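(* Let $Y$ be a separable Hilbert space and let $B$ be a positive self-adjoint operator on $Y$ which is bounded (so $D(B)=Y$). Then the operator $A=-\partial_{xx}^2+B$ with domain $H^2_{\mathrm{ul-s}}(\mathbb{R},Y)\cap L^2_{\mathrm{ul-s}}(\mathbb{R},D(B))$ is a sectorial operator on $L^2_{\mathrm{ul-s}}(\mathbb{R},Y)$, which generates an analytic semigroup $e^{-At}$ on $L^2_{\mathrm{ul-s}}(\mathbb{R},Y)$.
   Context: For a Banach space $E$, $\|u\|_{L^2_{\mathrm{ul}}(\mathbb{R},E)}=\sup_{a\in\mathbb{R}}\big(\int_a^{a+1}|u(x)|_E^2\,dx\big)^{1/2}$; $L^2_{\mathrm{ul-w}}(\mathbb{R},E)$ is the space of $u\in L^2_{\mathrm{loc}}(\mathbb{R},E)$ with finite norm, and $L^2_{\mathrm{ul-s}}(\mathbb{R},E)$ is the subspace of those $u\in L^2_{\mathrm{ul-w}}(\mathbb{R},E)$ such that $\|u-u(\cdot-\xi)\|_{L^2_{\mathrm{ul}}(\mathbb{R},E)}\to0$ as $\xi\to0$. $H^2_{\mathrm{ul-s}}(\mathbb{R},E)$ is the space of $u$ whose weak derivatives of order $\le2$ belong to $L^2_{\mathrm{ul-s}}(\mathbb{R},E)$. A sectorial operator on a Banach space $X$ is a closed, densely defined linear operator $A$ for which there are $z_0\in\mathbb{R}$, $\phi\in(0,\pi/2)$ and $M>0$ such that the sector $S_{z_0,\phi}=\{z\in\mathbb{C}\setminus\{z_0\}:\ \phi\le|\arg(z-z_0)|\le\pi\}$ is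 in the resolvent set of $A$ and $\|(z\,\mathrm{id}-A)^{-1}\|_{\mathcal{L}(X)}\le M/|z-z_0|$ for all $z\in S_{z_0,\phi}$. If $Y$ is real, resolvents are understood after complexification. *)

theory Defs
  imports "HOL-Analysis.Analysis"
begin

section \<open>Complex normed spaces, complex inner products, complexification\<close>

class complex_normed_vector = real_normed_vector +
  fixes scaleC :: "complex \<Rightarrow> 'a \<Rightarrow> 'a" (infixr "*\<^sub>C" 75)
  assumes scaleC_add_right: "c *\<^sub>C (x + y) = c *\<^sub>C x + c *\<^sub>C y"
    and scaleC_add_left: "(c + d) *\<^sub>C x = c *\<^sub>C x + d *\<^sub>C x"
    and scaleC_scaleC: "c *\<^sub>C d *\<^sub>C x = (c * d) *\<^sub>C x"
    and scaleC_of_real: "complex_of_real r *\<^sub>C x = r *\<^sub>R x"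
    and norm_scaleC: "norm (c *\<^sub>C x) = cmod c * norm x"

class complex_inner = complex_normed_vector +
  fixes cinner :: "'a \<Rightarrow> 'a \<Rightarrow> complex"
  assumes cinner_commute: "cinner x y = cnj (cinner y x)"
    and cinner_add_right: "cinner x (y + z) = cinner x y + cinner x z"
    and cinner_scaleC_right: "cinner x (c *\<^sub>C y) = c * cinner x y"
    and cinner_self: "cinner x x = complex_of_real ((norm x)\<^sup>2)"

lemma scaleC_minus_right: "c *\<^sub>C (- x) = - (c *\<^sub>C (x::'a::complex_normed_vector))"
proof -
  have "c *\<^sub>C (- x) = c *\<^sub>C (complex_of_real (- 1) *\<^sub>C x)"
    by (simp only: scaleC_of_real) simp
  also have "\<dots> = complex_of_real (- 1) *\<^sub>C c *\<^sub>C x"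
    by (simp only: scaleC_scaleC mult.commute)
  also have "\<dots> = - (c *\<^sub>C x)"
    by (simp only: scaleC_of_real) simp
  finally show ?thesis .
qed

lemma bounded_linear_scaleC: "bounded_linear (\<lambda>x::'a::complex_normed_vector. c *\<^sub>C x)"
proof (rule bounded_linear_intro[where K = "cmod c"])
  fix x :: 'a and r :: real
  show "c *\<^sub>C (r *\<^sub>R x) = r *\<^sub>R (c *\<^sub>C x)"
    by (simp only: scaleC_of_real[symmetric] scaleC_scaleC mult.commute)
qed (simp_all add: scaleC_add_right norm_scaleC mult.commute)

instantiation blinfun :: (real_normed_vector, complex_normed_vector) complex_normed_vector
begin

lift_definition scaleC_blinfun :: "complex \<Rightarrow> 'a \<Rightarrow>\<^sub>L 'b \<Rightarrow> 'a \<Rightarrow>\<^sub>L 'b" is "\<lambda>c f x. c *\<^sub>C f x"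
  using bounded_linear_compose[OF bounded_linear_scaleC] by blast

instance
proof
  fix c d :: complex and r :: real and f g :: "'a \<Rightarrow>\<^sub>L 'b"
  show "c *\<^sub>C (f + g) = c *\<^sub>C f + c *\<^sub>C g" by transfer (simp add: scaleC_add_right)
  show "(c + d) *\<^sub>C f = c *\<^sub>C f + d *\<^sub>C f" by transfer (simp add: scaleC_add_left)
  show a: "c *\<^sub>C d *\<^sub>C f = (c * d) *\<^sub>C f" for c d and f :: "'a \<Rightarrow>\<^sub>L 'b" by transfer (simp add: scaleC_scaleC)
  show b: "complex_of_real r *\<^sub>C f = r *\<^sub>R f" for r and f :: "'a \<Rightarrow>\<^sub>L 'b" by transfer (simp add: scaleC_of_real)
  have le: "norm (c *\<^sub>C f) \<le> cmod c * norm f" for c and f :: "'a \<Rightarrow>\<^sub>L 'b"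
  proof (rule norm_blinfun_bound)
    fix x
    show "norm ((c *\<^sub>C f) x) \<le> cmod c * norm f * norm x"
      using mult_left_mono[OF norm_blinfun[of f x], of "cmod c"]
      by (simp add: scaleC_blinfun.rep_eq norm_scaleC mult.assoc)
  qed simp
  show "norm (c *\<^sub>C f) = cmod c * norm f"
  proof (cases "c = 0")
    case True
    then show ?thesis using le[of c f] by simp
  next
    case False
    have "f = inverse c *\<^sub>C c *\<^sub>C f"
      using False b[of 1 f] by (simp add: a)
    then have "norm f \<le> cmod (inverse c) * norm (c *\<^sub>C f)"
      using le[of "inverse c" "c *\<^sub>C f"] by simp
    then have "cmod c * norm f \<le> norm (c *\<^sub>C f)"
      using False by (simp add: norm_inverse norm_divide field_simps)
    with le[of c f] show ?thesis by simp
  qed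
qed

end

text \<open>
  The complexification of a real normed space: \<open>Cplx x y\<close> stands for \<open>x + i y\<close>, and the norm is
  the Taylor norm \<open>sup\<^sub>t |Re (e\<^sup>i\<^sup>t (x + i y))|\<close>.  It is equivalent to
  \<open>|x| + |y|\<close>, and the notions below do not change under an equivalent norm.
\<close>

datatype 'a complexification = Cplx (re_part: 'a) (im_part: 'a)

instantiation complexification :: (real_normed_vector) complex_normed_vector
begin

definition "0 = Cplx 0 (0::'a)"
definition "w + w' = Cplx (re_part w + re_part w') (im_part w + im_part (w'::'a complexification))"
definition "- w = Cplx (- re_part w) (- im_part (w::'a complexification))"
definition "w - w' = Cplx (re_part w - re_part w') (im_part w - im_part (w'::'a complexification))"
definition "r *\<^sub>R w = Cplx (r *\<^sub>R re_part w) (r *\<^sub>R im_part (w::'a complexification))"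
definition "c *\<^sub>C w = Cplx (Re c *\<^sub>R re_part w - Im c *\<^sub>R im_part w)
                      (Re c *\<^sub>R im_part w + Im c *\<^sub>R re_part (w::'a complexification))"
definition norm_complexification :: "'a complexification \<Rightarrow> real"
  where "norm_complexification w = (SUP t. norm (re_part (cis t *\<^sub>C w)))"
definition "sgn w = inverse (norm w) *\<^sub>R (w::'a complexification)"
definition "dist w w' = norm (w - (w'::'a complexification))"
definition "(uniformity :: ('a complexification \<times> 'a complexification) filter)
  = (INF e\<in>{0<..}. principal {(w, w'). dist w w' < e})"
definition open_complexification :: "'a complexification set \<Rightarrow> bool"
  where "open_complexification S \<longleftrightarrow> (\<forall>w\<in>S. \<forall>\<^sub>F (w', v) in uniformity. w' = w \<longrightarrow> v \<in> S)"

lemmas cplx_defs = zero_complexification_def plus_complexification_def uminus_complexification_def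
  minus_complexification_def scaleR_complexification_def scaleC_complexification_def

instance
proof
  fix a b :: "'a complexification" and c d :: complex and r s :: real
  have bdd: "bdd_above (range (\<lambda>t. norm (re_part (cis t *\<^sub>C w))))" for w :: "'a complexification"
  proof (rule bdd_aboveI)
    fix q assume "q \<in> range (\<lambda>t. norm (re_part (cis t *\<^sub>C w)))"
    then obtain t where "q = norm (cos t *\<^sub>R re_part w - sin t *\<^sub>R im_part w)"
      by (auto simp: cplx_defs)
    also have "\<dots> \<le> norm (cos t *\<^sub>R re_part w) + norm (sin t *\<^sub>R im_part w)"
      by (rule norm_triangle_ineq4)
    also have "\<dots> \<le> norm (re_part w) + norm (im_part w)"
      by (intro add_mono) (simp_all add: mult_left_le_one_le)
    finally show "q \<le> norm (re_part w) + norm (im_part w)" .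
  qed
  have up: "norm (re_part (cis t *\<^sub>C w)) \<le> norm w" for t and w :: "'a complexification"
    unfolding norm_complexification_def by (rule cSUP_upper[OF _ bdd]) simp
  have least: "norm w \<le> K" if "\<And>t. norm (re_part (cis t *\<^sub>C w)) \<le> K"
    for K and w :: "'a complexification"
    unfolding norm_complexification_def by (rule cSUP_least) (use that in auto)
  show "a + b + e = a + (b + e)" "a + b = b + a" "0 + a = a" "- a + a = 0" "a - b = a + - b"
    for e :: "'a complexification"
    by (simp_all add: cplx_defs add.assoc add.commute)
  show "r *\<^sub>R (a + b) = r *\<^sub>R a + r *\<^sub>R b" "(r + s) *\<^sub>R a = r *\<^sub>R a + s *\<^sub>R a"
    "r *\<^sub>R s *\<^sub>R a = (r * s) *\<^sub>R a" "1 *\<^sub>R a = a"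
    by (simp_all add: cplx_defs scaleR_add_right scaleR_add_left)
  show "dist a b = norm (a - b)" by (rule dist_complexification_def)
  show "sgn a = inverse (norm a) *\<^sub>R a" by (rule sgn_complexification_def)
  show "(uniformity :: ('a complexification \<times> 'a complexification) filter)
    = (INF e\<in>{0<..}. principal {(w, w'). dist w w' < e})"
    by (rule uniformity_complexification_def)
  show "open S \<longleftrightarrow> (\<forall>w\<in>S. \<forall>\<^sub>F (w', v) in uniformity. w' = w \<longrightarrow> v \<in> S)"
    for S :: "'a complexification set" by (rule open_complexification_def)
  show addC: "c *\<^sub>C (a + b) = c *\<^sub>C a + c *\<^sub>C b" for c and a b :: "'a complexification"
    by (simp add: cplx_defs algebra_simps)
  show "(c + d) *\<^sub>C a = c *\<^sub>C a + d *\<^sub>C a" "complex_of_real r *\<^sub>C a = r *\<^sub>R a"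
    by (simp_all add: cplx_defs algebra_simps)
  show assC: "c *\<^sub>C d *\<^sub>C a = (c * d) *\<^sub>C a" for c d and a :: "'a complexification"
    by (simp add: cplx_defs algebra_simps)
  show "norm a = 0 \<longleftrightarrow> a = 0"
  proof
    assume "norm a = 0"
    then have "norm (re_part (cis 0 *\<^sub>C a)) \<le> 0" "norm (re_part (cis (pi/2) *\<^sub>C a)) \<le> 0"
      using up[of _ a] by metis+
    then show "a = 0" by (simp add: cplx_defs complexification.expand)
  next
    assume "a = 0"
    then show "norm a = 0" by (simp add: norm_complexification_def cplx_defs)
  qed
  show "norm (a + b) \<le> norm a + norm b"
  proof (rule least)
    fix t
    have "re_part (cis t *\<^sub>C (a + b)) = re_part (cis t *\<^sub>C a) + re_part (cis t *\<^sub>C b)"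
      unfolding addC by (simp add: plus_complexification_def)
    then show "norm (re_part (cis t *\<^sub>C (a + b))) \<le> norm a + norm b"
      unfolding \<open>re_part (cis t *\<^sub>C (a + b)) = _\<close>
      using norm_triangle_ineq[of "re_part (cis t *\<^sub>C a)" "re_part (cis t *\<^sub>C b)"] up[of t a] up[of t b]
      by linarith
  qed
  have rot: "norm (re_part (cis t *\<^sub>C c *\<^sub>C a)) = cmod c * norm (re_part (cis (t + Arg c) *\<^sub>C a))"
    for t c and a :: "'a complexification"
  proof -
    have "cis t * c = complex_of_real (cmod c) * cis (t + Arg c)"
      by (metis cis_mult mult.left_commute rcis_cmod_Arg rcis_def)
    then have "cis t *\<^sub>C c *\<^sub>C a = complex_of_real (cmod c) *\<^sub>C cis (t + Arg c) *\<^sub>C a"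
      by (simp only: assC)
    then have "re_part (cis t *\<^sub>C c *\<^sub>C a) = cmod c *\<^sub>R re_part (cis (t + Arg c) *\<^sub>C a)"
      by (simp add: scaleC_complexification_def)
    then show ?thesis by simp
  qed
  show nC: "norm (c *\<^sub>C a) = cmod c * norm a" for c and a :: "'a complexification"
  proof (rule antisym)
    show "norm (c *\<^sub>C a) \<le> cmod c * norm a"
      by (rule least) (simp add: rot up mult_left_mono)
    show "cmod c * norm a \<le> norm (c *\<^sub>C a)"
    proof (cases "c = 0")
      case True
      have "0 \<le> norm (c *\<^sub>C a)" using up[of 0 "c *\<^sub>C a"] norm_ge_zero order_trans by blast
      with True show ?thesis by simp
    next
      case False
      have "norm a \<le> norm (c *\<^sub>C a) / cmod c"
      proof (rule least)
        fix t
        have "cmod c * norm (re_part (cis t *\<^sub>C a)) \<le> norm (c *\<^sub>C a)"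
          using rot[of "t - Arg c" c a] up[of "t - Arg c" "c *\<^sub>C a"] by simp
        then show "norm (re_part (cis t *\<^sub>C a)) \<le> norm (c *\<^sub>C a) / cmod c"
          using False by (simp add: field_simps)
      qed
      then show ?thesis using False by (simp add: field_simps)
    qed
  qed
  have "r *\<^sub>R a = complex_of_real r *\<^sub>C a" by (simp add: cplx_defs)
  then show "norm (r *\<^sub>R a) = \<bar>r\<bar> * norm a" by (simp add: nC)
qed

end

section \<open>Uniformly local spaces\<close>

text \<open>
  \<open>L2ul_w\<close> and \<open>L2ul_s\<close> consist of functions; the quotient modulo null sets is the type
  \<open>l2uls\<close> below.  For separable \<open>E\<close> every Lebesgue measurable function is almost everywhere equal to a Borel measurable one,
  so it is enough to use \<^term>\<open>lborel\<close>.
\<close>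

definition l2_norm_on :: "real \<Rightarrow> (real \<Rightarrow> 'a::{banach, second_countable_topology}) \<Rightarrow> real" where
  "l2_norm_on a u = sqrt (LBINT x:{a..a+1}. (norm (u x))\<^sup>2)"

definition l2ul_norm :: "(real \<Rightarrow> 'a::{banach, second_countable_topology}) \<Rightarrow> real" where
  "l2ul_norm u = (SUP a. l2_norm_on a u)"

definition L2ul_w :: "(real \<Rightarrow> 'a::{banach, second_countable_topology}) set" where
  "L2ul_w = {u \<in> borel_measurable lborel.
     (\<forall>a. set_integrable lborel {a..a+1} (\<lambda>x. (norm (u x))\<^sup>2)) \<and>
     bdd_above (range (\<lambda>a. l2_norm_on a u))}"

definition L2ul_s :: "(real \<Rightarrow> 'a::{banach, second_countable_topology}) set" where
  "L2ul_s = {u \<in> L2ul_w. ((\<lambda>\<xi>. l2ul_norm (\<lambda>x. u x - u (x - \<xi>))) \<longlongrightarrow> 0) (at 0)}"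

lemma l2_norm_on_nonneg [simp]: "0 \<le> l2_norm_on a u"
  by (auto simp: l2_norm_on_def set_lebesgue_integral_def intro!: integral_nonneg_AE)

lemma l2_norm_on_square: "(l2_norm_on a u)\<^sup>2 = (LBINT x:{a..a+1}. (norm (u x))\<^sup>2)"
  unfolding l2_norm_on_def
  by (rule real_sqrt_pow2) (auto simp: set_lebesgue_integral_def intro!: integral_nonneg_AE)

lemma l2_norm_on_le: "u \<in> L2ul_w \<Longrightarrow> l2_norm_on a u \<le> l2ul_norm u"
  unfolding l2ul_norm_def L2ul_w_def by (auto intro!: cSUP_upper)

lemma l2ul_norm_le: "(\<And>a. l2_norm_on a u \<le> K) \<Longrightarrow> l2ul_norm u \<le> K"
  unfolding l2ul_norm_def by (rule cSUP_least) auto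

lemma l2ul_norm_nonneg: "u \<in> L2ul_w \<Longrightarrow> 0 \<le> l2ul_norm u"
  using l2_norm_on_le[of u 0] l2_norm_on_nonneg[of 0 u] by linarith

lemma L2ul_wI:
  assumes "u \<in> borel_measurable lborel"
    and "\<And>a. set_integrable lborel {a..a+1} (\<lambda>x. (norm (u x))\<^sup>2)"
    and "\<And>a. l2_norm_on a u \<le> K"
  shows "u \<in> L2ul_w"
  using assms unfolding L2ul_w_def by (auto intro!: bdd_aboveI)

lemma L2ul_w_dominated:
  fixes u :: "real \<Rightarrow> 'a::{banach, second_countable_topology}"
    and v :: "real \<Rightarrow> 'b::{banach, second_countable_topology}"
  assumes u: "u \<in> L2ul_w" and [measurable]: "v \<in> borel_measurable lborel"
    and K: "0 \<le> K" "AE x in lborel. norm (v x) \<le> K * norm (u x)"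
  shows "v \<in> L2ul_w" "l2ul_norm v \<le> K * l2ul_norm u"
proof -
  have iu: "set_integrable lborel {a..a+1} (\<lambda>x. (norm (u x))\<^sup>2)" for a
    using u by (auto simp: L2ul_w_def)
  have iKu: "set_integrable lborel {a..a+1} (\<lambda>x. K\<^sup>2 * (norm (u x))\<^sup>2)" for a
    using iu by auto
  have le: "AE x in lborel. (norm (v x))\<^sup>2 \<le> K\<^sup>2 * (norm (u x))\<^sup>2"
    using K(2)
  proof eventually_elim
    case (elim x)
    then show ?case using power_mono[of "norm (v x)" "K * norm (u x)" 2] by (simp add: power_mult_distrib)
  qed
  have iv: "set_integrable lborel {a..a+1} (\<lambda>x. (norm (v x))\<^sup>2)" for a
    unfolding set_integrable_def
  proof (rule Bochner_Integration.integrable_bound[OF iKu[of a, unfolded set_integrable_def]])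
    show "AE x in lborel. norm (indicat_real {a..a+1} x *\<^sub>R (norm (v x))\<^sup>2)
      \<le> norm (indicat_real {a..a+1} x *\<^sub>R (K\<^sup>2 * (norm (u x))\<^sup>2))"
      using le by eventually_elim (auto simp: indicator_def)
  qed measurable
  have b: "l2_norm_on a v \<le> K * l2_norm_on a u" for a
  proof (rule power2_le_imp_le)
    have "(LBINT x:{a..a+1}. (norm (v x))\<^sup>2) \<le> (LBINT x:{a..a+1}. K\<^sup>2 * (norm (u x))\<^sup>2)"
      using le by (intro set_integral_mono_AE iv iKu) auto
    then show "(l2_norm_on a v)\<^sup>2 \<le> (K * l2_norm_on a u)\<^sup>2"
      by (simp add: l2_norm_on_square power_mult_distrib)
  qed (use K(1) in simp)
  have b': "l2_norm_on a v \<le> K * l2ul_norm u" for a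
    using b[of a] mult_left_mono[OF l2_norm_on_le[OF u, of a] K(1)] by linarith
  show "v \<in> L2ul_w" by (rule L2ul_wI[OF _ iv b']) measurable
  show "l2ul_norm v \<le> K * l2ul_norm u" by (rule l2ul_norm_le) (rule b')
qed

lemma L2ul_w_add:
  fixes u v :: "real \<Rightarrow> 'a::{banach, second_countable_topology}"
  assumes u: "u \<in> L2ul_w" and v: "v \<in> L2ul_w"
  shows "(\<lambda>x. u x + v x) \<in> L2ul_w" "l2ul_norm (\<lambda>x. u x + v x) \<le> l2ul_norm u + l2ul_norm v"
proof -
  have [measurable]: "u \<in> borel_measurable lborel" "v \<in> borel_measurable lborel"
    using u v by (auto simp: L2ul_w_def)
  have iu: "set_integrable lborel {a..a+1} (\<lambda>x. (norm (u x))\<^sup>2)"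
    and iv: "set_integrable lborel {a..a+1} (\<lambda>x. (norm (v x))\<^sup>2)" for a
    using u v by (auto simp: L2ul_w_def)
  have young: "(norm (p + q))\<^sup>2 \<le> (1 + s) * (norm p)\<^sup>2 + (1 + 1/s) * (norm q)\<^sup>2"
    if "s > 0" for s and p q :: 'a
  proof -
    have "(norm (p + q))\<^sup>2 \<le> (norm p + norm q)\<^sup>2"
      by (intro power_mono norm_triangle_ineq) simp
    also have "\<dots> \<le> (1 + s) * (norm p)\<^sup>2 + (1 + 1/s) * (norm q)\<^sup>2"
    proof -
      have "0 \<le> (s * norm p - norm q)\<^sup>2 / s" using that by simp
      also have "\<dots> = s * (norm p)\<^sup>2 - 2 * norm p * norm q + (1/s) * (norm q)\<^sup>2"
        using that by (simp add: power2_eq_square field_simps)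
      finally show ?thesis by (simp add: power2_sum algebra_simps)
    qed
    finally show ?thesis .
  qed
  have ib: "set_integrable lborel {a..a+1} (\<lambda>x. (1 + s) * (norm (u x))\<^sup>2 + (1 + 1/s) * (norm (v x))\<^sup>2)"
    for a and s :: real
    using iu[of a] iv[of a] by (intro set_integral_add set_integrable_mult_right) auto
  have iw: "set_integrable lborel {a..a+1} (\<lambda>x. (norm (u x + v x))\<^sup>2)" for a
    unfolding set_integrable_def
  proof (rule Bochner_Integration.integrable_bound[OF ib[of a 1, unfolded set_integrable_def]])
    show "AE x in lborel. norm (indicat_real {a..a+1} x *\<^sub>R (norm (u x + v x))\<^sup>2)
      \<le> norm (indicat_real {a..a+1} x *\<^sub>R ((1 + 1) * (norm (u x))\<^sup>2 + (1 + 1/1) * (norm (v x))\<^sup>2))"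
      using young[of 1] by (auto simp: indicator_def)
  qed measurable
  have sq: "(l2_norm_on a (\<lambda>x. u x + v x))\<^sup>2
      \<le> (1 + s) * (l2_norm_on a u)\<^sup>2 + (1 + 1/s) * (l2_norm_on a v)\<^sup>2" if "s > 0" for a s
  proof -
    have "(LBINT x:{a..a+1}. (norm (u x + v x))\<^sup>2)
      \<le> (LBINT x:{a..a+1}. (1 + s) * (norm (u x))\<^sup>2 + (1 + 1/s) * (norm (v x))\<^sup>2)"
      by (rule set_integral_mono[OF iw ib]) (rule young[OF that])
    also have "\<dots> = (1 + s) * (LBINT x:{a..a+1}. (norm (u x))\<^sup>2)
        + (1 + 1/s) * (LBINT x:{a..a+1}. (norm (v x))\<^sup>2)"
      using iu[of a] iv[of a] by (subst set_integral_add) auto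
    finally show ?thesis by (simp only: l2_norm_on_square)
  qed
  have tri: "l2_norm_on a (\<lambda>x. u x + v x) \<le> l2_norm_on a u + l2_norm_on a v" for a
  proof (rule field_le_epsilon)
    fix e :: real assume e: "e > 0"
    define p q where "p = l2_norm_on a u + e/2" and "q = l2_norm_on a v + e/2"
    have pq: "p > 0" "q > 0" "l2_norm_on a u \<le> p" "l2_norm_on a v \<le> q"
      using e l2_norm_on_nonneg[of a u] l2_norm_on_nonneg[of a v] by (auto simp: p_def q_def add_nonneg_pos)
    have "(l2_norm_on a (\<lambda>x. u x + v x))\<^sup>2 \<le> (1 + q/p) * (l2_norm_on a u)\<^sup>2 + (1 + 1/(q/p)) * (l2_norm_on a v)\<^sup>2"
      by (rule sq) (use pq in simp)
    also have "\<dots> \<le> (1 + q/p) * p\<^sup>2 + (1 + 1/(q/p)) * q\<^sup>2"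
      using pq by (intro add_mono mult_left_mono power_mono) auto
    also have "\<dots> = (p + q)\<^sup>2"
      using pq by (simp add: power2_eq_square field_simps)
    finally have "l2_norm_on a (\<lambda>x. u x + v x) \<le> p + q"
      by (rule power2_le_imp_le) (use pq in simp)
    then show "l2_norm_on a (\<lambda>x. u x + v x) \<le> l2_norm_on a u + l2_norm_on a v + e"
      by (simp add: p_def q_def)
  qed
  have tri': "l2_norm_on a (\<lambda>x. u x + v x) \<le> l2ul_norm u + l2ul_norm v" for a
    using tri[of a] l2_norm_on_le[OF u, of a] l2_norm_on_le[OF v, of a] by linarith
  show "(\<lambda>x. u x + v x) \<in> L2ul_w" by (rule L2ul_wI[OF _ iw tri']) measurable
  show "l2ul_norm (\<lambda>x. u x + v x) \<le> l2ul_norm u + l2ul_norm v" by (rule l2ul_norm_le) (rule tri')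
qed

lemma L2ul_w_translate:
  fixes u :: "real \<Rightarrow> 'a::{banach, second_countable_topology}"
  assumes u: "u \<in> L2ul_w"
  shows "(\<lambda>x. u (x - \<xi>)) \<in> L2ul_w"
proof -
  have [measurable]: "u \<in> borel_measurable borel" using u by (auto simp: L2ul_w_def)
  have iu: "set_integrable lborel {a..a+1} (\<lambda>x. (norm (u x))\<^sup>2)" for a
    using u by (auto simp: L2ul_w_def)
  have ind: "indicat_real {a..a+1} x *\<^sub>R (norm (u (x - \<xi>)))\<^sup>2
    = (\<lambda>y. indicat_real {a-\<xi>..a-\<xi>+1} y *\<^sub>R (norm (u y))\<^sup>2) (-\<xi> + 1 * x)" for a x
    by (auto simp: indicator_def algebra_simps)
  have i: "set_integrable lborel {a..a+1} (\<lambda>x. (norm (u (x - \<xi>)))\<^sup>2)" for a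
    unfolding set_integrable_def ind
    by (rule lborel_integrable_real_affine) (use iu[of "a-\<xi>"] in \<open>auto simp: set_integrable_def\<close>)
  have "l2_norm_on a (\<lambda>x. u (x - \<xi>)) = l2_norm_on (a - \<xi>) u" for a
    unfolding l2_norm_on_def set_lebesgue_integral_def ind
    by (subst lborel_integral_real_affine[where c=1 and t="-\<xi>"]) auto
  then have "l2_norm_on a (\<lambda>x. u (x - \<xi>)) \<le> l2ul_norm u" for a
    using l2_norm_on_le[OF u] by simp
  then show ?thesis by (intro L2ul_wI[OF _ i]) auto
qed

lemma L2ul_w_diff_translate:
  assumes "u \<in> L2ul_w" shows "(\<lambda>x. u x - u (x - \<xi>)) \<in> L2ul_w"
proof -
  have "(\<lambda>x. - u (x - \<xi>)) \<in> L2ul_w"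
    using L2ul_w_translate[OF assms, of \<xi>]
    by (rule L2ul_w_dominated(1)[where K=1])
      (use L2ul_w_translate[OF assms, of \<xi>] in \<open>auto simp: L2ul_w_def\<close>)
  from L2ul_w_add(1)[OF assms this] show ?thesis by simp
qed

lemma L2ul_sD: "u \<in> L2ul_s \<Longrightarrow> u \<in> L2ul_w"
  by (simp add: L2ul_s_def)

lemma L2ul_s_map:
  fixes f :: "'a::{banach, second_countable_topology} \<Rightarrow> 'b::{banach, second_countable_topology}"
  assumes f: "bounded_linear f" and u: "u \<in> L2ul_s"
  shows "(\<lambda>x. f (u x)) \<in> L2ul_s"
proof -
  interpret bounded_linear f by fact
  obtain K where K: "0 \<le> K" "\<And>y. norm (f y) \<le> K * norm y"
    using nonneg_bounded by (auto simp: mult.commute)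
  have [measurable]: "f \<in> borel_measurable borel"
    by (intro borel_measurable_continuous_onI linear_continuous_on f)
  have dom: "(\<lambda>x. f (v x)) \<in> L2ul_w \<and> l2ul_norm (\<lambda>x. f (v x)) \<le> K * l2ul_norm v" if "v \<in> L2ul_w" for v
  proof -
    have [measurable]: "v \<in> borel_measurable lborel" using that by (simp add: L2ul_w_def)
    have "(\<lambda>x. f (v x)) \<in> borel_measurable lborel" by measurable
    then show ?thesis using L2ul_w_dominated[OF that, of "\<lambda>x. f (v x)" K] K by auto
  qed
  have w: "u \<in> L2ul_w" using u by (rule L2ul_sD)
  have "((\<lambda>\<xi>. l2ul_norm (\<lambda>x. f (u x) - f (u (x - \<xi>)))) \<longlongrightarrow> 0) (at 0)"
  proof (rule tendsto_sandwich)
    show "\<forall>\<^sub>F \<xi> in at 0. 0 \<le> l2ul_norm (\<lambda>x. f (u x) - f (u (x - \<xi>)))"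
      using dom[OF L2ul_w_diff_translate[OF w]] by (auto simp: diff[symmetric] intro!: l2ul_norm_nonneg always_eventually)
    show "\<forall>\<^sub>F \<xi> in at 0. l2ul_norm (\<lambda>x. f (u x) - f (u (x - \<xi>))) \<le> K * l2ul_norm (\<lambda>x. u x - u (x - \<xi>))"
      using dom[OF L2ul_w_diff_translate[OF w]] by (auto simp: diff[symmetric])
    show "((\<lambda>\<xi>. K * l2ul_norm (\<lambda>x. u x - u (x - \<xi>))) \<longlongrightarrow> 0) (at 0)"
      using u by (intro tendsto_mult_right_zero) (simp add: L2ul_s_def)
  qed simp
  then show ?thesis using dom[OF w] by (simp add: L2ul_s_def)
qed

lemma L2ul_s_add:
  fixes u v :: "real \<Rightarrow> 'a::{banach, second_countable_topology}"
  assumes u: "u \<in> L2ul_s" and v: "v \<in> L2ul_s"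
  shows "(\<lambda>x. u x + v x) \<in> L2ul_s"
proof -
  note w = L2ul_sD[OF u] L2ul_sD[OF v]
  have eq: "(\<lambda>x. (u x + v x) - (u (x - \<xi>) + v (x - \<xi>))) = (\<lambda>x. (u x - u (x - \<xi>)) + (v x - v (x - \<xi>)))" for \<xi>
    by (simp add: algebra_simps)
  note t = L2ul_w_add[OF L2ul_w_diff_translate[OF w(1)] L2ul_w_diff_translate[OF w(2)]]
  have "((\<lambda>\<xi>. l2ul_norm (\<lambda>x. (u x + v x) - (u (x - \<xi>) + v (x - \<xi>)))) \<longlongrightarrow> 0) (at 0)"
    unfolding eq
  proof (rule tendsto_sandwich)
    show "\<forall>\<^sub>F \<xi> in at 0. 0 \<le> l2ul_norm (\<lambda>x. (u x - u (x - \<xi>)) + (v x - v (x - \<xi>)))"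
      using l2ul_norm_nonneg[OF t(1)] by simp
    show "\<forall>\<^sub>F \<xi> in at 0. l2ul_norm (\<lambda>x. (u x - u (x - \<xi>)) + (v x - v (x - \<xi>)))
        \<le> l2ul_norm (\<lambda>x. u x - u (x - \<xi>)) + l2ul_norm (\<lambda>x. v x - v (x - \<xi>))"
      using t(2) by simp
    show "((\<lambda>\<xi>. l2ul_norm (\<lambda>x. u x - u (x - \<xi>)) + l2ul_norm (\<lambda>x. v x - v (x - \<xi>))) \<longlongrightarrow> 0) (at 0)"
      using u v by (intro tendsto_add_zero) (simp_all add: L2ul_s_def)
  qed simp
  then show ?thesis using L2ul_w_add(1)[OF w] by (simp add: L2ul_s_def)
qed

lemma L2ul_s_zero: "(\<lambda>x. 0) \<in> L2ul_s"
proof -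
  have "(\<lambda>x. 0) \<in> L2ul_w"
    by (rule L2ul_wI[where K=0]) (auto simp: l2_norm_on_def set_integrable_def)
  then show ?thesis by (simp add: L2ul_s_def l2ul_norm_def l2_norm_on_def)
qed

lemma l2ul_norm_cong_AE:
  fixes u v :: "real \<Rightarrow> 'a::{banach, second_countable_topology}"
  assumes "u \<in> L2ul_w" "v \<in> L2ul_w" "AE x in lborel. u x = v x"
  shows "l2ul_norm u = l2ul_norm v"
proof -
  have m: "u \<in> borel_measurable lborel" "v \<in> borel_measurable lborel"
    using assms by (auto simp: L2ul_w_def)
  have "AE x in lborel. norm (v x) \<le> 1 * norm (u x)" "AE x in lborel. norm (u x) \<le> 1 * norm (v x)"
    using assms(3) by (auto elim!: eventually_mono)
  then show ?thesis
    using L2ul_w_dominated(2)[OF assms(1) m(2), of 1] L2ul_w_dominated(2)[OF assms(2) m(1), of 1]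
    by simp
qed

lemma l2ul_norm_eq_0:
  fixes u :: "real \<Rightarrow> 'a::{banach, second_countable_topology}"
  assumes u: "u \<in> L2ul_w"
  shows "l2ul_norm u = 0 \<longleftrightarrow> (AE x in lborel. u x = 0)"
proof
  assume 0: "l2ul_norm u = 0"
  have "AE x in lborel. \<forall>n::int. x \<in> {real_of_int n..real_of_int n + 1} \<longrightarrow> u x = 0"
    unfolding AE_all_countable
  proof
    fix n :: int
    define a where "a = real_of_int n"
    have int: "integrable lborel (\<lambda>x. indicat_real {a..a+1} x *\<^sub>R (norm (u x))\<^sup>2)"
      using u by (auto simp: L2ul_w_def set_integrable_def)
    have "l2_norm_on a u = 0"
      using l2_norm_on_le[OF u, of a] 0 l2_norm_on_nonneg[of a u] by linarith
    then have "(\<integral>x. indicat_real {a..a+1} x *\<^sub>R (norm (u x))\<^sup>2 \<partial>lborel) = 0"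
      by (simp add: l2_norm_on_def set_lebesgue_integral_def)
    then have "AE x in lborel. indicat_real {a..a+1} x *\<^sub>R (norm (u x))\<^sup>2 = 0"
      by (subst integral_nonneg_eq_0_iff_AE[OF int, symmetric]) auto
    then show "AE x in lborel. x \<in> {real_of_int n..real_of_int n + 1} \<longrightarrow> u x = 0"
      unfolding a_def[symmetric] by eventually_elim (auto simp: indicator_def split: if_splits)
  qed
  then show "AE x in lborel. u x = 0"
  proof eventually_elim
    case (elim x)
    from elim[rule_format, of "\<lfloor>x\<rfloor>"] show ?case by auto
  qed
next
  assume "AE x in lborel. u x = 0"
  then have "l2ul_norm u = l2ul_norm (\<lambda>x. 0 :: 'a)"
    by (intro l2ul_norm_cong_AE u L2ul_sD L2ul_s_zero)
  then show "l2ul_norm u = 0" by (simp add: l2ul_norm_def l2_norm_on_def)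
qed

definition l2uls_rel :: "(real \<Rightarrow> 'a::{banach, second_countable_topology}) \<Rightarrow> (real \<Rightarrow> 'a) \<Rightarrow> bool" where
  "l2uls_rel u v \<longleftrightarrow> u \<in> L2ul_s \<and> v \<in> L2ul_s \<and> (AE x in lborel. u x = v x)"

lemma part_equivp_l2uls_rel: "part_equivp l2uls_rel"
proof (rule part_equivpI)
  show "\<exists>u. l2uls_rel u u" using L2ul_s_zero by (auto simp: l2uls_rel_def)
  show "symp l2uls_rel" by (rule sympI) (auto simp: l2uls_rel_def elim!: eventually_mono)
  show "transp l2uls_rel"
    by (rule transpI) (auto simp: l2uls_rel_def elim: eventually_elim2)
qed

quotient_type (overloaded) 'a l2uls = "real \<Rightarrow> 'a::{banach, second_countable_topology}" / partial: l2uls_rel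
  by (rule part_equivp_l2uls_rel)

lift_definition l2uls_map :: "('a::{banach, second_countable_topology} \<Rightarrow>\<^sub>L 'b::{banach, second_countable_topology})
    \<Rightarrow> 'a l2uls \<Rightarrow> 'b l2uls" is "\<lambda>f u x. blinfun_apply f (u x)"
  by (auto simp: l2uls_rel_def L2ul_s_map blinfun.bounded_linear_right elim!: eventually_mono)

instantiation l2uls :: ("{banach, second_countable_topology}") real_normed_vector
begin

lift_definition zero_l2uls :: "'a l2uls" is "\<lambda>x. 0"
  by (simp add: l2uls_rel_def L2ul_s_zero)

lift_definition plus_l2uls :: "'a l2uls \<Rightarrow> 'a l2uls \<Rightarrow> 'a l2uls" is "\<lambda>u v x. u x + v x"
  by (auto simp: l2uls_rel_def L2ul_s_add elim: eventually_elim2)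

lift_definition uminus_l2uls :: "'a l2uls \<Rightarrow> 'a l2uls" is "\<lambda>u x. - u x"
  by (auto simp: l2uls_rel_def intro!: L2ul_s_map[OF bounded_linear_minus[OF bounded_linear_ident]]
      elim!: eventually_mono)

lift_definition scaleR_l2uls :: "real \<Rightarrow> 'a l2uls \<Rightarrow> 'a l2uls" is "\<lambda>r u x. r *\<^sub>R u x"
  by (auto simp: l2uls_rel_def intro!: L2ul_s_map[OF bounded_linear_scaleR_right]
      elim!: eventually_mono)

lift_definition norm_l2uls :: "'a l2uls \<Rightarrow> real" is l2ul_norm
  by (auto simp: l2uls_rel_def intro!: l2ul_norm_cong_AE L2ul_sD)

definition "u - v = u + - (v::'a l2uls)"
definition "sgn u = inverse (norm u) *\<^sub>R (u::'a l2uls)"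
definition "dist u v = norm (u - (v::'a l2uls))"
definition "(uniformity :: ('a l2uls \<times> 'a l2uls) filter)
  = (INF e\<in>{0<..}. principal {(u, v). dist u v < e})"
definition open_l2uls :: "'a l2uls set \<Rightarrow> bool"
  where "open_l2uls S \<longleftrightarrow> (\<forall>u\<in>S. \<forall>\<^sub>F (u', v) in uniformity. u' = u \<longrightarrow> v \<in> S)"

instance
proof
  fix a b c :: "'a l2uls" and r s :: real
  show "a + b + c = a + (b + c)"
    by transfer (simp add: l2uls_rel_def L2ul_s_add add.assoc)
  show "a + b = b + a"
    by transfer (simp add: l2uls_rel_def L2ul_s_add add.commute)
  show "0 + a = a"
    by transfer (simp add: l2uls_rel_def)
  show "- a + a = 0"
    by transfer (simp add: l2uls_rel_def L2ul_s_zero)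
  show "a - b = a + - b" by (rule minus_l2uls_def)
  note sc = L2ul_s_map[OF bounded_linear_scaleR_right]
  show "r *\<^sub>R (a + b) = r *\<^sub>R a + r *\<^sub>R b"
    by transfer (simp add: l2uls_rel_def L2ul_s_add sc flip: scaleR_add_right)
  show "(r + s) *\<^sub>R a = r *\<^sub>R a + s *\<^sub>R a"
    by transfer (simp add: l2uls_rel_def L2ul_s_add sc flip: scaleR_add_left)
  show "r *\<^sub>R s *\<^sub>R a = (r * s) *\<^sub>R a"
    by transfer (simp add: l2uls_rel_def sc)
  show "1 *\<^sub>R a = a"
    by transfer (simp add: l2uls_rel_def)
  show "dist a b = norm (a - b)" by (rule dist_l2uls_def)
  show "sgn a = inverse (norm a) *\<^sub>R a" by (rule sgn_l2uls_def)
  show "(uniformity :: ('a l2uls \<times> 'a l2uls) filter)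
    = (INF e\<in>{0<..}. principal {(u, v). dist u v < e})" by (rule uniformity_l2uls_def)
  show "open S \<longleftrightarrow> (\<forall>u\<in>S. \<forall>\<^sub>F (u', v) in uniformity. u' = u \<longrightarrow> v \<in> S)" for S :: "'a l2uls set"
    by (rule open_l2uls_def)
  show "norm a = 0 \<longleftrightarrow> a = 0"
    by transfer (simp add: l2uls_rel_def L2ul_s_zero l2ul_norm_eq_0 L2ul_sD)
  show "norm (a + b) \<le> norm a + norm b"
    by transfer (simp add: l2uls_rel_def L2ul_w_add(2) L2ul_sD)
  show "norm (r *\<^sub>R a) = \<bar>r\<bar> * norm a"
  proof transfer
    fix r :: real and u :: "real \<Rightarrow> 'a"
    assume "l2uls_rel u u"
    then have u: "u \<in> L2ul_s" by (simp add: l2uls_rel_def)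
    have "l2_norm_on a (\<lambda>x. r *\<^sub>R u x) = \<bar>r\<bar> * l2_norm_on a u" for a
      by (simp add: l2_norm_on_def power_mult_distrib real_sqrt_mult)
    note eq = this
    show "l2ul_norm (\<lambda>x. r *\<^sub>R u x) = \<bar>r\<bar> * l2ul_norm u"
    proof (rule antisym)
      show "l2ul_norm (\<lambda>x. r *\<^sub>R u x) \<le> \<bar>r\<bar> * l2ul_norm u"
        by (rule l2ul_norm_le) (simp add: eq mult_left_mono l2_norm_on_le L2ul_sD u)
      show "\<bar>r\<bar> * l2ul_norm u \<le> l2ul_norm (\<lambda>x. r *\<^sub>R u x)"
      proof (cases "r = 0")
        case True
        then show ?thesis by (simp add: l2ul_norm_def l2_norm_on_def)
      next
        case False
        have "l2ul_norm u \<le> l2ul_norm (\<lambda>x. r *\<^sub>R u x) / \<bar>r\<bar>"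
          using False l2_norm_on_le[OF L2ul_sD[OF sc[OF u, of r]]]
          by (intro l2ul_norm_le) (simp add: eq field_simps)
        then show ?thesis using False by (simp add: field_simps)
      qed
    qed
  qed
qed

end

instantiation l2uls :: ("{complex_normed_vector, banach, second_countable_topology}") complex_normed_vector
begin

lift_definition scaleC_l2uls :: "complex \<Rightarrow> 'a l2uls \<Rightarrow> 'a l2uls" is "\<lambda>c u x. c *\<^sub>C u x"
  by (auto simp: l2uls_rel_def intro!: L2ul_s_map[OF bounded_linear_scaleC] elim!: eventually_mono)

instance
proof
  fix a b :: "'a l2uls" and c d :: complex and r :: real
  note sc = L2ul_s_map[OF bounded_linear_scaleC]
  show "c *\<^sub>C (a + b) = c *\<^sub>C a + c *\<^sub>C b"
    by transfer (simp add: l2uls_rel_def L2ul_s_add sc flip: scaleC_add_right)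
  show "(c + d) *\<^sub>C a = c *\<^sub>C a + d *\<^sub>C a"
    by transfer (simp add: l2uls_rel_def L2ul_s_add sc flip: scaleC_add_left)
  show "c *\<^sub>C d *\<^sub>C a = (c * d) *\<^sub>C a"
    by transfer (simp add: l2uls_rel_def sc scaleC_scaleC)
  show "complex_of_real r *\<^sub>C a = r *\<^sub>R a"
    by transfer (simp add: l2uls_rel_def L2ul_s_map[OF bounded_linear_scaleR_right] scaleC_of_real)
  have "norm (c *\<^sub>C a) = norm (cmod c *\<^sub>R a)"
    by transfer (simp add: l2ul_norm_def l2_norm_on_def norm_scaleC)
  then show "norm (c *\<^sub>C a) = cmod c * norm a" by simp
qed

end

section \<open>Weak derivatives and \<open>H\<^sup>2\<^sub>u\<^sub>l\<^sub>-\<^sub>s\<close>\<close>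

definition test_functions :: "(real \<Rightarrow> real) set" where
  "test_functions = {\<phi>. (\<forall>k x. (deriv ^^ k) \<phi> differentiable (at x)) \<and> compact (closure {x. \<phi> x \<noteq> 0})}"

definition has_weak_deriv ::
  "nat \<Rightarrow> (real \<Rightarrow> 'a::{banach, second_countable_topology}) \<Rightarrow> (real \<Rightarrow> 'a) \<Rightarrow> bool" where
  "has_weak_deriv k u v \<longleftrightarrow> (\<forall>\<phi>\<in>test_functions.
     (LBINT x. (deriv ^^ k) \<phi> x *\<^sub>R u x) = (-1) ^ k *\<^sub>R (LBINT x. \<phi> x *\<^sub>R v x))"

definition weak_deriv :: "nat \<Rightarrow> 'a::{banach, second_countable_topology} l2uls \<Rightarrow> 'a l2uls" where
  "weak_deriv k u = (THE v. has_weak_deriv k (rep_l2uls u) (rep_l2uls v))"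

definition H2ul_s :: "'a::{banach, second_countable_topology} l2uls set" where
  "H2ul_s = {u. \<forall>k\<le>2. \<exists>v. has_weak_deriv k (rep_l2uls u) (rep_l2uls v)}"

text \<open>
  \<open>L\<^sup>2\<^sub>u\<^sub>l\<^sub>-\<^sub>s(\<real>, D(B))\<close> for an everywhere defined \<open>B\<close>: the graph norm of \<open>y\<close> is the norm of the pair
  \<open>(y, B y)\<close>.
\<close>

definition L2ul_s_dom :: "('a::{banach, second_countable_topology} \<Rightarrow>\<^sub>L 'a) \<Rightarrow> 'a l2uls set" where
  "L2ul_s_dom B = {u. (\<lambda>x. (rep_l2uls u x, B (rep_l2uls u x))) \<in> L2ul_s}"

definition A_dom :: "('a::{banach, second_countable_topology} \<Rightarrow>\<^sub>L 'a) \<Rightarrow> 'a l2uls set" where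
  "A_dom B = H2ul_s \<inter> L2ul_s_dom B"

definition A_op :: "('a::{banach, second_countable_topology} \<Rightarrow>\<^sub>L 'a) \<Rightarrow> 'a l2uls \<Rightarrow> 'a l2uls" where
  "A_op B u = - weak_deriv 2 u + l2uls_map B u"

section \<open>Sectorial operators\<close>

text \<open>
  An unbounded operator is given by its domain \<open>D\<close> and a map \<open>A\<close>, of which only the values on \<open>D\<close>
  matter.
\<close>

definition closed_operator :: "'x::real_normed_vector set \<Rightarrow> ('x \<Rightarrow> 'x) \<Rightarrow> bool" where
  "closed_operator D A \<longleftrightarrow> closed {(u, A u) |u. u \<in> D}"

definition densely_defined :: "'x::real_normed_vector set \<Rightarrow> bool" where
  "densely_defined D \<longleftrightarrow> closure D = UNIV"

definition linear_operator :: "'x::real_normed_vector set \<Rightarrow> ('x \<Rightarrow> 'x) \<Rightarrow> bool" where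
  "linear_operator D A \<longleftrightarrow> 0 \<in> D \<and>
     (\<forall>u\<in>D. \<forall>v\<in>D. u + v \<in> D \<and> A (u + v) = A u + A v) \<and>
     (\<forall>u\<in>D. \<forall>r. r *\<^sub>R u \<in> D \<and> A (r *\<^sub>R u) = r *\<^sub>R A u)"

definition clinear_operator :: "'x::complex_normed_vector set \<Rightarrow> ('x \<Rightarrow> 'x) \<Rightarrow> bool" where
  "clinear_operator D A \<longleftrightarrow> 0 \<in> D \<and>
     (\<forall>u\<in>D. \<forall>v\<in>D. u + v \<in> D \<and> A (u + v) = A u + A v) \<and>
     (\<forall>u\<in>D. \<forall>c. c *\<^sub>C u \<in> D \<and> A (c *\<^sub>C u) = c *\<^sub>C A u)"

text \<open>
  \<open>R\<close> is a bounded two-sided inverse of \<open>z id - A : D \<rightarrow> X\<close>; it is only required to be real linear,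
  but for a complex linear \<open>A\<close> it is automatically complex linear.
\<close>

definition is_resolvent :: "'x::complex_normed_vector set \<Rightarrow> ('x \<Rightarrow> 'x) \<Rightarrow> complex \<Rightarrow> ('x \<Rightarrow>\<^sub>L 'x) \<Rightarrow> bool" where
  "is_resolvent D A z R \<longleftrightarrow>
     (\<forall>f. R f \<in> D \<and> z *\<^sub>C R f - A (R f) = f) \<and> (\<forall>u\<in>D. R (z *\<^sub>C u - A u) = u)"

definition resolvent_set :: "'x::complex_normed_vector set \<Rightarrow> ('x \<Rightarrow> 'x) \<Rightarrow> complex set" where
  "resolvent_set D A = {z. \<exists>R. is_resolvent D A z R}"

definition resolvent :: "'x::complex_normed_vector set \<Rightarrow> ('x \<Rightarrow> 'x) \<Rightarrow> complex \<Rightarrow> 'x \<Rightarrow>\<^sub>L 'x" where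
  "resolvent D A z = (THE R. is_resolvent D A z R)"

definition sector :: "real \<Rightarrow> real \<Rightarrow> complex set" where
  "sector z\<^sub>0 \<phi> = {z. z \<noteq> of_real z\<^sub>0 \<and> \<phi> \<le> \<bar>Arg (z - of_real z\<^sub>0)\<bar> \<and> \<bar>Arg (z - of_real z\<^sub>0)\<bar> \<le> pi}"

definition sector_resolvent_bound :: "'x::complex_normed_vector set \<Rightarrow> ('x \<Rightarrow> 'x) \<Rightarrow> bool" where
  "sector_resolvent_bound D A \<longleftrightarrow> (\<exists>z\<^sub>0 \<phi> M. 0 < \<phi> \<and> \<phi> < pi / 2 \<and> 0 < M \<and>
     sector z\<^sub>0 \<phi> \<subseteq> resolvent_set D A \<and>
     (\<forall>z\<in>sector z\<^sub>0 \<phi>. norm (resolvent D A z) \<le> M / cmod (z - of_real z\<^sub>0)))"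

definition sectorial :: "'x::complex_normed_vector set \<Rightarrow> ('x \<Rightarrow> 'x) \<Rightarrow> bool" where
  "sectorial D A \<longleftrightarrow> clinear_operator D A \<and> closed_operator D A \<and> densely_defined D \<and>
     sector_resolvent_bound D A"

definition complexify_dom :: "'x set \<Rightarrow> 'x complexification set" where
  "complexify_dom D = {w. re_part w \<in> D \<and> im_part w \<in> D}"

definition complexify_op :: "('x \<Rightarrow> 'x) \<Rightarrow> 'x complexification \<Rightarrow> 'x complexification" where
  "complexify_op A w = Cplx (A (re_part w)) (A (im_part w))"

definition real_sectorial :: "'x::real_normed_vector set \<Rightarrow> ('x \<Rightarrow> 'x) \<Rightarrow> bool" where
  "real_sectorial D A \<longleftrightarrow> linear_operator D A \<and> closed_operator D A \<and> densely_defined D \<and>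
     sector_resolvent_bound (complexify_dom D) (complexify_op A)"

section \<open>Analytic semigroups\<close>

definition is_generator :: "(real \<Rightarrow> 'x::real_normed_vector \<Rightarrow>\<^sub>L 'x) \<Rightarrow> 'x set \<Rightarrow> ('x \<Rightarrow> 'x) \<Rightarrow> bool" where
  "is_generator S D G \<longleftrightarrow>
     D = {x. \<exists>y. ((\<lambda>t. (1 / t) *\<^sub>R (S t x - x)) \<longlongrightarrow> y) (at_right 0)} \<and>
     (\<forall>x\<in>D. ((\<lambda>t. (1 / t) *\<^sub>R (S t x - x)) \<longlongrightarrow> G x) (at_right 0))"

definition open_sector :: "real \<Rightarrow> complex set" where
  "open_sector \<delta> = {z. z \<noteq> 0 \<and> \<bar>Arg z\<bar> < \<delta>}"

text \<open>
  Holomorphy is meant in the operator norm: the Frechet derivative at \<open>z\<close> is multiplication by some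
  bounded operator \<open>L\<close>.
\<close>

definition analytic_semigroup :: "real \<Rightarrow> (complex \<Rightarrow> 'x::complex_normed_vector \<Rightarrow>\<^sub>L 'x) \<Rightarrow> bool" where
  "analytic_semigroup \<delta> T \<longleftrightarrow> 0 < \<delta> \<and> \<delta> \<le> pi / 2 \<and>
     T 0 = id_blinfun \<and>
     (\<forall>z\<in>open_sector \<delta> \<union> {0}. \<forall>w\<in>open_sector \<delta> \<union> {0}. T (z + w) = T z o\<^sub>L T w) \<and>
     (\<forall>z\<in>open_sector \<delta>. \<forall>c x. T z (c *\<^sub>C x) = c *\<^sub>C T z x) \<and>
     (\<forall>z\<in>open_sector \<delta>. \<exists>L. (T has_derivative (\<lambda>h. h *\<^sub>C L)) (at z)) \<and>
     (\<forall>x. ((\<lambda>z. T z x) \<longlongrightarrow> x) (at 0 within open_sector \<delta>))"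

text \<open>The semigroup \<open>e\<^sup>-\<^sup>A\<^sup>t\<close> is the one generated by \<open>- A\<close>.\<close>

definition generates_analytic_semigroup :: "'x::complex_normed_vector set \<Rightarrow> ('x \<Rightarrow> 'x) \<Rightarrow> bool" where
  "generates_analytic_semigroup D A \<longleftrightarrow> (\<exists>\<delta> T. analytic_semigroup \<delta> T \<and>
     is_generator (\<lambda>t. T (of_real t)) D (\<lambda>u. - A u))"

text \<open>
  On a real space, the semigroup \<open>S\<close> consists of real operators, and its complexification extends
  to an analytic semigroup; this forces \<open>S\<close> to be a strongly continuous semigroup.
\<close>

definition real_generates_analytic_semigroup :: "'x::real_normed_vector set \<Rightarrow> ('x \<Rightarrow> 'x) \<Rightarrow> bool" where
  "real_generates_analytic_semigroup D A \<longleftrightarrow> (\<exists>\<delta> T S. analytic_semigroup \<delta> T \<and>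
     (\<forall>t\<ge>0. \<forall>x y. T (of_real t) (Cplx x y) = Cplx (blinfun_apply (S t) x) (blinfun_apply (S t) y)) \<and>
     is_generator S D (\<lambda>u. - A u))"

section \<open>Positive self-adjoint bounded operators\<close>

definition positive_selfadjoint :: "('a::real_inner \<Rightarrow>\<^sub>L 'a) \<Rightarrow> bool" where
  "positive_selfadjoint B \<longleftrightarrow> (\<forall>x y. inner (B x) y = inner x (B y)) \<and> (\<forall>x. 0 \<le> inner (B x) x)"

definition complex_positive_selfadjoint :: "('a::complex_inner \<Rightarrow>\<^sub>L 'a) \<Rightarrow> bool" where
  "complex_positive_selfadjoint B \<longleftrightarrow> (\<forall>c x. B (c *\<^sub>C x) = c *\<^sub>C B x) \<and>
     (\<forall>x y. cinner (B x) y = cinner x (B y)) \<and> (\<forall>x. 0 \<le> Re (cinner (B x) x))"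

end

theory Submission
  imports Defs "HOL-Probability.Distributions" "HOL-Computational_Algebra.Polynomial"
begin

text \<open>
  By definition \<open>L\<^sup>2\<^sub>u\<^sub>l\<^sub>-\<^sub>s(\<real>, Y)\<close> is the space on which the translations
  \<open>U(s) u = u(\<cdot> - s)\<close> are strongly continuous, so \<open>U\<close> is a strongly continuous group of
  isometries. Testing against smooth functions shows that its generator \<open>G\<close> is minus the weak
  derivative (\<open>weak_deriv_iff_gen\<close>). Hence \<open>A = B - G\<^sup>2\<close>, where the bounded operator \<open>B\<close>,
  acting pointwise, commutes with \<open>U\<close>. Everything that is claimed of \<open>A\<close> holds for
  \<open>B - G\<^sup>2\<close> whenever \<open>G\<close> generates a group of isometries of a complex Banach space and a
  bounded \<open>B\<close> commutes with the group; the locale \<open>perturbed_square\<close> is about this situation.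

  Resolvents. For \<open>Re l > 0\<close> the Laplace transform of \<open>U\<close> inverts \<open>l - G\<close> and has norm at
  most \<open>1 / Re l\<close>; that of \<open>s \<mapsto> U(-s)\<close> inverts \<open>l + G\<close>. Their product inverts
  \<open>l\<^sup>2 - G\<^sup>2\<close> with norm at most \<open>1 / (Re l)\<^sup>2\<close>. For \<open>l\<^sup>2 = - z\<close> one has
  \<open>(Re l)\<^sup>2 = (|z| - Re z) / 2\<close>, which is comparable to \<open>|z|\<close> away from a sector around the
  positive half-axis. Moving the vertex of the sector far enough to the left makes \<open>(Re l)\<^sup>2\<close> large
  against the norm of \<open>B\<close>, and \<open>B\<close> is then absorbed by a contraction argument
  (\<open>resolvent_bound\<close>, \<open>sector_bounds\<close>).

  Semigroup. The semigroup is written down explicitly: \<open>e\<^sup>-\<^sup>z\<^sup>A\<close> is the Gaussian average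
  \<open>(4\<pi>z)\<^sup>-\<^sup>1\<^sup>/\<^sup>2 \<integral> exp (- s\<^sup>2 / 4z) U(s) ds\<close> followed by the exponential series of \<open>- z B\<close>. The
  Gaussian average is holomorphic in the operator norm, and two integrations by parts show that its
  derivative on \<open>D(G\<^sup>2)\<close> is \<open>G\<^sup>2\<close> times itself (\<open>heat_has_derivative\<close>). All other properties
  follow from this differential equation. For the semigroup law, the \<open>s\<close>-derivative of
  \<open>T(z + (1 - s) w) T(s w) x\<close> vanishes (\<open>heat_exp_add\<close>); that the complex Gaussians have
  integral one is the same equation for the trivial group (\<open>heat_normalization\<close>). The generator is
  exactly \<open>- A\<close> because the resolvents of \<open>A\<close> commute with the semigroup (\<open>generator\<close>).

  If \<open>Y\<close> is real, the group and \<open>B\<close> are extended to the complexification; the semigroup found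
  there commutes with complex conjugation at real times and therefore restricts to a real one
  (\<open>real_perturbed_square\<close>).

  On the concrete side there remain the completeness of \<open>L\<^sup>2\<^sub>u\<^sub>l\<^sub>-\<^sub>s\<close> and the fact that test functions
  separate its points (\<open>pairing_separates\<close>).
\<close>

section \<open>Improper integrals of vector-valued functions\<close>

text \<open>
  The gauge integral is used for vector-valued integrals: unlike the Bochner integral it does not ask
  for separability of the target, and the uniformly local spaces are in general not separable.
\<close>

lemma integrable_on_interval_dominated:
  fixes f :: "real \<Rightarrow> 'x::banach"
  assumes "continuous_on UNIV f" "closed S" "is_interval S"
    and "\<And>s. s \<in> S \<Longrightarrow> norm (f s) \<le> g s" "g integrable_on S"
  shows "f integrable_on S"
proof (rule integrable_on_all_intervals_integrable_bound[OF _ assms(4,5)])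
  fix a b :: real
  have "compact (S \<inter> {a..b})" "connected (S \<inter> {a..b})"
    using assms(2,3) by (auto intro!: closed_Int_compact is_interval_connected is_interval_Int is_interval_cc)
  then obtain c d where "S \<inter> {a..b} = {c..d}"
    by (metis connected_compact_interval_1)
  moreover have "f integrable_on {c..d}"
    by (intro integrable_continuous_interval continuous_on_subset[OF assms(1)]) auto
  ultimately show "(\<lambda>s. if s \<in> S then f s else 0) integrable_on cbox a b"
    by (simp add: integrable_restrict_Int)
qed auto

lemma not_ex_cbox_halfline: "\<nexists>a b. {0..} = cbox a (b::real)"
proof clarify
  fix a b :: real assume eq: "{0..} = cbox a b"
  have "max 0 b + 1 \<in> {0::real..}" by auto
  then show False unfolding eq by auto
qed

lemma not_ex_cbox_line: "\<nexists>a b. UNIV = cbox a (b::real)"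
  by (metis bounded_cbox not_bounded_UNIV)

text \<open>
  The fundamental theorem of calculus on the half-line and on the line, for functions that vanish at
  infinity. It turns differential equations into identities between Laplace or Gaussian averages.
\<close>

lemma integral_vector_derivative_halfline:
  fixes F :: "real \<Rightarrow> 'x::banach"
  assumes "\<And>s. 0 \<le> s \<Longrightarrow> (F has_vector_derivative F' s) (at s)" "F' integrable_on {0..}" "(F \<longlongrightarrow> 0) at_top"
  shows "integral {0..} F' = - F 0"
proof -
  have "norm (integral {0..} F' + F 0) \<le> e" if e: "e > 0" for e
  proof -
    obtain B where B: "B > 0" "\<And>a b. ball 0 B \<subseteq> cbox a b \<Longrightarrow>
        \<exists>z. ((\<lambda>s. if s \<in> {0..} then F' s else 0) has_integral z) (cbox a b) \<and> norm (z - integral {0..} F') < e/2"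
      using has_integral_altD[OF integrable_integral[OF assms(2)] not_ex_cbox_halfline half_gt_zero[OF e]]
      by metis
    obtain N where N: "\<And>s. s \<ge> N \<Longrightarrow> norm (F s) < e/2"
      using assms(3) half_gt_zero[OF e] unfolding tendsto_iff eventually_at_top_linorder dist_norm
      by (metis diff_zero)
    define b where "b = max B (max N 0)"
    have "ball 0 B \<subseteq> cbox (-b) b" by (auto simp: b_def dist_norm)
    then obtain z where z: "((\<lambda>s. if s \<in> {0..} then F' s else 0) has_integral z) (cbox (-b) b)"
      "norm (z - integral {0..} F') < e/2" using B by blast
    have "(F' has_integral (F b - F 0)) {0..b}"
      by (rule fundamental_theorem_of_calculus)
        (use assms(1) in \<open>auto simp: b_def intro: has_vector_derivative_at_within\<close>)
    moreover have "{0..} \<inter> cbox (-b) b = {0..b}" by (auto simp: b_def)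
    ultimately have "z = F b - F 0"
      using z(1) by (metis has_integral_restrict_Int has_integral_unique)
    moreover have "norm (F b) < e/2" by (rule N) (simp add: b_def)
    moreover have "integral {0..} F' + F 0 = F b - ((F b - F 0) - integral {0..} F')" by simp
    ultimately show ?thesis using z(2) norm_triangle_ineq4[of "F b" "(F b - F 0) - integral {0..} F'"]
      by (simp only:)
  qed
  then have "norm (integral {0..} F' + F 0) \<le> 0" by (rule field_le_epsilon) auto
  then show ?thesis by (simp add: eq_neg_iff_add_eq_0)
qed

lemma integral_vector_derivative_line:
  fixes F :: "real \<Rightarrow> 'x::banach"
  assumes "\<And>s. (F has_vector_derivative F' s) (at s)" "F' integrable_on UNIV"
    "(F \<longlongrightarrow> 0) at_top" "(F \<longlongrightarrow> 0) at_bot"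
  shows "integral UNIV F' = 0"
proof -
  have "norm (integral UNIV F') \<le> e" if e: "e > 0" for e
  proof -
    have e3: "e/3 > 0" using e by simp
    obtain B where B: "B > 0" "\<And>a b. ball 0 B \<subseteq> cbox a b \<Longrightarrow>
        \<exists>z. (F' has_integral z) (cbox a b) \<and> norm (z - integral UNIV F') < e/3"
      using has_integral_altD[OF integrable_integral[OF assms(2)] not_ex_cbox_line e3]
      unfolding if_P[OF UNIV_I] by metis
    obtain N where N: "\<And>s. s \<ge> N \<Longrightarrow> norm (F s) < e/3"
      using assms(3) e3 unfolding tendsto_iff eventually_at_top_linorder dist_norm
      by (metis diff_zero)
    obtain N' where N': "\<And>s. s \<le> N' \<Longrightarrow> norm (F s) < e/3"
      using assms(4) e3 unfolding tendsto_iff eventually_at_bot_linorder dist_norm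
      by (metis diff_zero)
    define b where "b = max B (max N (-N'))"
    have "ball 0 B \<subseteq> cbox (-b) b" by (auto simp: b_def dist_norm)
    then obtain z where z: "(F' has_integral z) (cbox (-b) b)"
      "norm (z - integral UNIV F') < e/3" using B by blast
    have "(F' has_integral (F b - F (-b))) {-b..b}"
      by (rule fundamental_theorem_of_calculus)
        (use assms(1) B(1) in \<open>auto simp: b_def intro: has_vector_derivative_at_within\<close>)
    then have "z = F b - F (-b)" using z(1) by (auto dest: has_integral_unique)
    moreover have "norm (F b) < e/3" by (rule N) (simp add: b_def)
    moreover have "norm (F (-b)) < e/3" by (rule N') (simp add: b_def)
    ultimately show ?thesis using z(2) norm_triangle_ineq4[of "F b" "F (-b)"]
      norm_triangle_sub[of "integral UNIV F'" z] by (simp add: norm_minus_commute)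
  qed
  then have "norm (integral UNIV F') \<le> 0" by (rule field_le_epsilon) auto
  then show ?thesis by simp
qed

lemma bounded_bilinear_scaleC:
  "bounded_bilinear (scaleC :: complex \<Rightarrow> 'a::complex_normed_vector \<Rightarrow> 'a)"
proof
  fix a b :: complex and r :: real and x y :: 'a
  show "(r *\<^sub>R a) *\<^sub>C x = r *\<^sub>R (a *\<^sub>C x)"
    by (simp only: scaleR_conv_of_real[of r a] scaleC_of_real[symmetric] scaleC_scaleC)
  show "a *\<^sub>C (r *\<^sub>R x) = r *\<^sub>R (a *\<^sub>C x)"
    by (simp only: scaleC_of_real[symmetric] scaleC_scaleC mult.commute)
  show "\<exists>K. \<forall>a (x::'a). norm (a *\<^sub>C x) \<le> norm a * norm x * K"
    by (rule exI[of _ 1]) (simp add: norm_scaleC)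
qed (simp_all add: scaleC_add_left scaleC_add_right)

interpretation scaleC: bounded_bilinear "scaleC :: complex \<Rightarrow> 'a::complex_normed_vector \<Rightarrow> 'a"
  by (rule bounded_bilinear_scaleC)

lemma scaleC_one [simp]: "1 *\<^sub>C x = (x::'a::complex_normed_vector)"
  using scaleC_of_real[of 1 x] by simp

lemma has_vector_derivative_iff_quotient:
  "(F has_vector_derivative y) (at t) \<longleftrightarrow> ((\<lambda>h. (F (t + h) - F t) /\<^sub>R h) \<longlongrightarrow> y) (at 0)"
proof -
  have "norm (F (t + h) - F t - h *\<^sub>R y) / norm h = norm ((F (t + h) - F t) /\<^sub>R h - y)" if "h \<noteq> 0" for h
  proof -
    have "F (t + h) - F t - h *\<^sub>R y = h *\<^sub>R ((F (t + h) - F t) /\<^sub>R h - y)"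
      using that by (simp add: scaleR_diff_right)
    then show ?thesis using that by (simp only: norm_scaleR) simp
  qed
  then have "((\<lambda>h. norm (F (t + h) - F t - h *\<^sub>R y) / norm h) \<longlongrightarrow> 0) (at 0) \<longleftrightarrow>
      ((\<lambda>h. norm ((F (t + h) - F t) /\<^sub>R h - y)) \<longlongrightarrow> 0) (at 0)"
    by (intro filterlim_cong) (auto simp: eventually_at_filter)
  then show ?thesis
    by (simp add: has_vector_derivative_def has_derivative_at bounded_linear_scaleR_left
        tendsto_norm_zero_iff LIM_zero_iff)
qed

lemma has_vector_derivative_shift:
  "(F has_vector_derivative y) (at (t + c)) \<Longrightarrow> ((\<lambda>s. F (s + c)) has_vector_derivative y) (at t)"
  unfolding has_vector_derivative_iff_quotient by (simp add: ac_simps)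

section \<open>Groups of isometries\<close>

locale isometry_group =
  fixes U :: "real \<Rightarrow> 'x::banach \<Rightarrow>\<^sub>L 'x"
  assumes U_0 [simp]: "U 0 x = x"
    and U_add: "U (s + t) x = U s (U t x)"
    and norm_U [simp]: "norm (U s x) = norm x"
    and U_tendsto: "((\<lambda>s. U s x) \<longlongrightarrow> x) (at 0)"
begin

lemma U_minus_cancel [simp]: "U s (U (- s) x) = x" "U (- s) (U s x) = x"
  using U_add[of s "-s" x] U_add[of "-s" s x] by simp_all

lemma continuous_on_U [continuous_intros]: "continuous_on S (\<lambda>s. U s x)"
proof -
  have "isCont (\<lambda>s. U s x) t" for t
  proof -
    have "(\<lambda>h. U (t + h) x) \<midarrow>0\<rightarrow> U t x"
      unfolding U_add by (rule blinfun.tendsto[OF tendsto_const U_tendsto])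
    then show ?thesis by (simp add: isCont_iff)
  qed
  then show ?thesis by (simp add: continuous_at_imp_continuous_on)
qed

text \<open>
  The generator is kept as a relation, so that no default value outside its domain intervenes.
\<close>

definition gen :: "'x \<Rightarrow> 'x \<Rightarrow> bool" where
  "gen x y \<longleftrightarrow> ((\<lambda>s. U s x) has_vector_derivative y) (at 0)"

lemma gen_zero: "gen 0 0"
  unfolding gen_def by (simp add: blinfun.zero_right)

lemma gen_add: "gen x y \<Longrightarrow> gen x' y' \<Longrightarrow> gen (x + x') (y + y')"
  unfolding gen_def blinfun.add_right by (rule has_vector_derivative_add)

lemma gen_commute:
  assumes "bounded_linear P" "\<And>s x. P (U s x) = U s (P x)" "gen x y"
  shows "gen (P x) (P y)"
  using bounded_linear.has_vector_derivative[OF assms(1), of "\<lambda>s. U s x"] assms(2,3)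
  by (simp add: gen_def)

lemma gen_scaleR: "gen x y \<Longrightarrow> gen (r *\<^sub>R x) (r *\<^sub>R y)"
  by (rule gen_commute[OF bounded_linear_scaleR_right]) (simp_all add: blinfun.scaleR_right)

lemma orbit_has_vector_derivative:
  assumes "gen x y"
  shows "((\<lambda>s. U s x) has_vector_derivative U s y) (at s)"
proof -
  have "((\<lambda>r. U (r - s) x) has_vector_derivative y) (at s)"
    using has_vector_derivative_shift[of "\<lambda>r. U r x" y s "- s"] assms by (simp add: gen_def)
  from bounded_linear.has_vector_derivative[OF blinfun.bounded_linear_right[of "U s"] this]
  show ?thesis by (simp add: U_add[symmetric])
qed

lemma orbit_primitive:
  assumes "a < t" "t < b"
  shows "((\<lambda>s. integral {a..s} (\<lambda>r. U r x)) has_vector_derivative U t x) (at t)"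
proof -
  have "((\<lambda>s. integral {a..s} (\<lambda>r. U r x)) has_vector_derivative U t x) (at t within {a..b})"
    by (rule integral_has_vector_derivative) (use assms in \<open>auto intro: continuous_on_U\<close>)
  moreover have "at t within {a..b} = at t" using assms by (intro at_within_interior) auto
  ultimately show ?thesis by simp
qed

text \<open>
  The integrated form of the relation is stable under limits in \<open>x\<close> and \<open>y\<close>, which yields
  closedness below. The integrals start at \<open>-1\<close> so that their upper limit can move on both sides
  of \<open>0\<close>.
\<close>

lemma gen_iff_integral:
  "gen x y \<longleftrightarrow> (\<forall>s\<in>{-1..1}. U s x = U (-1) x + integral {-1..s} (\<lambda>r. U r y))"
proof
  assume g: "gen x y"
  show "\<forall>s\<in>{-1..1}. U s x = U (-1) x + integral {-1..s} (\<lambda>r. U r y)"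
  proof
    fix s :: real assume s: "s \<in> {-1..1}"
    have "((\<lambda>r. U r y) has_integral (U s x - U (-1) x)) {-1..s}"
      by (rule fundamental_theorem_of_calculus)
        (use s orbit_has_vector_derivative[OF g] in \<open>auto intro: has_vector_derivative_at_within\<close>)
    then show "U s x = U (-1) x + integral {-1..s} (\<lambda>r. U r y)" by (simp add: integral_unique)
  qed
next
  assume eq: "\<forall>s\<in>{-1..1}. U s x = U (-1) x + integral {-1..s} (\<lambda>r. U r y)"
  have "((\<lambda>s. U (-1) x + integral {-1..s} (\<lambda>r. U r y)) has_vector_derivative 0 + U 0 y) (at 0)"
    by (intro has_vector_derivative_add has_vector_derivative_const orbit_primitive[where b=1]) auto
  then have "((\<lambda>s. U s x) has_vector_derivative 0 + U 0 y) (at 0)"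
  proof (rule has_vector_derivative_transform_within[where d=1])
    show "U (-1) x + integral {-1..s} (\<lambda>r. U r y) = U s x" if "dist s 0 < 1" for s
      by (rule eq[rule_format, symmetric]) (use that in \<open>auto simp: dist_norm\<close>)
  qed auto
  then show "gen x y" by (simp add: gen_def)
qed

lemma gen_closed:
  assumes "\<And>n. gen (x n) (y n)" "x \<longlonglongrightarrow> x'" "y \<longlonglongrightarrow> y'"
  shows "gen x' y'"
  unfolding gen_iff_integral
proof
  fix s :: real assume s: "s \<in> {-1..1}"
  have int: "(\<lambda>r. U r z) integrable_on {-1..s}" for z
    by (intro integrable_continuous_interval continuous_on_U)
  have "bounded_linear (\<lambda>z. integral {-1..s} (\<lambda>r. U r z))"
  proof (rule bounded_linear_intro)
    fix z z' and c :: real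
    show "integral {-1..s} (\<lambda>r. U r (z + z')) = integral {-1..s} (\<lambda>r. U r z) + integral {-1..s} (\<lambda>r. U r z')"
      by (simp add: blinfun.add_right integral_add int)
    show "integral {-1..s} (\<lambda>r. U r (c *\<^sub>R z)) = c *\<^sub>R integral {-1..s} (\<lambda>r. U r z)"
      by (simp add: blinfun.scaleR_right)
    show "norm (integral {-1..s} (\<lambda>r. U r z)) \<le> norm z * 2"
      using integral_bound[OF _ continuous_on_U, of "-1" s z "norm z"] s
        mult_left_mono[of "s + 1" 2 "norm z"] by auto
  qed
  note lim = bounded_linear.tendsto[OF this assms(3)]
  have eq: "U (-1) (x n) + integral {-1..s} (\<lambda>r. U r (y n)) = U s (x n)" for n
    using assms(1)[of n] s unfolding gen_iff_integral by metis
  have "(\<lambda>n. U s (x n)) \<longlonglongrightarrow> U (-1) x' + integral {-1..s} (\<lambda>r. U r y')"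
    using tendsto_add[OF blinfun.tendsto[OF tendsto_const assms(2)] lim]
    by (rule Lim_transform_eventually) (use eq in \<open>auto intro!: always_eventually\<close>)
  moreover have "(\<lambda>n. U s (x n)) \<longlonglongrightarrow> U s x'"
    by (rule blinfun.tendsto[OF tendsto_const assms(2)])
  ultimately show "U s x' = U (-1) x' + integral {-1..s} (\<lambda>r. U r y')"
    using LIMSEQ_unique by blast
qed

text \<open>
  Averages of an orbit lie in the domain of the generator; they supply a dense set of such elements.
\<close>

lemma gen_average:
  assumes "0 \<le> h" "h \<le> 1"
  shows "gen (integral {0..h} (\<lambda>r. U r x)) (U h x - x)"
proof -
  define F where "F = (\<lambda>t. integral {-2..t} (\<lambda>r. U r x))"
  have F: "(F has_vector_derivative U t x) (at t)" if "-2 < t" "t < 3" for t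
    unfolding F_def using that by (rule orbit_primitive)
  have int: "(\<lambda>r. U r x) integrable_on {a..b}" for a b
    by (intro integrable_continuous_interval continuous_on_U)
  have eq: "F (s + h) - F s = U s (integral {0..h} (\<lambda>r. U r x))" if s: "dist s 0 < 1" for s
  proof -
    have "integral {-2..s} (\<lambda>r. U r x) + integral {s..s+h} (\<lambda>r. U r x) = integral {-2..s+h} (\<lambda>r. U r x)"
      by (rule Henstock_Kurzweil_Integration.integral_combine[OF _ _ int]) (use s assms in \<open>auto simp: dist_norm\<close>)
    then have "F (s + h) - F s = integral {s..s+h} (\<lambda>r. U r x)"
      unfolding F_def by (simp add: algebra_simps)
    also have "\<dots> = integral {0..h} (\<lambda>r. U (s + r) x)"
      using integral_shift_Icc_real[of 0 h "\<lambda>r. U r x" s] by (simp add: o_def add.commute)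
    also have "\<dots> = U s (integral {0..h} (\<lambda>r. U r x))"
      using integral_linear[OF int blinfun.bounded_linear_right[of "U s"]] by (simp add: U_add o_def)
    finally show ?thesis .
  qed
  have "((\<lambda>s. F (s + h) - F s) has_vector_derivative U (0 + h) x - U 0 x) (at 0)"
  proof (intro has_vector_derivative_diff)
    show "((\<lambda>s. F (s + h)) has_vector_derivative U (0 + h) x) (at 0)"
      using has_vector_derivative_shift[of F "U (0 + h) x" 0 h] F[of "0 + h"] assms by simp
  qed (rule F; simp)
  then have "((\<lambda>s. U s (integral {0..h} (\<lambda>r. U r x))) has_vector_derivative U (0 + h) x - U 0 x) (at 0)"
    by (rule has_vector_derivative_transform_within[where d=1]) (use eq in auto)
  then show ?thesis by (simp add: gen_def)
qed

lemma gen_dense: "\<exists>u v. (\<forall>n. gen (u n) (v n)) \<and> u \<longlonglongrightarrow> x"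
proof -
  define F where "F = (\<lambda>t. integral {-1..t} (\<lambda>r. U r x))"
  define h where "h = (\<lambda>n::nat. 1 / real (Suc n))"
  have "(F has_vector_derivative x) (at 0)"
    unfolding F_def using orbit_primitive[of "-1" 0 1 x] by simp
  then have "((\<lambda>h. (F (0 + h) - F 0) /\<^sub>R h) \<longlongrightarrow> x) (at 0)"
    by (simp add: has_vector_derivative_iff_quotient)
  moreover have "filterlim h (at 0) sequentially"
    unfolding h_def filterlim_at using LIMSEQ_inverse_real_of_nat by (auto simp: inverse_eq_divide)
  ultimately have lim: "(\<lambda>n. (F (0 + h n) - F 0) /\<^sub>R h n) \<longlonglongrightarrow> x"
    by (rule filterlim_compose)
  have "F (h n) - F 0 = integral {0..h n} (\<lambda>r. U r x)" for n
  proof -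
    have "integral {-1..0} (\<lambda>r. U r x) + integral {0..h n} (\<lambda>r. U r x) = integral {-1..h n} (\<lambda>r. U r x)"
      by (rule Henstock_Kurzweil_Integration.integral_combine)
        (auto simp: h_def intro: integrable_continuous_interval continuous_on_U)
    then show ?thesis unfolding F_def by (simp add: algebra_simps)
  qed
  then have "gen ((F (0 + h n) - F 0) /\<^sub>R h n) ((U (h n) x - x) /\<^sub>R h n)" for n
    using gen_scaleR[OF gen_average[of "h n" x], of "inverse (h n)"] by (simp add: h_def)
  then show ?thesis
    using lim by (intro exI[of _ "\<lambda>n. (F (0 + h n) - F 0) /\<^sub>R h n"] exI[of _ "\<lambda>n. (U (h n) x - x) /\<^sub>R h n"]) blast
qed

end

section \<open>Complex linear groups and their Laplace transform\<close>

locale complex_isometry_group = isometry_group U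
  for U :: "real \<Rightarrow> 'x::{complex_normed_vector, banach} \<Rightarrow>\<^sub>L 'x" +
  assumes U_scaleC: "U s (c *\<^sub>C x) = c *\<^sub>C U s x"
begin

lemma gen_scaleC: "gen x y \<Longrightarrow> gen (c *\<^sub>C x) (c *\<^sub>C y)"
  by (rule gen_commute[OF bounded_linear_scaleC]) (simp_all add: U_scaleC)

text \<open>
  The kernels that are integrated against the orbits of the group: exponentials on the half-line and
  Gaussians on the line.
\<close>

definition kernel_on :: "real set \<Rightarrow> (real \<Rightarrow> complex) \<Rightarrow> bool" where
  "kernel_on S f \<longleftrightarrow> closed S \<and> is_interval S \<and> continuous_on UNIV f \<and> (\<lambda>s. cmod (f s)) integrable_on S"

definition smear :: "real set \<Rightarrow> (real \<Rightarrow> complex) \<Rightarrow> 'x \<Rightarrow>\<^sub>L 'x" where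
  "smear S f = Blinfun (\<lambda>x. integral S (\<lambda>s. f s *\<^sub>C U s x))"

lemma kernel_integrable: "kernel_on S f \<Longrightarrow> (\<lambda>s. f s *\<^sub>C U s x) integrable_on S"
  unfolding kernel_on_def
  by (rule integrable_on_interval_dominated[where g = "\<lambda>s. cmod (f s) * norm x"])
    (auto simp: norm_scaleC intro!: scaleC.continuous_on continuous_on_U integrable_on_mult_left)

lemma norm_orbit_integral:
  assumes "kernel_on S f"
  shows "norm (integral S (\<lambda>s. f s *\<^sub>C U s x)) \<le> integral S (\<lambda>s. cmod (f s)) * norm x"
proof -
  have "norm (integral S (\<lambda>s. f s *\<^sub>C U s x)) \<le> integral S (\<lambda>s. cmod (f s) * norm x)"
    using assms by (intro integral_norm_bound_integral kernel_integrable)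
      (auto simp: norm_scaleC kernel_on_def intro!: integrable_on_mult_left)
  then show ?thesis by simp
qed

lemma smear_apply:
  assumes "kernel_on S f"
  shows "smear S f x = integral S (\<lambda>s. f s *\<^sub>C U s x)"
proof -
  have "bounded_linear (\<lambda>x. integral S (\<lambda>s. f s *\<^sub>C U s x))"
  proof (rule bounded_linear_intro)
    fix z z' and c :: real
    show "integral S (\<lambda>s. f s *\<^sub>C U s (z + z')) = integral S (\<lambda>s. f s *\<^sub>C U s z) + integral S (\<lambda>s. f s *\<^sub>C U s z')"
      by (simp add: blinfun.add_right scaleC_add_right integral_add kernel_integrable assms)
    show "integral S (\<lambda>s. f s *\<^sub>C U s (c *\<^sub>R z)) = c *\<^sub>R integral S (\<lambda>s. f s *\<^sub>C U s z)"
      by (simp add: blinfun.scaleR_right scaleC.scaleR_right)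
    show "norm (integral S (\<lambda>s. f s *\<^sub>C U s z)) \<le> norm z * integral S (\<lambda>s. cmod (f s))"
      using norm_orbit_integral[OF assms] by (simp add: mult.commute)
  qed
  then show ?thesis unfolding smear_def by (simp add: bounded_linear_Blinfun_apply)
qed

lemma norm_smear: "kernel_on S f \<Longrightarrow> norm (smear S f) \<le> integral S (\<lambda>s. cmod (f s))"
  by (rule norm_blinfun_bound)
    (auto simp: smear_apply norm_orbit_integral kernel_on_def intro: integral_nonneg)

lemma smear_commute:
  assumes "kernel_on S f" "bounded_linear P" "\<And>c x. P (c *\<^sub>C x) = c *\<^sub>C P x" "\<And>s x. P (U s x) = U s (P x)"
  shows "P (smear S f x) = smear S f (P x)"
  using integral_linear[OF kernel_integrable[OF assms(1)] assms(2), of x]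
  by (simp add: smear_apply assms o_def)

lemma smear_U: "kernel_on S f \<Longrightarrow> smear S f (U s x) = U s (smear S f x)"
  by (rule smear_commute[symmetric])
    (simp_all add: blinfun.bounded_linear_right U_scaleC U_add[symmetric] add.commute)

lemma smear_scaleC: "kernel_on S f \<Longrightarrow> smear S f (c *\<^sub>C x) = c *\<^sub>C smear S f x"
  by (rule smear_commute[symmetric])
    (simp_all add: bounded_linear_scaleC U_scaleC scaleC_scaleC mult.commute)

lemma gen_smear: "kernel_on S f \<Longrightarrow> gen x y \<Longrightarrow> gen (smear S f x) (smear S f y)"
  by (rule gen_commute) (simp_all add: blinfun.bounded_linear_right smear_U)

definition laplace :: "complex \<Rightarrow> 'x \<Rightarrow>\<^sub>L 'x" where
  "laplace l = smear {0..} (\<lambda>s. exp (- l * of_real s))"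

lemma laplace_kernel:
  assumes "Re l > 0"
  shows "((\<lambda>s. cmod (exp (- l * of_real s))) has_integral 1 / Re l) {0..}"
    "kernel_on {0..} (\<lambda>s. exp (- l * of_real s))"
proof -
  show *: "((\<lambda>s. cmod (exp (- l * of_real s))) has_integral 1 / Re l) {0..}"
    using has_integral_exp_minus_to_infinity[OF assms, of 0] by simp
  then show "kernel_on {0..} (\<lambda>s. exp (- l * of_real s))"
    unfolding kernel_on_def by (auto intro!: continuous_intros simp: is_interval_ci)
qed

lemma norm_laplace: "Re l > 0 \<Longrightarrow> norm (laplace l) \<le> 1 / Re l"
  unfolding laplace_def using norm_smear[OF laplace_kernel(2)] integral_unique[OF laplace_kernel(1)] by simp

lemma laplace_apply:
  "Re l > 0 \<Longrightarrow> laplace l x = integral {0..} (\<lambda>s. exp (- l * of_real s) *\<^sub>C U s x)"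
  unfolding laplace_def by (rule smear_apply[OF laplace_kernel(2)])

lemma laplace_scaleC: "Re l > 0 \<Longrightarrow> laplace l (c *\<^sub>C x) = c *\<^sub>C laplace l x"
  unfolding laplace_def by (rule smear_scaleC[OF laplace_kernel(2)])

text \<open>
  The integrand of \<open>laplace l (l x - y)\<close> is minus the derivative of \<open>e\<^sup>-\<^sup>l\<^sup>s U(s) x\<close>.
\<close>

lemma laplace_gen:
  assumes l: "Re l > 0" and g: "gen x y"
  shows "laplace l (l *\<^sub>C x - y) = x"
proof -
  define F where "F = (\<lambda>s. exp (- l * of_real s) *\<^sub>C U s x)"
  define F' where "F' = (\<lambda>s. - (exp (- l * of_real s) *\<^sub>C U s (l *\<^sub>C x - y)))"
  have F: "(F has_vector_derivative F' s) (at s)" for s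
  proof -
    have "((\<lambda>s. exp (- l * of_real s)) has_vector_derivative - l * exp (- l * of_real s)) (at s)"
      by (auto intro!: derivative_eq_intros has_vector_derivative_real_field simp: field_simps)
    from scaleC.has_vector_derivative[OF this orbit_has_vector_derivative[OF g]]
    show ?thesis
      unfolding F_def F'_def
      by (rule has_vector_derivative_eq_rhs)
        (simp add: blinfun.diff_right U_scaleC scaleC.diff_right scaleC_scaleC scaleC.minus_left mult.commute)
  qed
  have "integral {0..} F' = - F 0"
  proof (rule integral_vector_derivative_halfline[OF F])
    show "F' integrable_on {0..}"
      unfolding F'_def by (intro integrable_neg kernel_integrable laplace_kernel l)
    have "((\<lambda>s. exp (- (Re l * s)) * norm x) \<longlongrightarrow> 0) at_top"
      using l by real_asymp
    then show "(F \<longlongrightarrow> 0) at_top"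
      by (subst tendsto_norm_zero_iff[symmetric]) (simp add: F_def norm_scaleC)
  qed
  then show ?thesis
    by (simp add: F_def F'_def laplace_apply[OF l])
qed

text \<open>
  On the domain of the generator this is the left inverse property together with the fact that
  smearing commutes with the generator; density and closedness give it everywhere.
\<close>

lemma gen_laplace:
  assumes l: "Re l > 0"
  shows "gen (laplace l x) (l *\<^sub>C laplace l x - x)"
proof -
  obtain u v where uv: "\<And>n. gen (u n) (v n)" "u \<longlonglongrightarrow> x" using gen_dense[of x] by blast
  have v: "laplace l (v n) = l *\<^sub>C laplace l (u n) - u n" for n
    using laplace_gen[OF l uv(1)[of n]]
    by (simp add: blinfun.diff_right laplace_scaleC l) (simp add: algebra_simps)
  have lim: "(\<lambda>n. laplace l (u n)) \<longlonglongrightarrow> laplace l x"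
    by (rule blinfun.tendsto[OF tendsto_const uv(2)])
  show ?thesis
  proof (rule gen_closed)
    show "gen (laplace l (u n)) (laplace l (v n))" for n
      unfolding laplace_def by (rule gen_smear[OF laplace_kernel(2)[OF l] uv(1)])
    show "(\<lambda>n. laplace l (v n)) \<longlonglongrightarrow> l *\<^sub>C laplace l x - x"
      unfolding v by (intro tendsto_diff scaleC.tendsto tendsto_const lim uv(2))
  qed (rule lim)
qed

lemma reverse_group: "complex_isometry_group (\<lambda>s. U (- s))"
proof
  fix x
  show "((\<lambda>s. U (- s) x) \<longlongrightarrow> x) (at 0)"
  proof -
    have "continuous_on UNIV (\<lambda>s. U (- s) x)"
      by (rule continuous_on_compose2[OF continuous_on_U[of UNIV] continuous_on_minus[OF continuous_on_id]]) simp
    then have "isCont (\<lambda>s. U (- s) x) 0" by (simp add: continuous_on_eq_continuous_at)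
    then show ?thesis unfolding isCont_def by simp
  qed
next
  fix s t x
  show "U (- (s + t)) x = U (- s) (U (- t) x)" using U_add[of "-s" "-t" x] by simp
qed (simp_all add: U_scaleC)

text \<open>
  The reversed group has generator \<open>- G\<close>, so its Laplace transform inverts \<open>l + G\<close>.
\<close>

lemma gen_reverse: "isometry_group.gen (\<lambda>s. U (- s)) x y \<longleftrightarrow> gen x (- y)"
proof -
  interpret rev: complex_isometry_group "\<lambda>s. U (- s)" by (rule reverse_group)
  have *: "((\<lambda>s. F (- s)) has_vector_derivative - y) (at 0)" if "(F has_vector_derivative y) (at 0)"
    for F :: "real \<Rightarrow> 'x" and y
  proof -
    have "(uminus has_vector_derivative - 1) (at (0::real))"
      using has_vector_derivative_minus[OF has_vector_derivative_id[of "at (0::real)"]] by simp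
    from vector_diff_chain_at[OF this, of F y] that show ?thesis by (simp add: o_def)
  qed
  show ?thesis
    using *[of "\<lambda>s. U s x" "- y"] *[of "\<lambda>s. U (- s) x" y] by (auto simp: gen_def rev.gen_def)
qed

text \<open>
  The factorization \<open>l\<^sup>2 - G\<^sup>2 = (l - G) (l + G)\<close>.
\<close>

definition square_resolvent :: "complex \<Rightarrow> 'x \<Rightarrow>\<^sub>L 'x" where
  "square_resolvent l = complex_isometry_group.laplace (\<lambda>s. U (- s)) l o\<^sub>L laplace l"

lemma norm_square_resolvent:
  assumes "Re l > 0"
  shows "norm (square_resolvent l) \<le> 1 / (Re l)\<^sup>2"
proof -
  interpret rev: complex_isometry_group "\<lambda>s. U (- s)" by (rule reverse_group)
  have "norm (square_resolvent l) \<le> norm (rev.laplace l) * norm (laplace l)"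
    unfolding square_resolvent_def by (rule norm_blinfun_compose)
  also have "\<dots> \<le> (1 / Re l) * (1 / Re l)"
    using assms by (intro mult_mono norm_laplace rev.norm_laplace) auto
  finally show ?thesis by (simp add: power2_eq_square)
qed

lemma square_resolvent_right:
  assumes l: "Re l > 0"
  shows "\<exists>v. gen (square_resolvent l f) v \<and> gen v (l\<^sup>2 *\<^sub>C square_resolvent l f - f)"
proof -
  interpret rev: complex_isometry_group "\<lambda>s. U (- s)" by (rule reverse_group)
  define g where "g = laplace l f"
  have u: "square_resolvent l f = rev.laplace l g" by (simp add: square_resolvent_def g_def)
  have 1: "gen (rev.laplace l g) (g - l *\<^sub>C rev.laplace l g)"
    using rev.gen_laplace[OF l, of g] by (simp add: gen_reverse)
  have 2: "gen g (l *\<^sub>C g - f)" unfolding g_def by (rule gen_laplace[OF l])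
  have "gen (g - l *\<^sub>C rev.laplace l g) (l *\<^sub>C g - f + (- l) *\<^sub>C (g - l *\<^sub>C rev.laplace l g))"
    using gen_add[OF 2 gen_scaleC[OF 1, of "- l"]] by (simp add: scaleC.minus_left)
  then show ?thesis
    using 1 unfolding u
    by (auto simp: scaleC.diff_right scaleC_scaleC scaleC.minus_left power2_eq_square algebra_simps
        intro!: exI[of _ "g - l *\<^sub>C rev.laplace l g"])
qed

lemma square_resolvent_left:
  assumes l: "Re l > 0" and g: "gen x y" "gen y z"
  shows "square_resolvent l (l\<^sup>2 *\<^sub>C x - z) = x"
proof -
  interpret rev: complex_isometry_group "\<lambda>s. U (- s)" by (rule reverse_group)
  have "gen (l *\<^sub>C x + y) (l *\<^sub>C y + z)" by (intro gen_add gen_scaleC g)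
  from laplace_gen[OF l this] have "laplace l (l\<^sup>2 *\<^sub>C x - z) = l *\<^sub>C x + y"
    by (simp add: scaleC_add_right scaleC_scaleC power2_eq_square)
  moreover have "rev.laplace l (l *\<^sub>C x - (- y)) = x"
    by (rule rev.laplace_gen[OF l]) (simp add: gen_reverse g)
  ultimately show ?thesis by (simp add: square_resolvent_def)
qed

end

section \<open>Gaussian integrals\<close>

lemma has_bochner_integral_imp_has_integral:
  fixes f :: "real \<Rightarrow> real"
  assumes "has_bochner_integral lborel f x"
  shows "(f has_integral x) UNIV"
  using has_integral_integral_lborel[of f] assms unfolding has_bochner_integral_iff by metis

lemma gauss_moment_even:
  fixes p :: real
  assumes p: "p > 0"
  shows "((\<lambda>s. s ^ (2 * k) * exp (- (p * s\<^sup>2))) has_integral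
    sqrt (pi / p) * (fact (2 * k) / ((4 * p) ^ k * fact k))) UNIV"
proof -
  define \<sigma> where "\<sigma> = 1 / sqrt (2 * p)"
  have \<sigma>: "\<sigma> > 0" "\<sigma>\<^sup>2 = 1 / (2 * p)" using p by (auto simp: \<sigma>_def power_divide)
  have nd: "normal_density 0 \<sigma> s = exp (- (p * s\<^sup>2)) / sqrt (pi / p)" for s
    using p by (simp add: normal_density_def \<sigma>(2) field_simps)
  have "has_bochner_integral lborel (\<lambda>s. normal_density 0 \<sigma> s * (s - 0) ^ (2 * k)) (fact (2 * k) / ((2 / \<sigma>\<^sup>2) ^ k * fact k))"
    by (rule normal_moment_even[OF \<sigma>(1)])
  then have "((\<lambda>s. normal_density 0 \<sigma> s * s ^ (2 * k)) has_integral (fact (2 * k) / ((2 / \<sigma>\<^sup>2) ^ k * fact k))) UNIV"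
    by (intro has_bochner_integral_imp_has_integral) simp
  from has_integral_mult_right[OF this, of "sqrt (pi / p)"] show ?thesis
    using p by (simp add: nd \<sigma>(2) mult.commute)
qed

lemma gauss_moment_abs:
  fixes p :: real
  assumes p: "p > 0"
  shows "((\<lambda>s. \<bar>s\<bar> * exp (- (p * s\<^sup>2))) has_integral 1 / p) UNIV"
proof -
  define \<sigma> where "\<sigma> = 1 / sqrt (2 * p)"
  have \<sigma>: "\<sigma> > 0" "\<sigma>\<^sup>2 = 1 / (2 * p)" using p by (auto simp: \<sigma>_def power_divide)
  have nd: "normal_density 0 \<sigma> s = exp (- (p * s\<^sup>2)) / sqrt (pi / p)" for s
    using p by (simp add: normal_density_def \<sigma>(2) field_simps)
  have "has_bochner_integral lborel (\<lambda>s. normal_density 0 \<sigma> s * \<bar>s - 0\<bar> ^ (2 * 0 + 1)) (2^0 * \<sigma>^(2*0+1) * fact 0 * sqrt (2 / pi))"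
    by (rule normal_moment_abs_odd[OF \<sigma>(1)])
  then have "((\<lambda>s. normal_density 0 \<sigma> s * \<bar>s\<bar>) has_integral (\<sigma> * sqrt (2 / pi))) UNIV"
    by (intro has_bochner_integral_imp_has_integral) simp
  moreover have "sqrt (pi / p) * (\<sigma> * sqrt (2 / pi)) = 1 / p"
    using p by (simp add: \<sigma>_def real_sqrt_divide real_sqrt_mult)
  ultimately show ?thesis
    using has_integral_mult_right[of "\<lambda>s. normal_density 0 \<sigma> s * \<bar>s\<bar>" "\<sigma> * sqrt (2 / pi)" UNIV "sqrt (pi / p)"] p
    by (simp add: nd mult.commute)
qed

lemma has_derivative_quadratic:
  assumes "bounded_linear L" "e > 0"
    and "\<And>h. norm h < e \<Longrightarrow> norm (F (a + h) - F a - L h) \<le> C * (norm h)\<^sup>2"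
  shows "(F has_derivative L) (at a)"
  unfolding has_derivative_at
proof
  show "((\<lambda>h. norm (F (a + h) - F a - L h) / norm h) \<longlongrightarrow> 0) (at 0)"
  proof (rule tendsto_sandwich[where f = "\<lambda>_. 0" and h = "\<lambda>h. C * norm h"])
    have "\<forall>\<^sub>F h in at 0. norm h < e"
      using assms(2) eventually_at[of "\<lambda>h. norm h < e" 0 UNIV] by (auto simp: dist_norm)
    then show "\<forall>\<^sub>F h in at 0. norm (F (a + h) - F a - L h) / norm h \<le> C * norm h"
    proof eventually_elim
      case (elim h)
      then show ?case
        using assms(3)[OF elim] by (cases "h = 0") (auto simp: divide_simps power2_eq_square mult_ac)
    qed
    show "((\<lambda>h. C * norm h) \<longlongrightarrow> 0) (at 0)"
      by (auto intro!: tendsto_eq_intros)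
  qed auto
qed (rule assms(1))

context complex_isometry_group
begin

lemma kernel_on_dominated:
  assumes "closed S" "is_interval S" "continuous_on UNIV f" "\<And>s. s \<in> S \<Longrightarrow> cmod (f s) \<le> g s" "g integrable_on S"
  shows "kernel_on S f"
proof -
  have "(\<lambda>s. cmod (f s)) integrable_on S"
    by (rule integrable_on_interval_dominated[where g = g]) (use assms in \<open>auto intro: continuous_on_norm\<close>)
  then show ?thesis using assms by (simp add: kernel_on_def)
qed

definition gauss :: "complex \<Rightarrow> 'x \<Rightarrow>\<^sub>L 'x" where
  "gauss a = smear UNIV (\<lambda>s. exp (- (a * of_real (s\<^sup>2))))"

definition gauss_square :: "complex \<Rightarrow> 'x \<Rightarrow>\<^sub>L 'x" where
  "gauss_square a = smear UNIV (\<lambda>s. of_real (s\<^sup>2) * exp (- (a * of_real (s\<^sup>2))))"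

lemma gauss_kernel:
  assumes a: "Re a > 0"
  shows "kernel_on UNIV (\<lambda>s. exp (- (a * of_real (s\<^sup>2))))" (is ?t1)
    and "kernel_on UNIV (\<lambda>s. of_real (s\<^sup>2) * exp (- (a * of_real (s\<^sup>2))))" (is ?t2)
proof -
  show ?t1
    by (rule kernel_on_dominated[where g = "\<lambda>s. s ^ (2 * 0) * exp (- (Re a * s\<^sup>2))"])
      (use gauss_moment_even[OF a, of 0] in \<open>auto intro!: continuous_intros\<close>)
  show ?t2
    by (rule kernel_on_dominated[where g = "\<lambda>s. s ^ (2 * 1) * exp (- (Re a * s\<^sup>2))"])
      (use gauss_moment_even[OF a, of 1] in \<open>auto intro!: continuous_intros simp: norm_mult norm_power\<close>)
qed

lemma gauss_apply: "Re a > 0 \<Longrightarrow> gauss a x = integral UNIV (\<lambda>s. exp (- (a * of_real (s\<^sup>2))) *\<^sub>C U s x)"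
  unfolding gauss_def by (rule smear_apply[OF gauss_kernel(1)])

lemma gauss_square_apply:
  "Re a > 0 \<Longrightarrow> gauss_square a x = integral UNIV (\<lambda>s. (of_real (s\<^sup>2) * exp (- (a * of_real (s\<^sup>2)))) *\<^sub>C U s x)"
  unfolding gauss_square_def by (rule smear_apply[OF gauss_kernel(2)])

lemma norm_gauss: "Re a > 0 \<Longrightarrow> norm (gauss a) \<le> sqrt (pi / Re a)"
  unfolding gauss_def using norm_smear[OF gauss_kernel(1)] integral_unique[OF gauss_moment_even[of "Re a" 0]]
  by fastforce

lemma gauss_commute:
  assumes "Re a > 0" "bounded_linear P" "\<And>c x. P (c *\<^sub>C x) = c *\<^sub>C P x" "\<And>s x. P (U s x) = U s (P x)"
  shows "P (gauss a x) = gauss a (P x)"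
  unfolding gauss_def using assms by (intro smear_commute gauss_kernel) auto

lemma gauss_conj:
  assumes a: "Re a > 0" and J: "bounded_linear J" "\<And>c x. J (c *\<^sub>C x) = cnj c *\<^sub>C J x" "\<And>s x. J (U s x) = U s (J x)"
  shows "J (gauss a x) = gauss (cnj a) (J x)"
  using integral_linear[OF kernel_integrable[OF gauss_kernel(1)[OF a]] J(1), of x] a
  by (simp add: gauss_apply J o_def exp_cnj)

lemma cmod_exp_Taylor1: "cmod (exp w - 1 - w) \<le> exp (cmod w) * (cmod w)\<^sup>2"
  using Taylor_exp_field[of w 1] by (simp add: algebra_simps power2_eq_square)

text \<open>
  The remainder of the exponential series bounds the difference of the kernels by
  \<open>|h|\<^sup>2 s\<^sup>4 exp (- p s\<^sup>2)\<close>, whose integral is finite; hence the derivative exists in operator norm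
  although \<open>s \<mapsto> U(s)\<close> is only strongly continuous.
\<close>

lemma gauss_has_derivative:
  assumes a: "Re a > 0"
  shows "(gauss has_derivative (\<lambda>h. h *\<^sub>C (- gauss_square a))) (at a)"
proof (rule has_derivative_quadratic)
  show "bounded_linear (\<lambda>h. h *\<^sub>C (- gauss_square a))" by (rule scaleC.bounded_linear_left)
  \<comment> \<open>Half of the decay rate is given up to absorb the factor \<open>exp (|h| s\<^sup>2)\<close> of the remainder.\<close>
  define p where "p = Re a / 2"
  define C where "C = integral UNIV (\<lambda>s. s ^ 4 * exp (- (p * s\<^sup>2)))"
  have p: "p > 0" using a by (simp add: p_def)
  have int: "(\<lambda>s. s ^ 4 * exp (- (p * s\<^sup>2))) integrable_on UNIV"
    using gauss_moment_even[OF p, of 2] by auto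
  show "norm (gauss (a + h) - gauss a - h *\<^sub>C (- gauss_square a)) \<le> C * (norm h)\<^sup>2" if h: "norm h < p" for h
  proof (rule norm_blinfun_bound)
    show "0 \<le> C * (norm h)\<^sup>2" unfolding C_def by (intro mult_nonneg_nonneg integral_nonneg int) auto
    fix x
    have ah: "Re (a + h) > 0" using h abs_Re_le_cmod[of h] a by (simp add: p_def)
    define k where "k = (\<lambda>s. exp (- ((a + h) * of_real (s\<^sup>2))) - exp (- (a * of_real (s\<^sup>2)))
      + h * (of_real (s\<^sup>2) * exp (- (a * of_real (s\<^sup>2)))))"
    have k: "cmod (k s) \<le> (norm h)\<^sup>2 * (s ^ 4 * exp (- (p * s\<^sup>2)))" for s
    proof -
      define w where "w = - (h * of_real (s\<^sup>2))"
      have "k s = exp (- (a * of_real (s\<^sup>2))) * (exp w - 1 - w)"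
        by (simp add: k_def w_def exp_add[symmetric] algebra_simps)
      then have "cmod (k s) \<le> exp (- (Re a * s\<^sup>2)) * (exp (cmod w) * (cmod w)\<^sup>2)"
        by (simp add: norm_mult mult_left_mono cmod_exp_Taylor1)
      also have "\<dots> = (norm h)\<^sup>2 * s ^ 4 * exp (- (Re a * s\<^sup>2) + cmod h * s\<^sup>2)"
        by (simp add: w_def norm_mult norm_power power_mult_distrib exp_add exp_diff exp_minus field_simps)
      also have "\<dots> \<le> (norm h)\<^sup>2 * s ^ 4 * exp (- (p * s\<^sup>2))"
      proof (intro mult_left_mono)
        have "cmod h * s\<^sup>2 \<le> p * s\<^sup>2" using h by (intro mult_right_mono) auto
        then show "exp (- (Re a * s\<^sup>2) + cmod h * s\<^sup>2) \<le> exp (- (p * s\<^sup>2))"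
          by (simp add: p_def)
      qed auto
      finally show ?thesis by (simp add: mult.assoc)
    qed
    have "(gauss (a + h) - gauss a - h *\<^sub>C (- gauss_square a)) x = integral UNIV (\<lambda>s. k s *\<^sub>C U s x)"
    proof -
      note i = kernel_integrable[OF gauss_kernel(1)[OF ah]] kernel_integrable[OF gauss_kernel(1)[OF a]]
        kernel_integrable[OF gauss_kernel(2)[OF a]]
      have i3: "(\<lambda>s. h *\<^sub>C (of_real (s\<^sup>2) * exp (- (a * of_real (s\<^sup>2)))) *\<^sub>C U s x) integrable_on UNIV"
        and e3: "integral UNIV (\<lambda>s. h *\<^sub>C (of_real (s\<^sup>2) * exp (- (a * of_real (s\<^sup>2)))) *\<^sub>C U s x) = h *\<^sub>C gauss_square a x"
        using integrable_linear[OF i(3) bounded_linear_scaleC[of h]] integral_linear[OF i(3) bounded_linear_scaleC[of h]]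
        by (simp_all add: o_def gauss_square_apply[OF a])
      have "(gauss (a + h) - gauss a - h *\<^sub>C (- gauss_square a)) x = gauss (a + h) x - gauss a x + h *\<^sub>C gauss_square a x"
        by (simp add: blinfun.diff_left blinfun.add_left scaleC_blinfun.rep_eq blinfun.minus_left scaleC.minus_right)
      also have "\<dots> = integral UNIV (\<lambda>s. exp (- ((a + h) * of_real (s\<^sup>2))) *\<^sub>C U s x - exp (- (a * of_real (s\<^sup>2))) *\<^sub>C U s x
         + h *\<^sub>C (of_real (s\<^sup>2) * exp (- (a * of_real (s\<^sup>2)))) *\<^sub>C U s x)"
        unfolding gauss_apply[OF ah] gauss_apply[OF a] e3[symmetric]
        by (simp only: integral_diff[OF i(1,2), symmetric] integral_add[OF integrable_diff[OF i(1,2)] i3, symmetric])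
      finally show ?thesis
        by (simp add: k_def scaleC.add_left scaleC.diff_left scaleC_scaleC)
    qed
    also have "norm \<dots> \<le> integral UNIV (\<lambda>s. (norm h)\<^sup>2 * (s ^ 4 * exp (- (p * s\<^sup>2))) * norm x)"
    proof (rule integral_norm_bound_integral)
      have "kernel_on UNIV k"
        by (rule kernel_on_dominated[OF _ _ _ k integrable_on_mult_right[OF int]])
          (auto simp: k_def intro!: continuous_intros)
      then show "(\<lambda>s. k s *\<^sub>C U s x) integrable_on UNIV" by (rule kernel_integrable)
      show "(\<lambda>s. (norm h)\<^sup>2 * (s ^ 4 * exp (- (p * s\<^sup>2))) * norm x) integrable_on UNIV"
        by (intro integrable_on_mult_left integrable_on_mult_right int)
      show "norm (k s *\<^sub>C U s x) \<le> (norm h)\<^sup>2 * (s ^ 4 * exp (- (p * s\<^sup>2))) * norm x" for s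
        unfolding norm_scaleC norm_U by (intro mult_right_mono k) auto
    qed
    also have "\<dots> = C * (norm h)\<^sup>2 * norm x" by (simp add: C_def)
    finally show "norm ((gauss (a + h) - gauss a - h *\<^sub>C (- gauss_square a)) x) \<le> C * (norm h)\<^sup>2 * norm x" .
  qed
  show "p > 0" by (rule p)
qed

text \<open>
  Two integrations by parts: the second derivative of the kernel is
  \<open>(4 a\<^sup>2 s\<^sup>2 - 2 a) exp (- a s\<^sup>2)\<close>.
\<close>

lemma gauss_gen_square:
  assumes a: "Re a > 0" and g: "gen x y" "gen y z"
  shows "gauss a z = (4 * a\<^sup>2) *\<^sub>C gauss_square a x - (2 * a) *\<^sub>C gauss a x"
proof -
  define e where "e = (\<lambda>s::real. exp (- (a * of_real (s\<^sup>2))))"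
  \<comment> \<open>\<open>e U' - e' U\<close> along the orbit of \<open>x\<close>: its derivative is \<open>e U'' - e'' U\<close>.\<close>
  define F where "F = (\<lambda>s. e s *\<^sub>C U s y + (2 * a * of_real s * e s) *\<^sub>C U s x)"
  define F' where "F' = (\<lambda>s. e s *\<^sub>C U s z + (2 * a) *\<^sub>C e s *\<^sub>C U s x - (4 * a\<^sup>2) *\<^sub>C (of_real (s\<^sup>2) * e s) *\<^sub>C U s x)"
  have F: "(F has_vector_derivative F' s) (at s)" for s
  proof -
    have e: "(e has_vector_derivative - (2 * a * of_real s * e s)) (at s)"
      unfolding e_def by (auto intro!: derivative_eq_intros has_vector_derivative_real_field)
    have e2: "((\<lambda>s. 2 * a * of_real s * e s) has_vector_derivative 2 * a * e s - 4 * a\<^sup>2 * of_real (s\<^sup>2) * e s) (at s)"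
      unfolding e_def by (auto intro!: derivative_eq_intros has_vector_derivative_real_field
          simp: power2_eq_square algebra_simps)
    show ?thesis
      unfolding F_def F'_def
      by (rule has_vector_derivative_eq_rhs[OF has_vector_derivative_add[OF
            scaleC.has_vector_derivative[OF e orbit_has_vector_derivative[OF g(2)]]
            scaleC.has_vector_derivative[OF e2 orbit_has_vector_derivative[OF g(1)]]]])
        (simp add: scaleC.minus_left scaleC.diff_left scaleC_scaleC mult.assoc)
  qed
  have p: "Re a > 0" by (rule a)
  have nF: "norm (F s) \<le> exp (- (Re a * s\<^sup>2)) * norm y + 2 * cmod a * \<bar>s\<bar> * exp (- (Re a * s\<^sup>2)) * norm x" for s
    unfolding F_def by (rule norm_triangle_le) (simp add: norm_scaleC norm_mult e_def)
  have top: "(F \<longlongrightarrow> 0) at_top"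
  proof (rule Lim_null_comparison)
    show "((\<lambda>s. exp (- (Re a * s\<^sup>2)) * norm y + 2 * cmod a * \<bar>s\<bar> * exp (- (Re a * s\<^sup>2)) * norm x) \<longlongrightarrow> 0) at_top"
      using p by real_asymp
  qed (simp add: nF)
  have bot: "(F \<longlongrightarrow> 0) at_bot"
  proof (rule Lim_null_comparison)
    show "((\<lambda>s. exp (- (Re a * s\<^sup>2)) * norm y + 2 * cmod a * \<bar>s\<bar> * exp (- (Re a * s\<^sup>2)) * norm x) \<longlongrightarrow> 0) at_bot"
      using p by real_asymp
  qed (simp add: nF)
  have i1: "(\<lambda>s. e s *\<^sub>C U s w) integrable_on UNIV" for w
    unfolding e_def by (rule kernel_integrable[OF gauss_kernel(1)[OF a]])
  have i0: "(\<lambda>s. (of_real (s\<^sup>2) * e s) *\<^sub>C U s x) integrable_on UNIV"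
    unfolding e_def by (rule kernel_integrable[OF gauss_kernel(2)[OF a]])
  note i2 = integrable_linear[OF i1 bounded_linear_scaleC, unfolded o_def]
  note i3 = integrable_linear[OF i0 bounded_linear_scaleC, unfolded o_def]
  have e2: "integral UNIV (\<lambda>s. (2 * a) *\<^sub>C e s *\<^sub>C U s x) = (2 * a) *\<^sub>C gauss a x"
    using integral_linear[OF i1 bounded_linear_scaleC[of "2 * a"]] by (simp add: o_def gauss_apply[OF a] e_def)
  have e3: "integral UNIV (\<lambda>s. (4 * a\<^sup>2) *\<^sub>C (of_real (s\<^sup>2) * e s) *\<^sub>C U s x) = (4 * a\<^sup>2) *\<^sub>C gauss_square a x"
    using integral_linear[OF i0 bounded_linear_scaleC[of "4 * a\<^sup>2"]]
    by (simp add: o_def gauss_square_apply[OF a] e_def)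
  have "integral UNIV F' = 0"
    by (rule integral_vector_derivative_line[OF F _ top bot])
      (unfold F'_def, intro integrable_add integrable_diff i1 i2 i3)
  also have "integral UNIV F' = gauss a z + (2 * a) *\<^sub>C gauss a x - (4 * a\<^sup>2) *\<^sub>C gauss_square a x"
    unfolding F'_def integral_diff[OF integrable_add[OF i1 i2] i3] integral_add[OF i1 i2] e2 e3
    by (simp add: gauss_apply[OF a] e_def)
  finally show ?thesis by (simp add: algebra_simps)
qed

end

section \<open>The heat semigroup of a group of isometries\<close>

context complex_isometry_group
begin

text \<open>
  The kernel of \<open>heat z\<close> is the Gaussian \<open>(4\<pi>z)\<^sup>-\<^sup>1\<^sup>/\<^sup>2 exp (- s\<^sup>2 / 4z)\<close>, which is
  \<open>(a / \<pi>)\<^sup>1\<^sup>/\<^sup>2 exp (- a s\<^sup>2)\<close> for \<open>a = 1 / 4z\<close>.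
\<close>

definition heat :: "complex \<Rightarrow> 'x \<Rightarrow>\<^sub>L 'x" where
  "heat z = csqrt (1 / (4 * z) / of_real pi) *\<^sub>C gauss (1 / (4 * z))"

lemma Re_quarter_inverse: "Re (1 / (4 * z)) = Re z / (4 * (cmod z)\<^sup>2)"
proof -
  have "(4 * Re z)\<^sup>2 + (4 * Im z)\<^sup>2 = 4 * (4 * (cmod z)\<^sup>2)"
    by (simp add: cmod_power2 power_mult_distrib)
  then show ?thesis by (simp add: Re_divide)
qed

lemma Re_quarter_inverse_pos: "Re z > 0 \<Longrightarrow> Re (1 / (4 * z)) > 0"
  unfolding Re_quarter_inverse by (intro divide_pos_pos) auto

lemma heat_apply: "heat z x = csqrt (1 / (4 * z) / of_real pi) *\<^sub>C gauss (1 / (4 * z)) x"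
  by (simp add: heat_def scaleC_blinfun.rep_eq)

lemma heat_commute:
  assumes "Re z > 0" "bounded_linear P" "\<And>c x. P (c *\<^sub>C x) = c *\<^sub>C P x" "\<And>s x. P (U s x) = U s (P x)"
  shows "P (heat z x) = heat z (P x)"
  using gauss_commute[OF Re_quarter_inverse_pos[OF assms(1)] assms(2-)] assms(3) by (simp add: heat_apply)

lemma heat_conj:
  assumes t: "0 < t" and J: "bounded_linear J" "\<And>c x. J (c *\<^sub>C x) = cnj c *\<^sub>C J x" "\<And>s x. J (U s x) = U s (J x)"
  shows "J (heat (of_real t) x) = heat (of_real t) (J x)"
proof -
  have r: "1 / (4 * complex_of_real t) = of_real (1 / (4 * t))" by simp
  have "cnj (csqrt (of_real (1 / (4 * t)) / of_real pi)) = csqrt (of_real (1 / (4 * t)) / of_real pi)"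
    using t by (simp add: of_real_divide[symmetric] del: of_real_divide)
  then show ?thesis
    using gauss_conj[of "of_real (1 / (4 * t))" J x] t J unfolding heat_apply r by simp
qed

text \<open>
  The heat equation. With \<open>a = 1 / 4z\<close> one has \<open>a' = - 4 a\<^sup>2\<close>, and the factor
  \<open>(a / \<pi>)\<^sup>1\<^sup>/\<^sup>2\<close> has logarithmic derivative \<open>1 / 2a\<close>; the two terms are those of
  \<open>gauss_gen_square\<close>.
\<close>

lemma heat_has_derivative:
  assumes z: "Re z > 0"
  shows "\<exists>L. (heat has_derivative (\<lambda>h. h *\<^sub>C L)) (at z) \<and> (\<forall>x y v. gen x y \<longrightarrow> gen y v \<longrightarrow> L x = heat z v)"
proof -
  define a where "a = 1 / (4 * z)"
  define c where "c = csqrt (a / of_real pi)"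
  define M where "M = (c / (2 * a)) *\<^sub>C gauss a - c *\<^sub>C gauss_square a"
  have a: "Re a > 0" "a \<noteq> 0" and z0: "z \<noteq> 0"
    using z Re_quarter_inverse_pos[OF z] by (auto simp: a_def)
  have c2: "c\<^sup>2 = a / of_real pi" by (simp add: c_def)
  have c0: "c \<noteq> 0" using a by (simp add: c_def)
  have nn: "a / of_real pi \<notin> \<real>\<^sub>\<le>\<^sub>0"
    using divide_pos_pos[OF a(1) pi_gt_zero] by (auto simp: complex_nonpos_Reals_iff Re_divide_of_real)
  have "c / (2 * a) = 1 / of_real pi / (2 * c)"
    using c2 c0 a by (simp add: power2_eq_square field_simps)
  then have d1: "((\<lambda>w. csqrt (w / of_real pi)) has_field_derivative c / (2 * a)) (at a)"
    using nn by (auto intro!: derivative_eq_intros simp: c_def)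
  have d2: "((\<lambda>w. csqrt (w / of_real pi) *\<^sub>C gauss w) has_derivative (\<lambda>h. h *\<^sub>C M)) (at (1 / (4 * z)))"
    unfolding a_def[symmetric]
    by (rule has_derivative_eq_rhs[OF scaleC.FDERIV[OF has_field_derivative_imp_has_derivative[OF d1] gauss_has_derivative[OF a(1)]]])
      (simp add: fun_eq_iff c_def[symmetric] M_def scaleC.diff_right scaleC.minus_right scaleC_scaleC mult.commute)
  have d3: "((\<lambda>z. 1 / (4 * z)) has_derivative (\<lambda>h. (- 4 * a\<^sup>2) * h)) (at z)"
  proof -
    have "((\<lambda>z. 1 / (4 * z)) has_field_derivative (- 4 * a\<^sup>2)) (at z)"
      using z0 by (auto intro!: derivative_eq_intros simp: a_def power2_eq_square field_simps)
    then show ?thesis unfolding has_field_derivative_def .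
  qed
  define L where "L = (- 4 * a\<^sup>2) *\<^sub>C M"
  have "(heat has_derivative (\<lambda>h. h *\<^sub>C L)) (at z)"
    unfolding heat_def[abs_def] L_def
    by (rule has_derivative_eq_rhs[OF has_derivative_compose[OF d3 d2]])
      (simp add: fun_eq_iff scaleC_scaleC mult.commute)
  moreover have "L x = heat z v" if "gen x y" "gen y v" for x y v
  proof -
    have "heat z v = c *\<^sub>C gauss a v" by (simp add: heat_apply a_def c_def)
    also have "\<dots> = (4 * a\<^sup>2 * c) *\<^sub>C gauss_square a x - (2 * a * c) *\<^sub>C gauss a x"
      unfolding gauss_gen_square[OF a(1) that] by (simp add: scaleC.diff_right scaleC_scaleC mult_ac)
    also have "\<dots> = L x"
      using a by (simp add: L_def M_def scaleC_blinfun.rep_eq blinfun.diff_left scaleC.diff_right scaleC.minus_left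
          scaleC_scaleC power2_eq_square mult_ac)
    finally show ?thesis by simp
  qed
  ultimately show ?thesis by blast
qed

text \<open>
  For the group that consists of the identity every derivative along orbits vanishes, so the heat
  equation says that \<open>heat z x\<close> does not depend on \<open>z\<close>. At \<open>z = 1 / 4\<close> the kernel is
  \<open>\<pi>\<^sup>-\<^sup>1\<^sup>/\<^sup>2 exp (- s\<^sup>2)\<close>, whose integral is one.
\<close>

lemma heat_normalization:
  fixes x :: 'x
  assumes z: "Re z > 0"
  shows "csqrt (1 / (4 * z) / of_real pi) *\<^sub>C integral UNIV (\<lambda>s. exp (- (1 / (4 * z) * of_real (s\<^sup>2))) *\<^sub>C x) = x"
proof -
  interpret triv: complex_isometry_group "\<lambda>_. id_blinfun :: 'x \<Rightarrow>\<^sub>L 'x"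
    by unfold_locales auto
  have g: "triv.gen y 0" for y by (simp add: triv.gen_def)
  have "(\<lambda>z. triv.heat z x) z = (\<lambda>z. triv.heat z x) (1 / 4)"
  proof (rule has_derivative_zero_unique[OF convex_halfspace_Re_gt[of 0]])
    fix w assume w: "w \<in> {w. Re w > 0}"
    then obtain L where L: "(triv.heat has_derivative (\<lambda>h. h *\<^sub>C L)) (at w)"
      "\<forall>x y v. triv.gen x y \<longrightarrow> triv.gen y v \<longrightarrow> L x = triv.heat w v"
      using triv.heat_has_derivative by blast
    have "L x = 0" using L(2) g[of x] g[of 0] by (metis blinfun.zero_right)
    then have "((\<lambda>z. triv.heat z x) has_derivative (\<lambda>h. 0)) (at w)"
      using bounded_linear.has_derivative[OF blinfun.bounded_linear_left L(1), of x]
      by (simp add: scaleC_blinfun.rep_eq scaleC.zero_right)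
    then show "((\<lambda>z. triv.heat z x) has_derivative (\<lambda>h. 0)) (at w within {w. Re w > 0})"
      by (rule has_derivative_at_withinI)
  qed (use z in auto)
  also have "triv.heat (1 / 4) x = x"
  proof -
    have "((\<lambda>s. exp (- s\<^sup>2) *\<^sub>R x) has_integral sqrt pi *\<^sub>R x) UNIV"
      using has_integral_linear[OF gauss_moment_even[of 1 0] bounded_linear_scaleR_left[of x]] by (simp add: o_def)
    moreover have "exp (- (1 * complex_of_real (s\<^sup>2))) *\<^sub>C x = exp (- s\<^sup>2) *\<^sub>R x" for s
      by (simp add: exp_of_real[symmetric] scaleC_of_real[symmetric] del: of_real_power flip: of_real_minus)
    ultimately have "triv.gauss 1 x = sqrt pi *\<^sub>R x"
      by (simp add: triv.gauss_apply integral_unique)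
    moreover have "csqrt (1 / of_real pi) = of_real (1 / sqrt pi)"
      using of_real_sqrt[of "1 / pi"] by (simp add: real_sqrt_divide)
    moreover have "of_real (1 / sqrt pi) *\<^sub>C (sqrt pi *\<^sub>R x) = x"
      by (simp only: scaleC_of_real scaleR_scaleR) simp
    ultimately show ?thesis
      by (simp add: triv.heat_apply)
  qed
  finally show ?thesis
    using z by (simp add: triv.heat_apply triv.gauss_apply Re_quarter_inverse_pos)
qed

text \<open>
  The \<open>L\<^sup>1\<close> norm of the kernel is \<open>(|z| / Re z)\<^sup>1\<^sup>/\<^sup>2\<close>, which is bounded on every sector smaller than the half-plane.
\<close>

lemma norm_heat:
  assumes z: "Re z > 0" "cmod z \<le> 2 * Re z"
  shows "norm (heat z) \<le> 2"
proof -
  define a where "a = 1 / (4 * z)"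
  have a: "Re a > 0" and z0: "z \<noteq> 0" using z Re_quarter_inverse_pos[OF z(1)] by (auto simp: a_def)
  have "norm (heat z) \<le> sqrt (cmod a / pi) * sqrt (pi / Re a)"
    using norm_gauss[OF a] by (simp add: heat_def a_def[symmetric] norm_scaleC norm_divide mult_left_mono)
  also have "\<dots> = sqrt (cmod a / Re a)" by (simp add: real_sqrt_mult[symmetric])
  also have "cmod a / Re a = cmod z / Re z"
    using z0 z by (simp add: a_def Re_quarter_inverse norm_divide norm_mult power2_eq_square)
  also have "cmod z / Re z \<le> 2\<^sup>2" using z by (simp add: divide_simps)
  finally show ?thesis by simp
qed

lemma norm_orbit_diff:
  assumes "gen x y"
  shows "norm (U s x - x) \<le> \<bar>s\<bar> * norm y"
proof -
  have "norm (U s x - U 0 x) \<le> norm y * norm (s - 0)"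
  proof (rule differentiable_bound[of UNIV])
    show "((\<lambda>s. U s x) has_derivative (\<lambda>h. h *\<^sub>R U t y)) (at t within UNIV)" for t
      using orbit_has_vector_derivative[OF assms, of t] by (simp add: has_vector_derivative_def)
    show "onorm (\<lambda>h. h *\<^sub>R U t y) \<le> norm y" for t
      by (rule onorm_bound) auto
  qed auto
  then show ?thesis by (simp add: mult.commute)
qed

text \<open>
  Since the kernel has integral one, \<open>heat z x - x\<close> is the average of \<open>U(s) x - x\<close>, of norm at
  most \<open>|s|\<close> times that of \<open>y\<close>; the first absolute moment of the kernel is of order
  \<open>|z|\<^sup>1\<^sup>/\<^sup>2\<close>.
\<close>

lemma norm_heat_diff:
  assumes z: "Re z > 0" "cmod z \<le> 2 * Re z" and g: "gen x y"
  shows "norm (heat z x - x) \<le> 4 * sqrt (cmod z) * norm y"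
proof -
  define a where "a = 1 / (4 * z)"
  have a: "Re a > 0" and z0: "z \<noteq> 0" using z Re_quarter_inverse_pos[OF z(1)] by (auto simp: a_def)
  interpret triv: complex_isometry_group "\<lambda>_. id_blinfun :: 'x \<Rightarrow>\<^sub>L 'x"
    by unfold_locales auto
  note i = kernel_integrable[OF gauss_kernel(1)[OF a]] triv.kernel_integrable[OF triv.gauss_kernel(1)[OF a]]
  have i2: "(\<lambda>s. exp (- (a * of_real (s\<^sup>2))) *\<^sub>C x) integrable_on UNIV" using i(2) by simp
  have "heat z x - x = csqrt (a / of_real pi) *\<^sub>C
      (integral UNIV (\<lambda>s. exp (- (a * of_real (s\<^sup>2))) *\<^sub>C U s x) - integral UNIV (\<lambda>s. exp (- (a * of_real (s\<^sup>2))) *\<^sub>C x))"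
    using heat_normalization[OF z(1), of x] by (simp add: heat_apply a_def[symmetric] gauss_apply[OF a] scaleC.diff_right)
  also have "\<dots> = csqrt (a / of_real pi) *\<^sub>C integral UNIV (\<lambda>s. exp (- (a * of_real (s\<^sup>2))) *\<^sub>C (U s x - x))"
    by (simp only: integral_diff[OF i(1) i2] scaleC.diff_right)
  finally have "norm (heat z x - x) =
      sqrt (cmod a / pi) * norm (integral UNIV (\<lambda>s. exp (- (a * of_real (s\<^sup>2))) *\<^sub>C (U s x - x)))"
    by (simp add: norm_scaleC norm_divide)
  also have "norm (integral UNIV (\<lambda>s. exp (- (a * of_real (s\<^sup>2))) *\<^sub>C (U s x - x)))
      \<le> integral UNIV (\<lambda>s. norm y * (\<bar>s\<bar> * exp (- (Re a * s\<^sup>2))))"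
  proof (rule integral_norm_bound_integral)
    show "(\<lambda>s. exp (- (a * of_real (s\<^sup>2))) *\<^sub>C (U s x - x)) integrable_on UNIV"
      using integrable_diff[OF i(1) i2] by (simp add: scaleC.diff_right)
    show "(\<lambda>s. norm y * (\<bar>s\<bar> * exp (- (Re a * s\<^sup>2)))) integrable_on UNIV"
      using gauss_moment_abs[OF a] by (intro integrable_on_mult_right) auto
    show "norm (exp (- (a * of_real (s\<^sup>2))) *\<^sub>C (U s x - x)) \<le> norm y * (\<bar>s\<bar> * exp (- (Re a * s\<^sup>2)))" for s
      using mult_left_mono[OF norm_orbit_diff[OF g, of s], of "exp (- (Re a * s\<^sup>2))"]
      by (simp add: norm_scaleC mult_ac)
  qed
  also have "\<dots> = norm y * (1 / Re a)"
    using gauss_moment_abs[OF a] by (simp add: integral_unique)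
  finally have 1: "norm (heat z x - x) \<le> sqrt (cmod a / pi) * (norm y * (1 / Re a))"
    using z0 by (simp add: mult_left_mono a_def)
  have "sqrt (cmod a / pi) \<le> sqrt (cmod a)"
    using pi_ge_two by (intro real_sqrt_le_mono) (simp add: divide_le_eq mult_le_cancel_left1)
  also have "sqrt (cmod a) = 1 / (2 * sqrt (cmod z))"
    by (simp add: a_def norm_divide norm_mult real_sqrt_divide real_sqrt_mult)
  finally have 2: "sqrt (cmod a / pi) \<le> 1 / (2 * sqrt (cmod z))" .
  have 3: "1 / Re a \<le> 8 * cmod z"
  proof -
    have "1 / Re a = 4 * cmod z * cmod z / Re z"
      using z by (simp add: a_def Re_quarter_inverse power2_eq_square)
    also have "\<dots> \<le> 4 * cmod z * (2 * Re z) / Re z"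
      using z by (intro divide_right_mono mult_left_mono) auto
    finally show ?thesis using z by simp
  qed
  have "sqrt (cmod a / pi) * (norm y * (1 / Re a)) \<le> 1 / (2 * sqrt (cmod z)) * (norm y * (8 * cmod z))"
    using a by (intro mult_mono 2 3 mult_left_mono) auto
  also have "\<dots> = 4 * sqrt (cmod z) * norm y"
  proof -
    define q where "q = sqrt (cmod z)"
    have "q > 0" "cmod z = q * q" using z0 by (simp_all add: q_def)
    then show ?thesis unfolding q_def[symmetric] by (simp add: field_simps)
  qed
  finally show ?thesis using 1 by linarith
qed

lemma heat_tendsto:
  "((\<lambda>z. heat z x) \<longlongrightarrow> x) (at 0 within {z. Re z > 0 \<and> cmod z \<le> 2 * Re z})"
proof (rule tendstoI)
  fix e :: real assume e: "e > 0"
  obtain u v where uv: "\<And>n. gen (u n) (v n)" "u \<longlonglongrightarrow> x" using gen_dense[of x] by blast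
  have "e / 6 > 0" using e by simp
  then obtain n where n: "dist (u n) x < e / 6"
    using uv(2) unfolding tendsto_iff eventually_sequentially by blast
  let ?F = "at 0 within {z. Re z > 0 \<and> cmod z \<le> 2 * Re z}"
  have "((\<lambda>z. 4 * sqrt (cmod z) * norm (v n)) \<longlongrightarrow> 4 * sqrt (cmod 0) * norm (v n)) ?F"
    by (intro tendsto_intros)
  then have "\<forall>\<^sub>F z in ?F. 4 * sqrt (cmod z) * norm (v n) < e / 2"
    using e by (intro order_tendstoD(2)) auto
  moreover have "\<forall>\<^sub>F z in ?F. Re z > 0 \<and> cmod z \<le> 2 * Re z"
    by (auto simp: eventually_at_filter)
  ultimately show "\<forall>\<^sub>F z in ?F. dist (heat z x) x < e"
  proof eventually_elim
    case (elim z)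
    have "heat z x - x = heat z (x - u n) + (heat z (u n) - u n) + (u n - x)"
      by (simp add: blinfun.diff_right)
    then have "norm (heat z x - x) \<le> norm (heat z (x - u n)) + norm (heat z (u n) - u n) + norm (u n - x)"
      by (metis norm_triangle_ineq norm_triangle_mono order_refl)
    moreover have "norm (heat z (x - u n)) \<le> 2 * norm (x - u n)"
      using norm_blinfun[of "heat z" "x - u n"] norm_heat elim by (meson mult_right_mono norm_ge_zero order_trans)
    moreover have "norm (heat z (u n) - u n) < e / 2"
      using norm_heat_diff[OF _ _ uv(1)[of n], of z] elim by linarith
    moreover have "norm (u n - x) < e / 6" "norm (x - u n) < e / 6"
      using n by (simp_all add: dist_norm norm_minus_commute)
    ultimately show ?case by (simp add: dist_norm)
  qed
qed

end

section \<open>The exponential of a bounded operator\<close>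

definition op_power :: "('x::real_normed_vector \<Rightarrow>\<^sub>L 'x) \<Rightarrow> nat \<Rightarrow> 'x \<Rightarrow>\<^sub>L 'x" where
  "op_power B n = ((\<lambda>P. B o\<^sub>L P) ^^ n) id_blinfun"

text \<open>
  The series is taken in the normed space of operators: on the zero space the identity has norm zero,
  so that operators need not form a unital normed algebra.
\<close>

definition op_exp :: "('x::{complex_normed_vector, banach} \<Rightarrow>\<^sub>L 'x) \<Rightarrow> complex \<Rightarrow> 'x \<Rightarrow>\<^sub>L 'x" where
  "op_exp B z = (\<Sum>n. (z ^ n / fact n) *\<^sub>C op_power B n)"

lemma op_power_0 [simp]: "op_power B 0 = id_blinfun"
  and op_power_Suc: "op_power B (Suc n) = B o\<^sub>L op_power B n"
  by (simp_all add: op_power_def)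

lemma norm_op_power: "norm (op_power B n) \<le> norm B ^ n"
proof (induction n)
  case (Suc n)
  then show ?case
    using norm_blinfun_compose[of B "op_power B n"] mult_left_mono[OF Suc, of "norm B"]
    by (simp add: op_power_Suc)
qed (simp add: norm_blinfun_id_le)

lemma norm_op_exp_term:
  fixes B :: "'x::{complex_normed_vector, banach} \<Rightarrow>\<^sub>L 'x"
  assumes "cmod z \<le> r"
  shows "norm ((z ^ n / fact n) *\<^sub>C op_power B n) \<le> inverse (fact n) * (r * norm B) ^ n"
proof -
  have "cmod z ^ n * norm (op_power B n) \<le> r ^ n * norm B ^ n"
    using assms order_trans[OF norm_ge_zero assms] by (intro mult_mono power_mono norm_op_power) auto
  then show ?thesis
    by (simp add: norm_scaleC norm_divide norm_power power_mult_distrib divide_right_mono field_simps)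
qed

lemma summable_op_exp: "summable (\<lambda>n. (z ^ n / fact n) *\<^sub>C op_power B n)"
  for B :: "'x::{complex_normed_vector, banach} \<Rightarrow>\<^sub>L 'x"
  by (rule summable_comparison_test'[OF summable_exp[of "cmod z * norm B"]]) (rule norm_op_exp_term, simp)

lemma op_exp_0 [simp]: "op_exp B 0 = id_blinfun"
proof -
  have "(\<Sum>n. (0 ^ n / fact n) *\<^sub>C op_power B n) = (\<Sum>n\<in>{0}. (0 ^ n / fact n) *\<^sub>C op_power B n)"
    by (rule suminf_finite) (auto simp: power_0_left scaleC.zero_left)
  then show ?thesis by (simp add: op_exp_def)
qed

lemma op_exp_apply:
  "op_exp B z x = (\<Sum>n. (z ^ n / fact n) *\<^sub>C op_power B n x)"
  "summable (\<lambda>n. (z ^ n / fact n) *\<^sub>C op_power B n x)"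
  using bounded_linear.suminf[OF blinfun.bounded_linear_left summable_op_exp[of z B], of x]
    bounded_linear.summable[OF blinfun.bounded_linear_left summable_op_exp[of z B], of x]
  by (simp_all add: op_exp_def scaleC_blinfun.rep_eq)

lemma op_power_commute:
  fixes B :: "'x::real_normed_vector \<Rightarrow>\<^sub>L 'x"
  shows "(\<And>x. P (B x) = B (P x)) \<Longrightarrow> P (op_power B n x) = op_power B n (P x)"
  by (induction n) (simp_all add: op_power_Suc)

lemma op_exp_commute:
  fixes B :: "'x::{complex_normed_vector, banach} \<Rightarrow>\<^sub>L 'x"
  assumes "bounded_linear P" "\<And>c x. P (c *\<^sub>C x) = c *\<^sub>C P x" "\<And>x. P (B x) = B (P x)"
  shows "P (op_exp B z x) = op_exp B z (P x)"
  using bounded_linear.suminf[OF assms(1) op_exp_apply(2)[of z B x]]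
  by (simp add: op_exp_apply(1) assms(2) op_power_commute[of P B, OF assms(3)])

lemma op_exp_conj:
  fixes B :: "'x::{complex_normed_vector, banach} \<Rightarrow>\<^sub>L 'x"
  assumes "bounded_linear J" "\<And>c x. J (c *\<^sub>C x) = cnj c *\<^sub>C J x" "\<And>x. J (B x) = B (J x)"
  shows "J (op_exp B z x) = op_exp B (cnj z) (J x)"
  using bounded_linear.suminf[OF assms(1) op_exp_apply(2)[of z B x]]
  by (simp add: op_exp_apply(1) assms(2) op_power_commute[of J B, OF assms(3)])

text \<open>
  Termwise differentiation; the shifted series of derivatives converges uniformly on discs.
\<close>

lemma op_exp_has_derivative:
  fixes B :: "'x::{complex_normed_vector, banach} \<Rightarrow>\<^sub>L 'x"
  assumes B: "\<And>c x. B (c *\<^sub>C x) = c *\<^sub>C B x"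
  shows "(op_exp B has_derivative (\<lambda>h. h *\<^sub>C (B o\<^sub>L op_exp B z))) (at z)"
proof -
  define r where "r = cmod z + 1"
  define t where "t = (\<lambda>n w. (w ^ n / fact n) *\<^sub>C op_power B n)"
  define t' where "t' = (\<lambda>n w (h::complex). h *\<^sub>C (case n of 0 \<Rightarrow> 0 | Suc m \<Rightarrow> B o\<^sub>L t m w))"
  have comp: "B o\<^sub>L (c *\<^sub>C P) = c *\<^sub>C (B o\<^sub>L P)" for c and P :: "'x \<Rightarrow>\<^sub>L 'x"
    by (rule blinfun_eqI) (simp add: scaleC_blinfun.rep_eq B)
  have unif: "uniform_limit (ball (0::complex) r) (\<lambda>n w. \<Sum>i<n. t i w) (op_exp B) sequentially"
    unfolding op_exp_def[abs_def] t_def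
    by (rule Weierstrass_m_test[OF norm_op_exp_term[where r = r] summable_exp]) (auto simp: dist_norm)
  have "\<exists>g. \<forall>w\<in>ball (0::complex) r. (\<lambda>n. t n w) sums g w \<and> (g has_derivative (\<lambda>h. h *\<^sub>C (B o\<^sub>L op_exp B w))) (at w within ball (0::complex) r)"
  proof (rule has_derivative_series[where f' = t'])
    show "convex (ball (0::complex) r)" by simp
    show "0 \<in> ball (0::complex) r" by (auto simp: r_def add_nonneg_pos)
    show "(\<lambda>n. t n 0) sums op_exp B 0"
      unfolding op_exp_def t_def by (rule summable_sums[OF summable_op_exp])
    show "(t n has_derivative t' n w) (at w within ball (0::complex) r)" for n w
    proof (cases n)
      case 0
      then show ?thesis by (simp add: t_def t'_def scaleC.zero_right)
    next
      case (Suc m)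
      have "((\<lambda>w. w ^ n / fact n) has_field_derivative w ^ m / fact m) (at w within ball (0::complex) r)"
        using DERIV_cdivide[OF DERIV_power[OF DERIV_ident, where n = "Suc m"], of "fact (Suc m)"]
        by (simp add: Suc fact_Suc del: of_nat_Suc power_Suc)
      from bounded_linear.has_derivative[OF scaleC.bounded_linear_left has_field_derivative_imp_has_derivative[OF this], of "op_power B n"]
      show ?thesis
        by (simp add: t_def t'_def Suc op_power_Suc comp scaleC_scaleC mult.commute del: power_Suc fact_Suc)
    qed
    show "\<forall>\<^sub>F n in sequentially. \<forall>w\<in>ball (0::complex) r. \<forall>h. norm (sum (\<lambda>i. t' i w h) {..<n} - h *\<^sub>C (B o\<^sub>L op_exp B w)) \<le> e * norm h"
      if e: "e > 0" for e
    proof -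
      have "e / (norm B + 1) > 0" using e by (simp add: add_nonneg_pos)
      then have "\<forall>\<^sub>F n in sequentially. \<forall>w\<in>ball (0::complex) r. dist (\<Sum>i<n. t i w) (op_exp B w) < e / (norm B + 1)"
        using unif unfolding uniform_limit_iff by blast
      then have "\<forall>\<^sub>F n in sequentially. \<forall>w\<in>ball (0::complex) r. \<forall>h. norm (sum (\<lambda>i. t' i w h) {..<Suc n} - h *\<^sub>C (B o\<^sub>L op_exp B w)) \<le> e * norm h"
      proof eventually_elim
        case (elim n)
        show ?case
        proof (intro ballI allI)
          fix w h assume w: "w \<in> ball (0::complex) r"
          have "sum (\<lambda>i. t' i w h) {..<Suc n} = h *\<^sub>C (B o\<^sub>L (\<Sum>i<n. t i w))"
            unfolding sum.lessThan_Suc_shift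
            by (simp add: t'_def scaleC.zero_right scaleC.sum_right[symmetric]
                bounded_bilinear.sum_right[OF bounded_bilinear_blinfun_compose])
          then have "norm (sum (\<lambda>i. t' i w h) {..<Suc n} - h *\<^sub>C (B o\<^sub>L op_exp B w))
              = cmod h * norm (B o\<^sub>L ((\<Sum>i<n. t i w) - op_exp B w))"
            by (simp add: scaleC.diff_right[symmetric] norm_scaleC
                bounded_bilinear.diff_right[OF bounded_bilinear_blinfun_compose])
          also have "\<dots> \<le> cmod h * (norm B * (e / (norm B + 1)))"
            using elim w by (intro mult_left_mono order_trans[OF norm_blinfun_compose]) (auto simp: dist_norm intro: less_imp_le)
          also have "\<dots> \<le> cmod h * e"
            using e by (intro mult_left_mono) (auto simp: divide_simps add_nonneg_pos)
          finally show "norm (sum (\<lambda>i. t' i w h) {..<Suc n} - h *\<^sub>C (B o\<^sub>L op_exp B w)) \<le> e * norm h"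
            by (simp add: mult.commute)
        qed
      qed
      then show ?thesis by (rule eventually_sequentially_Suc[THEN iffD1])
    qed
  qed
  then obtain g where g: "\<And>w. w \<in> ball (0::complex) r \<Longrightarrow> (\<lambda>n. t n w) sums g w"
    "\<And>w. w \<in> ball (0::complex) r \<Longrightarrow> (g has_derivative (\<lambda>h. h *\<^sub>C (B o\<^sub>L op_exp B w))) (at w within ball (0::complex) r)" by blast
  have eq: "g w = op_exp B w" if "w \<in> ball (0::complex) r" for w
    using sums_unique[OF g(1)[OF that]] by (simp add: op_exp_def t_def)
  have z: "z \<in> ball (0::complex) r" by (simp add: r_def)
  have "(g has_derivative (\<lambda>h. h *\<^sub>C (B o\<^sub>L op_exp B z))) (at z)"
    using g(2)[OF z] at_within_open[OF z open_ball] by simp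
  then show ?thesis
    by (rule has_derivative_transform_within_open[OF _ open_ball z eq])
qed

section \<open>Resolvents\<close>

lemma is_resolvent_unique:
  assumes "is_resolvent D A z R" "is_resolvent D A z R'"
  shows "R = R'"
proof (rule blinfun_eqI)
  fix f
  have "R' f \<in> D" "z *\<^sub>C R' f - A (R' f) = f"
    using assms(2) by (auto simp: is_resolvent_def)
  moreover from this have "R (z *\<^sub>C R' f - A (R' f)) = R' f"
    using assms(1) unfolding is_resolvent_def by blast
  ultimately show "R f = R' f" by simp
qed

lemma resolvent_eq: "is_resolvent D A z R \<Longrightarrow> resolvent D A z = R"
  unfolding resolvent_def by (rule the_equality) (auto dest: is_resolvent_unique)

text \<open>
  The graph of \<open>A\<close> is the set of pairs \<open>(x, y)\<close> with \<open>x = R (z x - y)\<close>.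
\<close>

lemma is_resolvent_imp_closed_operator:
  assumes R: "is_resolvent D A z R"
  shows "closed_operator D A"
  unfolding closed_operator_def closed_sequential_limits
proof (intro allI impI, elim conjE)
  fix p l assume p: "\<forall>n. p n \<in> {(u, A u) |u. u \<in> D}" and lim: "p \<longlonglongrightarrow> l"
  define u where "u = (\<lambda>n. fst (p n))"
  obtain x y where l: "l = (x, y)" by fastforce
  have pu: "p n = (u n, A (u n))" "u n \<in> D" for n using p[rule_format, of n] by (auto simp: u_def)
  have u: "u \<longlonglongrightarrow> x" using tendsto_fst[OF lim] by (simp add: u_def l)
  have Au: "(\<lambda>n. A (u n)) \<longlonglongrightarrow> y" using tendsto_snd[OF lim] by (simp add: pu l)
  have "(\<lambda>n. R (z *\<^sub>C u n - A (u n))) \<longlonglongrightarrow> R (z *\<^sub>C x - y)"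
    by (intro blinfun.tendsto tendsto_const tendsto_diff scaleC.tendsto u Au)
  then have "u \<longlonglongrightarrow> R (z *\<^sub>C x - y)"
    using R pu(2) by (simp add: is_resolvent_def)
  then have x: "x = R (z *\<^sub>C x - y)" using u LIMSEQ_unique by blast
  then have "x \<in> D" "z *\<^sub>C x - A x = z *\<^sub>C x - y" using R by (metis is_resolvent_def)+
  then show "l \<in> {(u, A u) |u. u \<in> D}" by (auto simp: l)
qed

text \<open>
  The inverse of \<open>id - Q\<close>, by the contraction principle.
\<close>

lemma contraction_solution_operator:
  fixes Q :: "'x::banach \<Rightarrow>\<^sub>L 'x"
  assumes Q: "norm Q \<le> 1 / 2"
  shows "\<exists>S. (\<forall>f. blinfun_apply S f = f + Q (S f)) \<and> (\<forall>f x. x = f + Q x \<longrightarrow> x = S f) \<and> norm S \<le> 2"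
proof -
  have "\<exists>!x. f + Q x = x" for f
  proof (rule banach_fix_type[where c = "1/2"])
    show "\<forall>x y. dist (f + Q x) (f + Q y) \<le> 1 / 2 * dist x y"
    proof (intro allI)
      fix x y
      have "norm (Q (x - y)) \<le> 1 / 2 * norm (x - y)"
        using norm_blinfun[of Q "x - y"] mult_right_mono[OF Q, of "norm (x - y)"] by simp
      then show "dist (f + Q x) (f + Q y) \<le> 1 / 2 * dist x y"
        by (simp add: dist_norm blinfun.diff_right)
    qed
  qed auto
  then obtain s where s: "\<And>f. f + Q (s f) = s f" "\<And>f x. f + Q x = x \<Longrightarrow> x = s f"
    by metis
  have bl: "bounded_linear s"
  proof (rule bounded_linear_intro[where K = 2])
    fix f g and r :: real
    show "s (f + g) = s f + s g"
      by (rule s(2)[symmetric]) (use arg_cong2[of _ _ _ _ "(+)", OF s(1)[of f] s(1)[of g]] in \<open>simp only: blinfun.add_right add_ac\<close>)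
    show "s (r *\<^sub>R f) = r *\<^sub>R s f"
      by (rule s(2)[symmetric]) (use arg_cong[OF s(1)[of f], of "scaleR r"] in \<open>simp add: blinfun.scaleR_right scaleR_add_right\<close>)
    have "norm (s f) \<le> norm f + norm (Q (s f))" using norm_triangle_ineq[of f "Q (s f)"] s(1)[of f] by simp
    moreover have "norm (Q (s f)) \<le> 1 / 2 * norm (s f)"
      using norm_blinfun[of Q "s f"] mult_right_mono[OF Q, of "norm (s f)"] by simp
    ultimately show "norm (s f) \<le> norm f * 2" by simp
  qed
  show ?thesis
  proof (intro exI[of _ "Blinfun s"] conjI allI impI)
    show "norm (Blinfun s) \<le> 2"
    proof (rule norm_blinfun_bound)
      fix f
      have "norm (s f) \<le> norm f + norm (Q (s f))" using norm_triangle_ineq[of f "Q (s f)"] s(1)[of f] by simp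
      moreover have "norm (Q (s f)) \<le> 1 / 2 * norm (s f)"
        using norm_blinfun[of Q "s f"] mult_right_mono[OF Q, of "norm (s f)"] by simp
      ultimately show "norm (Blinfun s f) \<le> 2 * norm f" by (simp add: bounded_linear_Blinfun_apply bl)
    qed simp
  qed (use s in \<open>simp_all add: bounded_linear_Blinfun_apply bl\<close>)
qed

text \<open>
  With vertex \<open>- K\<close> and \<open>z = w - K\<close>, the condition on the argument says \<open>Re w \<le> |w| / 2\<close>, and
  \<open>(Re l)\<^sup>2 = (|z| - Re z) / 2\<close> for \<open>l\<^sup>2 = - z\<close>. The first bound gives the decay of the resolvent,
  the second one makes room for the perturbation.
\<close>

lemma sector_bounds:
  assumes K: "K > 0" and w: "w \<noteq> 0" "pi / 3 \<le> \<bar>Arg w\<bar>"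
  defines "z \<equiv> w - of_real K"
  shows "(Re (csqrt (- z)))\<^sup>2 \<ge> cmod w / 4" "(Re (csqrt (- z)))\<^sup>2 \<ge> K / 4" "Re (csqrt (- z)) > 0"
proof -
  have "Re w = cmod w * cos \<bar>Arg w\<bar>"
    by (metis Re_rcis cos_abs_real rcis_cmod_Arg)
  also have "cos \<bar>Arg w\<bar> \<le> cos (pi / 3)"
    by (rule cos_monotone_0_pi_le) (use w Arg_le_pi[of w] mpi_less_Arg[of w] in auto)
  finally have Rw: "Re w \<le> cmod w / 2"
    by (simp add: cos_60 mult_left_mono)
  have "\<bar>Re z\<bar> \<le> cmod z" by (rule abs_Re_le_cmod)
  then have sq: "(Re (csqrt (- z)))\<^sup>2 = (cmod z - Re z) / 2" by simp
  have Rz: "Re z = Re w - K" by (simp add: z_def)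
  have t: "cmod w \<le> cmod z + K" using norm_triangle_ineq[of z "of_real K"] K by (simp add: z_def)
  show 1: "(Re (csqrt (- z)))\<^sup>2 \<ge> cmod w / 4" unfolding sq using Rw Rz t by simp
  show 2: "(Re (csqrt (- z)))\<^sup>2 \<ge> K / 4"
  proof (cases "cmod w \<ge> K")
    case True
    then show ?thesis using 1 by simp
  next
    case False
    then have "Re z \<le> - K / 2" using Rw Rz by linarith
    moreover have "K / 4 \<le> (c - r) / 2" if "r \<le> - K / 2" "0 \<le> c" for c r :: real
      using that by (simp add: field_simps)
    ultimately show ?thesis unfolding sq using norm_ge_zero by blast
  qed
  show "Re (csqrt (- z)) > 0"
    using 2 K Re_csqrt[of "- z"] by (cases "Re (csqrt (- z)) = 0") auto
qed

section \<open>Perturbed squares of generators\<close>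

text \<open>
  The assumptions on \<open>D\<close> and \<open>A\<close> say that \<open>A = B - G\<^sup>2\<close> with domain \<open>D(G\<^sup>2)\<close>.
\<close>

locale perturbed_square = complex_isometry_group U
  for U :: "real \<Rightarrow> 'x::{complex_normed_vector, banach} \<Rightarrow>\<^sub>L 'x" +
  fixes B :: "'x \<Rightarrow>\<^sub>L 'x" and D :: "'x set" and A :: "'x \<Rightarrow> 'x"
  assumes B_scaleC: "B (c *\<^sub>C x) = c *\<^sub>C B x"
    and B_U: "B (U s x) = U s (B x)"
    and D_iff: "x \<in> D \<longleftrightarrow> (\<exists>y z. gen x y \<and> gen y z)"
    and A_eq: "gen x y \<Longrightarrow> gen y z \<Longrightarrow> A x = B x - z"
begin

lemma A_clinear: "clinear_operator D A"
  unfolding clinear_operator_def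
proof (intro conjI ballI allI)
  show "0 \<in> D" using gen_zero D_iff by blast
next
  fix u v assume "u \<in> D" "v \<in> D"
  then obtain a b c d where g: "gen u a" "gen a b" "gen v c" "gen c d" by (auto simp: D_iff)
  note g' = gen_add[OF g(1,3)] gen_add[OF g(2,4)]
  show "u + v \<in> D" "A (u + v) = A u + A v"
    using g' by (auto simp: D_iff A_eq[OF g(1,2)] A_eq[OF g(3,4)] A_eq[OF g'] blinfun.add_right)
next
  fix u and c :: complex assume "u \<in> D"
  then obtain a b where g: "gen u a" "gen a b" by (auto simp: D_iff)
  note g' = gen_scaleC[OF g(1)] gen_scaleC[OF g(2)]
  show "c *\<^sub>C u \<in> D" "A (c *\<^sub>C u) = c *\<^sub>C A u"
    using g' by (auto simp: D_iff A_eq[OF g] A_eq[OF g'] B_scaleC scaleC.diff_right)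
qed

lemma D_commute:
  assumes "bounded_linear P" "\<And>s x. P (U s x) = U s (P x)" "\<And>x. P (B x) = B (P x)" "x \<in> D"
  shows "P x \<in> D" "A (P x) = P (A x)"
proof -
  obtain a b where g: "gen x a" "gen a b" using assms(4) by (auto simp: D_iff)
  note g' = gen_commute[OF assms(1,2) g(1)] gen_commute[OF assms(1,2) g(2)]
  interpret P: bounded_linear P by (rule assms(1))
  show "P x \<in> D" "A (P x) = P (A x)"
    using g' by (auto simp: D_iff A_eq[OF g] A_eq[OF g'] P.diff assms(3))
qed

text \<open>
  The Laplace transform at \<open>1\<close> maps \<open>D(G)\<close> into \<open>D(G\<^sup>2)\<close>. It is continuous with range
  \<open>D(G)\<close>, so density of \<open>D(G)\<close> passes to \<open>D(G\<^sup>2)\<close>.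
\<close>

lemma D_dense: "densely_defined D"
proof -
  have 1: "u \<in> closure D" if g: "gen u v" for u v
  proof -
    obtain p q where pq: "\<And>n. gen (p n) (q n)" "p \<longlonglongrightarrow> u - v" using gen_dense[of "u - v"] by blast
    have l: "Re 1 > 0" by simp
    have "laplace 1 (p n) \<in> D" for n
    proof -
      have g1: "gen (laplace 1 (p n)) (laplace 1 (p n) - p n)" using gen_laplace[OF l, of "p n"] by simp
      have "gen (laplace 1 (p n) - p n) ((laplace 1 (p n) - p n) - q n)"
        using gen_add[OF g1 gen_scaleR[OF pq(1)[of n], of "-1"]] by simp
      then show ?thesis using g1 by (auto simp: D_iff)
    qed
    moreover have "(\<lambda>n. laplace 1 (p n)) \<longlonglongrightarrow> laplace 1 (u - v)"
      by (rule blinfun.tendsto[OF tendsto_const pq(2)])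
    moreover have "laplace 1 (u - v) = u" using laplace_gen[OF l g] by simp
    ultimately show ?thesis unfolding closure_sequential by metis
  qed
  have "x \<in> closure D" for x
  proof -
    obtain p q where "\<And>n. gen (p n) (q n)" "p \<longlonglongrightarrow> x" using gen_dense[of x] by blast
    then have "x \<in> closure (closure D)" using 1 unfolding closure_sequential by metis
    then show ?thesis by simp
  qed
  then show ?thesis by (auto simp: densely_defined_def)
qed

text \<open>
  The equation \<open>- l\<^sup>2 x - A x = f\<close> reads \<open>(l\<^sup>2 - G\<^sup>2) x = - f - B x\<close>, that is
  \<open>x = - Q f - Q B x\<close> with \<open>Q = (l\<^sup>2 - G\<^sup>2)\<^sup>-\<^sup>1\<close>; the assumption makes \<open>Q B\<close> a contraction
  with factor \<open>1 / 2\<close>.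
\<close>

lemma resolvent_bound:
  assumes l: "Re l > 0" "2 * norm B \<le> (Re l)\<^sup>2"
  shows "\<exists>R. is_resolvent D A (- (l\<^sup>2)) R \<and> norm R \<le> 2 / (Re l)\<^sup>2"
proof -
  define Q where "Q = square_resolvent l"
  have nQ: "norm Q \<le> 1 / (Re l)\<^sup>2" unfolding Q_def by (rule norm_square_resolvent[OF l(1)])
  have "norm (- (Q o\<^sub>L B)) \<le> 1 / (Re l)\<^sup>2 * norm B"
    using norm_blinfun_compose[of Q B] mult_right_mono[OF nQ, of "norm B"] by simp
  also have "\<dots> \<le> 1 / 2" using l by (simp add: divide_simps)
  finally obtain S :: "'x \<Rightarrow>\<^sub>L 'x" where S: "\<And>f. S f = f + (- (Q o\<^sub>L B)) (S f)"
    "\<And>f x. x = f + (- (Q o\<^sub>L B)) x \<Longrightarrow> x = S f" "norm S \<le> 2"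
    using contraction_solution_operator by metis
  define R where "R = - (S o\<^sub>L Q)"
  have R: "R f = - Q (f + B (R f))" for f
    using S(1)[of "Q f"] by (simp add: R_def blinfun.minus_left blinfun.minus_right blinfun.add_right blinfun.diff_right)
  have "is_resolvent D A (- (l\<^sup>2)) R"
    unfolding is_resolvent_def
  proof (intro conjI allI ballI)
    fix f
    define g where "g = f + B (R f)"
    obtain v where v: "gen (Q g) v" "gen v (l\<^sup>2 *\<^sub>C Q g - g)"
      using square_resolvent_right[OF l(1), of g] by (auto simp: Q_def)
    have Rf: "R f = - Q g" using R[of f] by (simp add: g_def)
    have g': "gen (R f) (- v)" "gen (- v) (- (l\<^sup>2 *\<^sub>C Q g - g))"
      using gen_scaleR[OF v(1), of "-1"] gen_scaleR[OF v(2), of "-1"] by (simp_all add: Rf)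
    then show "R f \<in> D" by (auto simp: D_iff)
    have "A (R f) = B (R f) + (l\<^sup>2 *\<^sub>C Q g - g)" using A_eq[OF g'] by simp
    moreover have "l\<^sup>2 *\<^sub>C R f = - (l\<^sup>2 *\<^sub>C Q g)" unfolding Rf by (simp add: scaleC.minus_right)
    moreover have "g - B (R f) = f" by (simp add: g_def)
    ultimately show "- (l\<^sup>2) *\<^sub>C R f - A (R f) = f" by (simp add: scaleC.minus_left)
  next
    fix u assume "u \<in> D"
    then obtain y v where g: "gen u y" "gen y v" by (auto simp: D_iff)
    define f where "f = - (l\<^sup>2) *\<^sub>C u - A u"
    have f: "f + B u = - (l\<^sup>2 *\<^sub>C u - v)" by (simp add: f_def A_eq[OF g] scaleC.minus_left)
    have "Q (f + B u) = - u"
      unfolding f blinfun.minus_right using square_resolvent_left[OF l(1) g] by (simp add: Q_def)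
    then have "- u = Q f + (- (Q o\<^sub>L B)) (- u)"
      by (simp add: blinfun.minus_left blinfun.minus_right blinfun.add_right)
    from S(2)[OF this] show "R (- (l\<^sup>2) *\<^sub>C u - A u) = u"
      unfolding f_def[symmetric] by (simp add: R_def blinfun.minus_left) (metis minus_minus)
  qed
  moreover have "norm R \<le> 2 * (1 / (Re l)\<^sup>2)"
    unfolding R_def norm_minus_cancel using S(3) nQ
    by (intro order_trans[OF norm_blinfun_compose] mult_mono) auto
  ultimately show ?thesis by auto
qed

text \<open>
  The vertex lies so far to the left that \<open>(Re l)\<^sup>2\<close>, which is at least a quarter of its distance
  to the origin, exceeds twice the norm of \<open>B\<close>; the summand \<open>1\<close> keeps \<open>Re l\<close> positive if
  \<open>B = 0\<close>.
\<close>

lemma sector_resolvent: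
  assumes "z \<in> sector (- (8 * norm B + 1)) (pi / 3)"
  shows "\<exists>R. is_resolvent D A z R \<and> norm R \<le> 8 / cmod (z - of_real (- (8 * norm B + 1)))"
proof -
  define K where "K = 8 * norm B + 1"
  define w where "w = z - of_real (- (8 * norm B + 1))"
  have K: "K > 0" by (simp add: K_def add_nonneg_pos)
  have w: "w \<noteq> 0" "pi / 3 \<le> \<bar>Arg w\<bar>" "z = w - of_real K"
    using assms by (simp_all only: sector_def w_def K_def mem_Collect_eq) simp_all
  define l where "l = csqrt (- z)"
  note b = sector_bounds[OF K w(1,2), folded w(3), folded l_def]
  have "2 * norm B \<le> (Re l)\<^sup>2" using b(2) by (simp add: K_def)
  then obtain R where R: "is_resolvent D A (- (l\<^sup>2)) R" "norm R \<le> 2 / (Re l)\<^sup>2"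
    using resolvent_bound[OF b(3)] by blast
  have "2 / (Re l)\<^sup>2 \<le> 2 / (cmod w / 4)"
    using w(1) b by (intro divide_left_mono) auto
  then have "norm R \<le> 8 / cmod w" using R(2) by simp
  then show ?thesis using R(1) unfolding w_def by (auto simp: l_def)
qed

lemma sector_bound: "sector_resolvent_bound D A"
  unfolding sector_resolvent_bound_def
proof (intro exI conjI ballI subsetI)
  fix z assume "z \<in> sector (- (8 * norm B + 1)) (pi / 3)"
  from sector_resolvent[OF this] show "z \<in> resolvent_set D A"
    "norm (resolvent D A z) \<le> 8 / cmod (z - of_real (- (8 * norm B + 1)))"
    by (auto simp: resolvent_set_def resolvent_eq)
qed auto

lemma ex_resolvent: "\<exists>z R. is_resolvent D A z R"
proof -
  have "- complex_of_real (8 * norm B + 2) \<in> sector (- (8 * norm B + 1)) (pi / 3)"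
  proof -
    have "- complex_of_real (8 * norm B + 2) - of_real (- (8 * norm B + 1)) = - 1" by simp
    then show ?thesis using Arg_of_real[of "-1"] pi_gt_zero by (simp add: sector_def)
  qed
  then show ?thesis using sector_resolvent by blast
qed

theorem sectorial: "sectorial D A"
  using A_clinear D_dense sector_bound ex_resolvent is_resolvent_imp_closed_operator
  unfolding sectorial_def by blast

end

context perturbed_square
begin

text \<open>
  \<open>exp (- z A) = exp (z G\<^sup>2) exp (- z B)\<close>, as \<open>B\<close> commutes with \<open>G\<close>. At \<open>z = 0\<close> the Gaussian
  formula makes no sense, and \<open>evolution\<close> adds the identity there.
\<close>

definition heat_exp :: "complex \<Rightarrow> 'x \<Rightarrow>\<^sub>L 'x" where
  "heat_exp z = heat z o\<^sub>L op_exp (- B) z"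

definition evolution :: "complex \<Rightarrow> 'x \<Rightarrow>\<^sub>L 'x" where
  "evolution z = (if z = 0 then id_blinfun else heat_exp z)"

text \<open>
  The sector \<open>|arg z| \<le> \<pi> / 3\<close> without its vertex, in a form that is visibly closed under addition.
\<close>

definition wedge :: "complex set" where
  "wedge = {z. Re z > 0 \<and> cmod z \<le> 2 * Re z}"

lemma wedge_add: "z \<in> wedge \<Longrightarrow> w \<in> wedge \<Longrightarrow> z + w \<in> wedge"
  using norm_triangle_ineq[of z w] by (auto simp: wedge_def)

lemma wedge_scale: "z \<in> wedge \<Longrightarrow> s > 0 \<Longrightarrow> of_real s * z \<in> wedge"
  by (simp add: wedge_def norm_mult)

lemma heat_exp_commute:
  assumes "Re z > 0" "bounded_linear P" "\<And>c x. P (c *\<^sub>C x) = c *\<^sub>C P x"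
    "\<And>s x. P (U s x) = U s (P x)" "\<And>x. P (B x) = B (P x)"
  shows "P (heat_exp z x) = heat_exp z (P x)"
proof -
  interpret P: bounded_linear P by (rule assms(2))
  have "P (op_exp (- B) z x) = op_exp (- B) z (P x)"
    by (rule op_exp_commute) (simp_all add: assms P.bounded_linear_axioms blinfun.minus_left P.neg)
  then show ?thesis by (simp add: heat_exp_def heat_commute[OF assms(1-4)])
qed

lemma heat_exp_U: "Re z > 0 \<Longrightarrow> heat_exp z (U s x) = U s (heat_exp z x)"
  by (rule heat_exp_commute[symmetric])
    (simp_all add: blinfun.bounded_linear_right U_scaleC B_U U_add[symmetric] add.commute)

lemma heat_exp_B: "Re z > 0 \<Longrightarrow> heat_exp z (B x) = B (heat_exp z x)"
  by (rule heat_exp_commute[symmetric]) (simp_all add: blinfun.bounded_linear_right B_scaleC B_U)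

lemma heat_exp_scaleC: "Re z > 0 \<Longrightarrow> heat_exp z (c *\<^sub>C x) = c *\<^sub>C heat_exp z x"
  by (rule heat_exp_commute[symmetric])
    (simp_all add: bounded_linear_scaleC U_scaleC B_scaleC scaleC_scaleC mult.commute)

lemma heat_exp_D:
  assumes "Re z > 0" "x \<in> D"
  shows "heat_exp z x \<in> D" "A (heat_exp z x) = heat_exp z (A x)"
  using D_commute[OF blinfun.bounded_linear_right _ _ assms(2), of "heat_exp z"] assms(1)
  by (simp_all add: heat_exp_U heat_exp_B)

text \<open>
  The equation \<open>T'(z) x = - T(z) A x\<close>, from which the semigroup law and the generator are derived.
\<close>

lemma heat_exp_has_derivative:
  assumes z: "Re z > 0"
  shows "\<exists>L. (heat_exp has_derivative (\<lambda>h. h *\<^sub>C L)) (at z) \<and> (\<forall>x\<in>D. L x = - heat_exp z (A x))"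
proof -
  obtain H where H: "(heat has_derivative (\<lambda>h. h *\<^sub>C H)) (at z)"
    "\<And>x y v. gen x y \<Longrightarrow> gen y v \<Longrightarrow> H x = heat z v"
    using heat_has_derivative[OF z] by blast
  have nB: "(- B) (c *\<^sub>C x) = c *\<^sub>C (- B) x" for c x
    by (simp add: blinfun.minus_left B_scaleC scaleC.minus_right)
  define L where "L = (heat z o\<^sub>L (- B o\<^sub>L op_exp (- B) z)) + (H o\<^sub>L op_exp (- B) z)"
  have heat_c: "heat z (c *\<^sub>C x) = c *\<^sub>C heat z x" for c x
    by (rule heat_commute[symmetric, OF z bounded_linear_scaleC]) (simp_all add: U_scaleC scaleC_scaleC mult.commute)
  have eq: "(heat z o\<^sub>L (h *\<^sub>C (- B o\<^sub>L op_exp (- B) z))) + ((h *\<^sub>C H) o\<^sub>L op_exp (- B) z) = h *\<^sub>C L" for h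
    by (rule blinfun_eqI)
      (simp add: L_def scaleC_blinfun.rep_eq blinfun.add_left heat_c scaleC_add_right)
  have "(heat_exp has_derivative (\<lambda>h. h *\<^sub>C L)) (at z)"
    unfolding heat_exp_def[abs_def]
    by (rule has_derivative_eq_rhs[OF bounded_bilinear.FDERIV[OF bounded_bilinear_blinfun_compose H(1) op_exp_has_derivative[OF nB]]])
      (simp add: fun_eq_iff eq)
  moreover have "L x = - heat_exp z (A x)" if x: "x \<in> D" for x
  proof -
    obtain y v where g: "gen x y" "gen y v" using x by (auto simp: D_iff)
    define E where "E = op_exp (- B) z"
    have EU: "E (U s x) = U s (E x)" for s x
      unfolding E_def by (rule op_exp_commute[symmetric])
        (simp_all add: blinfun.bounded_linear_right U_scaleC B_U blinfun.minus_left blinfun.minus_right)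
    have EB: "E (B x) = B (E x)" for x
      unfolding E_def by (rule op_exp_commute[symmetric])
        (simp_all add: blinfun.bounded_linear_right B_scaleC blinfun.minus_left blinfun.minus_right)
    note gE = gen_commute[OF blinfun.bounded_linear_right[of E], OF EU]
    have "H (E x) = heat z (E v)" by (rule H(2)[OF gE[OF g(1)] gE[OF g(2)]])
    then show ?thesis
      by (simp add: L_def heat_exp_def A_eq[OF g] E_def[symmetric] blinfun.add_left blinfun.minus_left
          blinfun.minus_right blinfun.diff_right EB)
  qed
  ultimately show ?thesis by blast
qed

lemma evolution_tendsto: "((\<lambda>z. evolution z x) \<longlongrightarrow> x) (at 0 within wedge)"
proof -
  let ?E = "op_exp (- B)"
  have nB: "(- B) (c *\<^sub>C x) = c *\<^sub>C (- B) x" for c x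
    by (simp add: blinfun.minus_left B_scaleC scaleC.minus_right)
  have "isCont ?E 0"
    by (rule has_derivative_continuous[OF op_exp_has_derivative[OF nB]])
  then have "(?E \<longlongrightarrow> id_blinfun) (at 0 within wedge)"
    unfolding isCont_def by (auto intro: tendsto_within_subset)
  from blinfun.tendsto[OF this tendsto_const[of x]]
  have "((\<lambda>z. norm (?E z x - x)) \<longlongrightarrow> 0) (at 0 within wedge)"
    by (simp add: LIM_zero tendsto_norm_zero)
  moreover have "((\<lambda>z. norm (heat z x - x)) \<longlongrightarrow> 0) (at 0 within wedge)"
    using heat_tendsto[of x] unfolding wedge_def by (simp add: LIM_zero tendsto_norm_zero)
  ultimately have lim: "((\<lambda>z. 2 * norm (?E z x - x) + norm (heat z x - x)) \<longlongrightarrow> 0) (at 0 within wedge)"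
    by (intro tendsto_add_zero tendsto_mult_right_zero)
  have "((\<lambda>z. evolution z x - x) \<longlongrightarrow> 0) (at 0 within wedge)"
  proof (rule Lim_null_comparison[OF _ lim])
    have "\<forall>\<^sub>F z in at 0 within wedge. z \<noteq> 0 \<and> z \<in> wedge" by (auto simp: eventually_at_filter)
    then show "\<forall>\<^sub>F z in at 0 within wedge. norm (evolution z x - x) \<le> 2 * norm (?E z x - x) + norm (heat z x - x)"
    proof eventually_elim
      case (elim z)
      have e: "evolution z x - x = heat z (?E z x - x) + (heat z x - x)"
        using elim by (simp add: evolution_def heat_exp_def blinfun.diff_right)
      moreover have "norm (heat z (?E z x - x)) \<le> 2 * norm (?E z x - x)"
        by (rule order_trans[OF norm_blinfun mult_right_mono]) (use elim in \<open>auto simp: wedge_def norm_heat\<close>)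
      ultimately show ?case
        using norm_triangle_ineq[of "heat z (?E z x - x)" "heat z x - x"] unfolding e by linarith
    qed
  qed
  then show ?thesis by (simp add: LIM_zero_iff)
qed

text \<open>
  On rays the complex equation becomes one in a real variable; for \<open>w = 1\<close> it is the equation from
  which the generator is found.
\<close>

lemma ray_continuous:
  assumes w: "w \<in> wedge"
  shows "continuous_on {0..1} (\<lambda>s. evolution (of_real s * w) x)"
    and "\<And>s. 0 < s \<Longrightarrow> x \<in> D \<Longrightarrow>
      ((\<lambda>s. evolution (of_real s * w) x) has_vector_derivative - (w *\<^sub>C evolution (of_real s * w) (A x))) (at s)"
proof -
  have w0: "w \<noteq> 0" using w by (auto simp: wedge_def)
  have pos: "Re (of_real s * w) > 0" if "s > 0" for s using w that by (simp add: wedge_def)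
  have der: "\<exists>L. ((\<lambda>s. evolution (of_real s * w) x) has_vector_derivative w *\<^sub>C blinfun_apply L x) (at s)
      \<and> (\<forall>x\<in>D. L x = - heat_exp (of_real s * w) (A x))" if s: "s > 0" for s x
  proof -
    obtain L where L: "(heat_exp has_derivative (\<lambda>h. h *\<^sub>C L)) (at (of_real s * w))"
      "\<forall>x\<in>D. L x = - heat_exp (of_real s * w) (A x)"
      using heat_exp_has_derivative[OF pos[OF s]] by blast
    have "((\<lambda>s. of_real s * w) has_derivative (\<lambda>h. of_real h * w)) (at s)"
      by (intro derivative_eq_intros) auto
    from has_derivative_compose[OF this L(1)]
    have "((\<lambda>s. heat_exp (of_real s * w) x) has_derivative (\<lambda>h. ((of_real h * w) *\<^sub>C L) x)) (at s)"
      by (rule bounded_linear.has_derivative[OF blinfun.bounded_linear_left])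
    then have "((\<lambda>s. heat_exp (of_real s * w) x) has_vector_derivative w *\<^sub>C L x) (at s)"
      by (simp add: has_vector_derivative_def scaleC_blinfun.rep_eq scaleC_scaleC[symmetric] scaleC_of_real blinfun.scaleR_left)
    then have "((\<lambda>s. evolution (of_real s * w) x) has_vector_derivative w *\<^sub>C L x) (at s)"
      by (rule has_vector_derivative_transform_within_open[of _ _ _ "{0<..}"]) (use s w0 in \<open>auto simp: evolution_def\<close>)
    then show ?thesis using L(2) by blast
  qed
  show "((\<lambda>s. evolution (of_real s * w) x) has_vector_derivative - (w *\<^sub>C evolution (of_real s * w) (A x))) (at s)"
    if "0 < s" "x \<in> D" for s
    using der[OF that(1), of x] that w0 by (auto simp: evolution_def scaleC.minus_right)
  show "continuous_on {0..1} (\<lambda>s. evolution (of_real s * w) x)"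
    unfolding continuous_on_eq_continuous_within
  proof
    fix s :: real assume "s \<in> {0..1}"
    then consider "s = 0" | "s > 0" by fastforce
    then show "continuous (at s within {0..1}) (\<lambda>s. evolution (of_real s * w) x)"
    proof cases
      case 1
      have "filterlim (\<lambda>s. of_real s * w) (at 0 within wedge) (at 0 within {0..1})"
        unfolding filterlim_at
      proof
        show "\<forall>\<^sub>F s in at 0 within {0..1}. of_real s * w \<in> wedge \<and> of_real s * w \<noteq> 0"
          using wedge_scale[OF w] w0 by (auto simp: eventually_at_filter)
        show "((\<lambda>s. of_real s * w) \<longlongrightarrow> 0) (at 0 within {0..1})" by (auto intro!: tendsto_eq_intros)
      qed
      from filterlim_compose[OF evolution_tendsto this] show ?thesis
        by (simp add: 1 continuous_within evolution_def)
    next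
      case 2
      then show ?thesis
        using der[OF 2, of x] has_vector_derivative_continuous continuous_at_imp_continuous_at_within by blast
    qed
  qed
qed

lemma dense_eq:
  fixes P Q :: "'x \<Rightarrow>\<^sub>L 'x"
  assumes "\<And>x. x \<in> D \<Longrightarrow> P x = Q x"
  shows "P = Q"
proof (rule blinfun_eqI)
  fix x
  have "x \<in> closure D" using D_dense by (simp add: densely_defined_def)
  then obtain u where u: "\<And>n. u n \<in> D" "u \<longlonglongrightarrow> x" unfolding closure_sequential by blast
  have "(\<lambda>n. P (u n)) \<longlonglongrightarrow> P x" by (rule blinfun.tendsto[OF tendsto_const u(2)])
  moreover have "(\<lambda>n. P (u n)) \<longlonglongrightarrow> Q x"
    unfolding assms[OF u(1)] by (rule blinfun.tendsto[OF tendsto_const u(2)])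
  ultimately show "P x = Q x" using LIMSEQ_unique by blast
qed

text \<open>
  For \<open>x\<close> in \<open>D\<close> the function \<open>s \<mapsto> T(z + (1 - s) w) T(s w) x\<close> has derivative
  \<open>w T(z + (1 - s) w) (A T(s w) - T(s w) A) x = 0\<close>, so its values at \<open>0\<close> and \<open>1\<close> agree.
\<close>

lemma heat_exp_add:
  assumes z: "z \<in> wedge" and w: "w \<in> wedge"
  shows "heat_exp (z + w) = heat_exp z o\<^sub>L heat_exp w"
proof (rule dense_eq)
  fix x assume x: "x \<in> D"
  define c where "c = (\<lambda>s. z + of_real (1 - s) * w)"
  define y where "y = (\<lambda>s. evolution (of_real s * w) x)"
  have w0: "w \<noteq> 0" and z0: "Re z > 0" "Re w > 0" using z w by (auto simp: wedge_def)
  have c: "Re (c s) > 0" if "s \<le> 1" for s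
    using z0 that by (simp add: c_def add_pos_nonneg)
  have dc: "\<exists>L. ((\<lambda>s. heat_exp (c s)) has_vector_derivative (- w) *\<^sub>C L) (at s) \<and> (\<forall>x\<in>D. L x = - heat_exp (c s) (A x))"
    if s1: "s \<le> 1" for s
  proof -
    obtain L where L: "(heat_exp has_derivative (\<lambda>h. h *\<^sub>C L)) (at (c s))" "\<forall>x\<in>D. L x = - heat_exp (c s) (A x)"
      using heat_exp_has_derivative[OF c[OF s1]] by blast
    have "(c has_derivative (\<lambda>h. of_real h * (- w))) (at s)"
      unfolding c_def by (intro derivative_eq_intros) auto
    from has_derivative_compose[OF this L(1)]
    have "((\<lambda>s. heat_exp (c s)) has_vector_derivative (- w) *\<^sub>C L) (at s)"
      unfolding has_vector_derivative_def
      by (rule has_derivative_eq_rhs) (simp only: scaleC_scaleC[symmetric] scaleC_of_real)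
    then show ?thesis using L(2) by blast
  qed
  have cont: "continuous_on {0..1} (\<lambda>s. heat_exp (c s) (y s))"
  proof (rule blinfun.continuous_on)
    show "continuous_on {0..1} (\<lambda>s. heat_exp (c s))"
      by (intro continuous_at_imp_continuous_on) (use dc has_vector_derivative_continuous in fastforce)
    show "continuous_on {0..1} y" unfolding y_def by (rule ray_continuous(1)[OF w])
  qed
  have "heat_exp (c 1) (y 1) = heat_exp (c 0) (y 0)"
  proof (rule has_derivative_zero_unique_strong_interval[of "{0, 1}" 0 1 "\<lambda>s. heat_exp (c s) (y s)"])
    fix s :: real assume "s \<in> {0..1} - {0, 1}"
    then have s: "0 < s" "s \<le> 1" by auto
    obtain L where L: "((\<lambda>s. heat_exp (c s)) has_vector_derivative (- w) *\<^sub>C L) (at s)"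
      "\<forall>x\<in>D. L x = - heat_exp (c s) (A x)" using dc[OF s(2)] by blast
    have ys: "y s = heat_exp (of_real s * w) x" using s w0 by (simp add: y_def evolution_def)
    have pos: "Re (of_real s * w) > 0" using s z0 by simp
    have yD: "y s \<in> D" "A (y s) = evolution (of_real s * w) (A x)"
      using heat_exp_D[OF pos x] s w0 by (simp_all add: ys evolution_def)
    have "((\<lambda>s. heat_exp (c s) (y s)) has_vector_derivative
        heat_exp (c s) (- (w *\<^sub>C evolution (of_real s * w) (A x))) + ((- w) *\<^sub>C L) (y s)) (at s)"
      using blinfun.has_vector_derivative[OF L(1) ray_continuous(2)[OF w s(1) x, folded y_def]]
      by (simp add: y_def)
    moreover have "heat_exp (c s) (- (w *\<^sub>C evolution (of_real s * w) (A x))) + ((- w) *\<^sub>C L) (y s) = 0"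
      using L(2) yD c[OF s(2)]
      by (simp add: scaleC_blinfun.rep_eq blinfun.minus_left blinfun.minus_right heat_exp_scaleC scaleC.minus_left scaleC.minus_right)
    ultimately show "((\<lambda>s. heat_exp (c s) (y s)) has_derivative (\<lambda>h. 0)) (at s within {0..1})"
      by (auto simp: has_vector_derivative_def intro: has_derivative_at_withinI)
  qed (use cont in auto)
  then show "heat_exp (z + w) x = (heat_exp z o\<^sub>L heat_exp w) x"
    using w0 by (simp add: c_def y_def evolution_def)
qed

lemma open_sector_wedge:
  assumes "z \<in> open_sector (pi / 3)"
  shows "z \<in> wedge"
proof -
  have z: "z \<noteq> 0" "\<bar>Arg z\<bar> < pi / 3" using assms by (auto simp: open_sector_def)
  have "cos (pi / 3) \<le> cos \<bar>Arg z\<bar>"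
    by (rule cos_monotone_0_pi_le) (use z pi_gt_zero in auto)
  then have "cmod z * (1 / 2) \<le> cmod z * cos \<bar>Arg z\<bar>"
    by (intro mult_left_mono) (simp_all add: cos_60)
  also have "cmod z * cos \<bar>Arg z\<bar> = Re z"
    by (metis Re_rcis cos_abs_real rcis_cmod_Arg)
  finally have "cmod z \<le> 2 * Re z" by simp
  moreover have "cmod z > 0" using z(1) by simp
  ultimately show ?thesis unfolding wedge_def mem_Collect_eq by linarith
qed

theorem evolution_analytic: "analytic_semigroup (pi / 3) evolution"
  unfolding analytic_semigroup_def
proof (intro conjI ballI allI)
  fix z w assume zw: "z \<in> open_sector (pi / 3) \<union> {0}" "w \<in> open_sector (pi / 3) \<union> {0}"
  show "evolution (z + w) = evolution z o\<^sub>L evolution w"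
  proof (cases "z = 0 \<or> w = 0")
    case True
    then show ?thesis by (auto simp: evolution_def intro!: blinfun_eqI)
  next
    case False
    then have wedge: "z \<in> wedge" "w \<in> wedge" using zw open_sector_wedge by auto
    have "Re (z + w) > 0" using wedge_add[OF wedge] unfolding wedge_def by blast
    then have "z + w \<noteq> 0" by (metis zero_complex.sel(1) less_irrefl)
    then show ?thesis using False heat_exp_add[OF wedge] by (simp add: evolution_def)
  qed
next
  fix z c x assume "z \<in> open_sector (pi / 3)"
  then show "evolution z (c *\<^sub>C x) = c *\<^sub>C evolution z x"
    using open_sector_wedge by (auto simp: evolution_def wedge_def heat_exp_scaleC)
next
  fix z assume "z \<in> open_sector (pi / 3)"
  then have z: "Re z > 0" using open_sector_wedge by (auto simp: wedge_def)
  then obtain L where L: "(heat_exp has_derivative (\<lambda>h. h *\<^sub>C L)) (at z)" using heat_exp_has_derivative by blast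
  have "(evolution has_derivative (\<lambda>h. h *\<^sub>C L)) (at z)"
    by (rule has_derivative_transform_within_open[OF L, of "- {0}"]) (use z in \<open>auto simp: evolution_def\<close>)
  then show "\<exists>L. (evolution has_derivative (\<lambda>h. h *\<^sub>C L)) (at z)" by blast
next
  fix x
  show "((\<lambda>z. evolution z x) \<longlongrightarrow> x) (at 0 within open_sector (pi / 3))"
    by (rule tendsto_within_subset[OF evolution_tendsto]) (use open_sector_wedge in auto)
qed (use pi_gt_zero in \<open>auto simp: evolution_def\<close>)

lemma one_in_wedge: "1 \<in> wedge"
  by (simp add: wedge_def)

text \<open>
  \<open>T(t) x - x\<close> is the integral of \<open>- T(s) A x\<close>, whose integrand is continuous at \<open>0\<close>. The
  differential equation itself is available at positive times only.
\<close>

lemma evolution_quotient: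
  assumes x: "x \<in> D"
  shows "((\<lambda>t. (1 / t) *\<^sub>R (evolution (of_real t) x - x)) \<longlongrightarrow> - A x) (at_right 0)"
proof -
  note ray = ray_continuous[OF one_in_wedge, simplified]
  have int: "((\<lambda>s. - evolution (of_real s) (A x)) has_integral (evolution (of_real t) x - x)) {0..t}" if "0 \<le> t" "t \<le> 1" for t
  proof -
    have "((\<lambda>s. - evolution (of_real s) (A x)) has_integral (evolution (of_real t) x - evolution (of_real 0) x)) {0..t}"
      by (rule fundamental_theorem_of_calculus_interior)
        (use that ray(2)[OF _ x] in \<open>auto intro: continuous_on_subset[OF ray(1)]\<close>)
    then show ?thesis by (simp add: evolution_def)
  qed
  have "((\<lambda>t. integral {0..t} (\<lambda>s. - evolution (of_real s) (A x))) has_vector_derivative - evolution (of_real 0) (A x)) (at 0 within {0..1})"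
    by (rule integral_has_vector_derivative) (auto intro: continuous_on_minus ray(1))
  then have "((\<lambda>t. evolution (of_real t) x - x) has_vector_derivative - evolution (of_real 0) (A x)) (at 0 within {0..1})"
    by (rule has_vector_derivative_transform[rotated 2]) (use integral_unique[OF int] in auto)
  then have "((\<lambda>t. norm (evolution (of_real t) x - x - (t *\<^sub>R (- A x))) / norm t) \<longlongrightarrow> 0) (at 0 within {0..1})"
    by (simp add: has_vector_derivative_def has_derivative_iff_norm evolution_def)
  moreover have "\<forall>\<^sub>F t in at 0 within {0..1}. norm (evolution (of_real t) x - x - (t *\<^sub>R (- A x))) / norm t
      = norm ((1 / t) *\<^sub>R (evolution (of_real t) x - x) - (- A x))"
    unfolding eventually_at_filter
  proof (intro always_eventually allI impI)
    fix t :: real assume "t \<noteq> 0"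
    then have "evolution (of_real t) x - x - (t *\<^sub>R (- A x)) = t *\<^sub>R ((1 / t) *\<^sub>R (evolution (of_real t) x - x) - (- A x))"
      by (simp add: scaleR_add_right scaleR_diff_right)
    then show "norm (evolution (of_real t) x - x - (t *\<^sub>R (- A x))) / norm t
      = norm ((1 / t) *\<^sub>R (evolution (of_real t) x - x) - (- A x))"
      using \<open>t \<noteq> 0\<close> by (simp only: norm_scaleR) simp
  qed
  ultimately have "((\<lambda>t. norm ((1 / t) *\<^sub>R (evolution (of_real t) x - x) - (- A x))) \<longlongrightarrow> 0) (at 0 within {0..1})"
    by (rule Lim_transform_eventually)
  then have "((\<lambda>t. (1 / t) *\<^sub>R (evolution (of_real t) x - x) - (- A x)) \<longlongrightarrow> 0) (at 0 within {0..1})"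
    by (rule tendsto_norm_zero_cancel)
  then have "((\<lambda>t. (1 / t) *\<^sub>R (evolution (of_real t) x - x)) \<longlongrightarrow> - A x) (at 0 within {0..1})"
    by (rule LIM_zero_cancel)
  moreover have "at_right (0::real) = at 0 within {0..1}"
    using at_within_Icc_at_right[of 0 "1::real"] by simp
  ultimately show ?thesis by simp
qed

text \<open>
  If the difference quotients of \<open>x\<close> converge to \<open>y\<close>, apply a resolvent \<open>R\<close>, which commutes
  with the semigroup: the quotients of \<open>R x\<close> converge to \<open>R y\<close> and, as \<open>R x\<close> lies in \<open>D\<close>,
  also to \<open>- A R x = x - z R x\<close>. So \<open>x = R y + z R x\<close> belongs to \<open>D\<close>.
\<close>

theorem generator: "is_generator (\<lambda>t. evolution (of_real t)) D (\<lambda>u. - A u)"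
  unfolding is_generator_def
proof (intro conjI ballI set_eqI iffI CollectI)
  fix x assume "x \<in> {x. \<exists>y. ((\<lambda>t. (1 / t) *\<^sub>R (evolution (of_real t) x - x)) \<longlongrightarrow> y) (at_right 0)}"
  then obtain y where y: "((\<lambda>t. (1 / t) *\<^sub>R (evolution (of_real t) x - x)) \<longlongrightarrow> y) (at_right 0)" by blast
  obtain z R where R: "is_resolvent D A z R" using ex_resolvent by blast
  have RD: "R f \<in> D" "z *\<^sub>C R f - A (R f) = f" for f using R by (auto simp: is_resolvent_def)
  have comm: "R (evolution (of_real t) f) = evolution (of_real t) (R f)" if t: "t > 0" for t f
  proof -
    have "evolution (of_real t) = heat_exp (of_real t)" using t by (simp add: evolution_def)
    moreover have h: "heat_exp (of_real t) (R f) \<in> D" "A (heat_exp (of_real t) (R f)) = heat_exp (of_real t) (A (R f))"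
      using heat_exp_D[OF _ RD(1), of "of_real t"] t by auto
    moreover have "z *\<^sub>C heat_exp (of_real t) (R f) - A (heat_exp (of_real t) (R f)) = heat_exp (of_real t) f"
      unfolding h(2) using t RD(2)[of f] by (simp add: heat_exp_scaleC[symmetric] blinfun.diff_right[symmetric])
    ultimately show ?thesis using R by (metis is_resolvent_def)
  qed
  have "((\<lambda>t. R ((1 / t) *\<^sub>R (evolution (of_real t) x - x))) \<longlongrightarrow> R y) (at_right 0)"
    by (rule blinfun.tendsto[OF tendsto_const y])
  moreover have "\<forall>\<^sub>F t in at_right 0. R ((1 / t) *\<^sub>R (evolution (of_real t) x - x)) = (1 / t) *\<^sub>R (evolution (of_real t) (R x) - R x)"
    using eventually_at_right_less[of 0] by eventually_elim (simp add: blinfun.scaleR_right blinfun.diff_right comm)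
  ultimately have "((\<lambda>t. (1 / t) *\<^sub>R (evolution (of_real t) (R x) - R x)) \<longlongrightarrow> R y) (at_right 0)"
    by (rule Lim_transform_eventually)
  from tendsto_unique[OF trivial_limit_at_right_real this evolution_quotient[OF RD(1)]]
  have "R y + z *\<^sub>C R x = z *\<^sub>C R x - A (R x)" by simp
  then have "x = R y + z *\<^sub>C R x" unfolding RD(2) by simp
  moreover have "R y + z *\<^sub>C R x \<in> D"
    using A_clinear RD(1)[of x] RD(1)[of y] unfolding clinear_operator_def by blast
  ultimately show "x \<in> D" by simp
next
  fix x assume "x \<in> D"
  from evolution_quotient[OF this]
  show "\<exists>y. ((\<lambda>t. (1 / t) *\<^sub>R (evolution (of_real t) x - x)) \<longlongrightarrow> y) (at_right 0)"
    by (rule exI)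
next
  fix x assume "x \<in> D"
  then show "((\<lambda>t. (1 / t) *\<^sub>R (evolution (of_real t) x - x)) \<longlongrightarrow> - A x) (at_right 0)"
    by (rule evolution_quotient)
qed

theorem generates: "generates_analytic_semigroup D A"
  unfolding generates_analytic_semigroup_def using evolution_analytic generator by blast

text \<open>
  An antilinear \<open>J\<close> that commutes with \<open>U\<close> and \<open>B\<close> commutes with the evolution at real times,
  because the kernel and the coefficients of the exponential series are then real.
\<close>

lemma evolution_conj:
  assumes J: "bounded_linear J" "\<And>c x. J (c *\<^sub>C x) = cnj c *\<^sub>C J x" "\<And>s x. J (U s x) = U s (J x)"
    "\<And>x. J (B x) = B (J x)" and t: "0 \<le> t"
  shows "J (evolution (of_real t) x) = evolution (of_real t) (J x)"
proof (cases "t = 0")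
  case False
  interpret J: bounded_linear J by (rule J(1))
  have "J (op_exp (- B) (of_real t) x) = op_exp (- B) (of_real t) (J x)"
    using op_exp_conj[of J "- B" "of_real t" x] J by (simp add: blinfun.minus_left J.neg)
  then show ?thesis
    using False t heat_conj[of t J] J by (simp add: evolution_def heat_exp_def)
qed (simp add: evolution_def)

end

section \<open>Complexification\<close>

lemma re_part_cis_scaleC:
  "re_part (cis t *\<^sub>C w) = cos t *\<^sub>R re_part w - sin t *\<^sub>R im_part (w :: 'a::real_normed_vector complexification)"
  by (simp add: scaleC_complexification_def)

lemma norm_re_part_cis_le:
  fixes w :: "'a::real_normed_vector complexification"
  shows "norm (re_part (cis t *\<^sub>C w)) \<le> norm (re_part w) + norm (im_part w)"
proof -
  have "norm (re_part (cis t *\<^sub>C w)) \<le> norm (cos t *\<^sub>R re_part w) + norm (sin t *\<^sub>R im_part w)"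
    unfolding re_part_cis_scaleC by (rule norm_triangle_ineq4)
  also have "\<dots> \<le> norm (re_part w) + norm (im_part w)"
    by (intro add_mono) (simp_all add: mult_left_le_one_le)
  finally show ?thesis .
qed

lemma norm_complexification_ge:
  fixes w :: "'a::real_normed_vector complexification"
  shows "norm (re_part (cis t *\<^sub>C w)) \<le> norm w"
  unfolding norm_complexification_def
  by (rule cSUP_upper) (auto intro!: bdd_aboveI norm_re_part_cis_le)

lemma norm_complexification_le:
  fixes w :: "'a::real_normed_vector complexification"
  assumes "\<And>t. norm (re_part (cis t *\<^sub>C w)) \<le> K"
  shows "norm w \<le> K"
  unfolding norm_complexification_def by (rule cSUP_least) (use assms in auto)

lemma norm_re_part_le: "norm (re_part w) \<le> norm (w :: 'a::real_normed_vector complexification)"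
  using norm_complexification_ge[of 0 w] by simp

lemma norm_im_part_le: "norm (im_part w) \<le> norm (w :: 'a::real_normed_vector complexification)"
  using norm_complexification_ge[of "pi / 2" w] by (simp add: cplx_defs)

lemma norm_complexification_add_le:
  "norm (w :: 'a::real_normed_vector complexification) \<le> norm (re_part w) + norm (im_part w)"
  by (rule norm_complexification_le) (rule norm_re_part_cis_le)

lemma bounded_linear_re_part: "bounded_linear (re_part :: 'a::real_normed_vector complexification \<Rightarrow> 'a)"
  by (rule bounded_linear_intro[where K = 1]) (simp_all add: cplx_defs norm_re_part_le)

lemma bounded_linear_im_part: "bounded_linear (im_part :: 'a::real_normed_vector complexification \<Rightarrow> 'a)"
  by (rule bounded_linear_intro[where K = 1]) (simp_all add: cplx_defs norm_im_part_le)

lemma bounded_linear_Cplx: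
  assumes "bounded_linear f" "bounded_linear g"
  shows "bounded_linear (\<lambda>x. Cplx (f x) (g x))"
proof -
  interpret f: bounded_linear f by fact
  interpret g: bounded_linear g by fact
  obtain K L where K: "\<And>x. norm (f x) \<le> norm x * K" and L: "\<And>x. norm (g x) \<le> norm x * L"
    using f.bounded g.bounded by blast
  show ?thesis
  proof (rule bounded_linear_intro[where K = "K + L"])
    fix x
    show "norm (Cplx (f x) (g x)) \<le> norm x * (K + L)"
      using norm_complexification_add_le[of "Cplx (f x) (g x)"] K[of x] L[of x] by (simp add: distrib_left)
  qed (simp_all add: cplx_defs f.add g.add f.scaleR g.scaleR)
qed

lemmas bounded_linear_Cplx_0 = bounded_linear_Cplx[OF bounded_linear_ident bounded_linear_zero]

lemma Cplx_split: "w = Cplx (re_part w) 0 + \<i> *\<^sub>C Cplx (im_part w) (0 :: 'a::real_normed_vector)"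
  by (simp add: cplx_defs)

instance complexification :: (banach) banach
proof
  fix X :: "nat \<Rightarrow> 'a complexification"
  assume "Cauchy X"
  then have "convergent (\<lambda>n. re_part (X n))" "convergent (\<lambda>n. im_part (X n))"
    using bounded_linear.Cauchy[OF bounded_linear_re_part] bounded_linear.Cauchy[OF bounded_linear_im_part]
    by (auto intro: Cauchy_convergent)
  then obtain x y where "(\<lambda>n. re_part (X n)) \<longlonglongrightarrow> x" "(\<lambda>n. im_part (X n)) \<longlonglongrightarrow> y"
    by (auto simp: convergent_def)
  then have "(\<lambda>n. norm (re_part (X n) - x) + norm (im_part (X n) - y)) \<longlonglongrightarrow> 0"
    by (intro tendsto_add_zero tendsto_norm_zero LIM_zero)
  then have "(\<lambda>n. X n - Cplx x y) \<longlonglongrightarrow> 0"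
    by (rule Lim_null_comparison[rotated])
      (use norm_complexification_add_le[of "X n - Cplx x y" for n] in \<open>auto simp: cplx_defs\<close>)
  then show "convergent X" by (auto simp: convergent_def intro: LIM_zero_cancel)
qed

definition complexify_blinfun ::
  "('a::real_normed_vector \<Rightarrow>\<^sub>L 'b::real_normed_vector) \<Rightarrow> 'a complexification \<Rightarrow>\<^sub>L 'b complexification" where
  "complexify_blinfun P = Blinfun (\<lambda>w. Cplx (P (re_part w)) (P (im_part w)))"

lemma complexify_blinfun_apply: "complexify_blinfun P w = Cplx (P (re_part w)) (P (im_part w))"
  unfolding complexify_blinfun_def
  by (subst bounded_linear_Blinfun_apply)
    (intro bounded_linear_Cplx bounded_linear_compose[OF blinfun.bounded_linear_right]
      bounded_linear_re_part bounded_linear_im_part, simp)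

lemma complexify_blinfun_scaleC: "complexify_blinfun P (c *\<^sub>C w) = c *\<^sub>C complexify_blinfun P w"
  by (simp add: complexify_blinfun_apply cplx_defs blinfun.bilinear_simps)

lemma norm_complexify_isometry:
  assumes "\<And>x. norm (blinfun_apply P x) = norm x"
  shows "norm (complexify_blinfun P w) = norm w"
proof -
  have "re_part (cis t *\<^sub>C complexify_blinfun P w) = P (re_part (cis t *\<^sub>C w))" for t
    by (simp add: complexify_blinfun_apply cplx_defs blinfun.bilinear_simps)
  then show ?thesis using assms by (simp add: norm_complexification_def)
qed

lemma has_vector_derivative_complexification:
  fixes F :: "real \<Rightarrow> 'a::real_normed_vector complexification"
  shows "(F has_vector_derivative v) (at t) \<longleftrightarrow>
    ((\<lambda>s. re_part (F s)) has_vector_derivative re_part v) (at t) \<and>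
    ((\<lambda>s. im_part (F s)) has_vector_derivative im_part v) (at t)" (is "?L \<longleftrightarrow> ?R")
proof
  assume ?L
  then show ?R
    using bounded_linear.has_vector_derivative[OF bounded_linear_re_part]
      bounded_linear.has_vector_derivative[OF bounded_linear_im_part] by blast
next
  assume R: ?R
  have bl: "bounded_linear (\<lambda>x. Cplx x (0::'a))" "bounded_linear (\<lambda>x. Cplx (0::'a) x)"
    using bounded_linear_Cplx_0 bounded_linear_Cplx[OF bounded_linear_zero bounded_linear_ident] by auto
  have "((\<lambda>s. Cplx (re_part (F s)) 0 + Cplx 0 (im_part (F s))) has_vector_derivative
      Cplx (re_part v) 0 + Cplx 0 (im_part v)) (at t)"
    using R by (intro has_vector_derivative_add bounded_linear.has_vector_derivative[OF bl(1)]
        bounded_linear.has_vector_derivative[OF bl(2)]) auto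
  then show ?L by (simp add: cplx_defs)
qed

definition conj_part :: "'a::real_normed_vector complexification \<Rightarrow> 'a complexification" where
  "conj_part w = Cplx (re_part w) (- im_part w)"

lemma bounded_linear_conj_part: "bounded_linear conj_part"
  unfolding conj_part_def
  by (intro bounded_linear_Cplx bounded_linear_minus bounded_linear_re_part bounded_linear_im_part)

lemma conj_part_scaleC: "conj_part (c *\<^sub>C w) = cnj c *\<^sub>C conj_part w"
  by (simp add: conj_part_def cplx_defs)

lemma conj_part_complexify: "conj_part (complexify_blinfun P w) = complexify_blinfun P (conj_part w)"
  by (simp add: conj_part_def complexify_blinfun_apply blinfun.minus_right)

lemma conj_part_fixed: "conj_part w = w \<Longrightarrow> im_part w = 0"
proof -
  assume "conj_part w = w"
  then have "- im_part w = im_part w" by (metis complexification.sel(2) conj_part_def)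
  then have "2 *\<^sub>R im_part w = 0" by (metis add.right_inverse scaleR_2)
  then show "im_part w = 0" by simp
qed

text \<open>
  The real counterpart of \<open>perturbed_square\<close>. Complexifying the group, \<open>B\<close> and \<open>(D, A)\<close>
  yields a complex instance, and each claim is read off on the elements \<open>x + i 0\<close>.
\<close>

locale real_perturbed_square = isometry_group U
  for U :: "real \<Rightarrow> 'x::banach \<Rightarrow>\<^sub>L 'x" +
  fixes B :: "'x \<Rightarrow>\<^sub>L 'x" and D :: "'x set" and A :: "'x \<Rightarrow> 'x"
  assumes B_U: "B (U s x) = U s (B x)"
    and D_iff: "x \<in> D \<longleftrightarrow> (\<exists>y z. gen x y \<and> gen y z)"
    and A_eq: "gen x y \<Longrightarrow> gen y z \<Longrightarrow> A x = B x - z"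
begin

lemma complexified_group: "complex_isometry_group (\<lambda>s. complexify_blinfun (U s))"
proof
  fix s t and x :: "'x complexification" and c
  show "complexify_blinfun (U 0) x = x" by (simp add: complexify_blinfun_apply)
  show "complexify_blinfun (U (s + t)) x = complexify_blinfun (U s) (complexify_blinfun (U t) x)"
    by (simp add: complexify_blinfun_apply U_add)
  show "norm (complexify_blinfun (U s) x) = norm x" by (rule norm_complexify_isometry) simp
  show "complexify_blinfun (U s) (c *\<^sub>C x) = c *\<^sub>C complexify_blinfun (U s) x"
    by (rule complexify_blinfun_scaleC)
  have "((\<lambda>s. norm (U s (re_part x) - re_part x) + norm (U s (im_part x) - im_part x)) \<longlongrightarrow> 0) (at 0)"
    by (intro tendsto_add_zero tendsto_norm_zero LIM_zero U_tendsto)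
  then have "((\<lambda>s. complexify_blinfun (U s) x - x) \<longlongrightarrow> 0) (at 0)"
    by (rule Lim_null_comparison[rotated])
      (use norm_complexification_add_le[of "complexify_blinfun (U s) x - x" for s]
        in \<open>auto simp: cplx_defs complexify_blinfun_apply\<close>)
  then show "((\<lambda>s. complexify_blinfun (U s) x) \<longlongrightarrow> x) (at 0)" by (rule LIM_zero_cancel)
qed

sublocale C: complex_isometry_group "\<lambda>s. complexify_blinfun (U s)"
  by (rule complexified_group)

lemma complexified_gen: "C.gen w v \<longleftrightarrow> gen (re_part w) (re_part v) \<and> gen (im_part w) (im_part v)"
  unfolding C.gen_def gen_def by (subst has_vector_derivative_complexification) (simp add: complexify_blinfun_apply)

sublocale C: perturbed_square "\<lambda>s. complexify_blinfun (U s)" "complexify_blinfun B" "complexify_dom D" "complexify_op A"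
proof
  fix s c and x y z :: "'x complexification"
  show "complexify_blinfun B (c *\<^sub>C x) = c *\<^sub>C complexify_blinfun B x" by (rule complexify_blinfun_scaleC)
  show "complexify_blinfun B (complexify_blinfun (U s) x) = complexify_blinfun (U s) (complexify_blinfun B x)"
    by (simp add: complexify_blinfun_apply B_U)
  show "x \<in> complexify_dom D \<longleftrightarrow> (\<exists>y z. C.gen x y \<and> C.gen y z)"
  proof
    assume "x \<in> complexify_dom D"
    then obtain y z y' z' where "gen (re_part x) y" "gen y z" "gen (im_part x) y'" "gen y' z'"
      by (auto simp: complexify_dom_def D_iff)
    then have "C.gen x (Cplx y y')" "C.gen (Cplx y y') (Cplx z z')" by (auto simp: complexified_gen)
    then show "\<exists>y z. C.gen x y \<and> C.gen y z" by blast
  qed (auto simp: complexify_dom_def D_iff complexified_gen)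
  show "complexify_op A x = complexify_blinfun B x - z" if "C.gen x y" "C.gen y z"
    using that A_eq by (auto simp: complexified_gen complexify_op_def complexify_blinfun_apply cplx_defs)
qed

lemma linear: "linear_operator D A"
  unfolding linear_operator_def
proof (intro conjI ballI allI)
  show "0 \<in> D" using gen_zero D_iff by blast
next
  fix u v assume "u \<in> D" "v \<in> D"
  then obtain a b c d where g: "gen u a" "gen a b" "gen v c" "gen c d" by (auto simp: D_iff)
  note g' = gen_add[OF g(1,3)] gen_add[OF g(2,4)]
  show "u + v \<in> D" "A (u + v) = A u + A v"
    using g' by (auto simp: D_iff A_eq[OF g(1,2)] A_eq[OF g(3,4)] A_eq[OF g'] blinfun.add_right)
next
  fix u and r :: real assume "u \<in> D"
  then obtain a b where g: "gen u a" "gen a b" by (auto simp: D_iff)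
  note g' = gen_scaleR[OF g(1)] gen_scaleR[OF g(2)]
  show "r *\<^sub>R u \<in> D" "A (r *\<^sub>R u) = r *\<^sub>R A u"
    using g' by (auto simp: D_iff A_eq[OF g] A_eq[OF g'] blinfun.scaleR_right scaleR_diff_right)
qed

lemma zero: "0 \<in> D" "A 0 = 0"
proof -
  show z: "0 \<in> D" using linear by (simp add: linear_operator_def)
  have "A (0 *\<^sub>R 0) = 0 *\<^sub>R A 0" using linear z unfolding linear_operator_def by blast
  then show "A 0 = 0" by simp
qed

lemma closed: "closed_operator D A"
proof -
  have c: "closed {(w, complexify_op A w) |w. w \<in> complexify_dom D}"
    using C.sectorial by (simp add: sectorial_def closed_operator_def)
  have cont: "continuous_on UNIV (\<lambda>p::'x \<times> 'x. (Cplx (fst p) (0::'x), Cplx (snd p) (0::'x)))"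
    by (intro continuous_on_Pair bounded_linear.continuous_on[OF bounded_linear_Cplx_0] continuous_on_fst
        continuous_on_snd continuous_on_id)
  have "{(u, A u) |u. u \<in> D} =
      (\<lambda>p. (Cplx (fst p) 0, Cplx (snd p) 0)) -` {(w, complexify_op A w) |w. w \<in> complexify_dom D}"
    using zero by (auto simp: complexify_op_def complexify_dom_def)
  then show ?thesis
    unfolding closed_operator_def using closed_vimage[OF c cont] by simp
qed

lemma D_dense: "densely_defined D"
proof -
  have "x \<in> closure D" for x
  proof -
    have "Cplx x 0 \<in> closure (complexify_dom D)" using C.D_dense by (simp add: densely_defined_def)
    then obtain w where w: "\<And>n. w n \<in> complexify_dom D" "w \<longlonglongrightarrow> Cplx x 0"
      unfolding closure_sequential by blast
    have "(\<lambda>n. re_part (w n)) \<longlonglongrightarrow> x"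
      using bounded_linear.tendsto[OF bounded_linear_re_part w(2)] by simp
    then show ?thesis
      unfolding closure_sequential using w(1) by (intro exI[of _ "\<lambda>n. re_part (w n)"]) (auto simp: complexify_dom_def)
  qed
  then show ?thesis by (auto simp: densely_defined_def)
qed

theorem real_sectorial: "real_sectorial D A"
  using linear closed D_dense C.sector_bound by (simp add: real_sectorial_def)

definition real_evolution :: "real \<Rightarrow> 'x \<Rightarrow>\<^sub>L 'x" where
  "real_evolution t = Blinfun (\<lambda>x. re_part (C.evolution (of_real t) (Cplx x 0)))"

lemma real_evolution_apply: "real_evolution t x = re_part (C.evolution (of_real t) (Cplx x 0))"
proof -
  have "bounded_linear (\<lambda>x. re_part (C.evolution (of_real t) (Cplx x 0)))"
    by (rule bounded_linear_compose[OF bounded_linear_re_part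
          bounded_linear_compose[OF blinfun.bounded_linear_right bounded_linear_Cplx_0]])
  then show ?thesis by (simp add: real_evolution_def bounded_linear_Blinfun_apply)
qed

text \<open>
  \<open>x + i 0\<close> is fixed by conjugation, hence so is its image.
\<close>

lemma evolution_real:
  assumes "0 \<le> t"
  shows "C.evolution (of_real t) (Cplx x 0) = Cplx (real_evolution t x) 0"
proof -
  have "conj_part (C.evolution (of_real t) (Cplx x 0)) = C.evolution (of_real t) (conj_part (Cplx x 0))"
    by (rule C.evolution_conj[OF bounded_linear_conj_part conj_part_scaleC conj_part_complexify conj_part_complexify assms])
  then have "im_part (C.evolution (of_real t) (Cplx x 0)) = 0"
    by (intro conj_part_fixed) (simp add: conj_part_def)
  then show ?thesis by (simp add: real_evolution_apply complexification.expand)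
qed

lemma evolution_Cplx:
  assumes t: "0 \<le> t"
  shows "C.evolution (of_real t) (Cplx x y) = Cplx (real_evolution t x) (real_evolution t y)"
proof -
  have "C.evolution (of_real t) (\<i> *\<^sub>C Cplx y 0) = \<i> *\<^sub>C C.evolution (of_real t) (Cplx y 0)"
    using t by (cases "t = 0") (simp_all add: C.evolution_def C.heat_exp_scaleC)
  moreover have "Cplx x y = Cplx x 0 + \<i> *\<^sub>C Cplx y 0" using Cplx_split[of "Cplx x y"] by simp
  ultimately have "C.evolution (of_real t) (Cplx x y) = Cplx (real_evolution t x) 0 + \<i> *\<^sub>C Cplx (real_evolution t y) 0"
    by (simp only: blinfun.add_right evolution_real[OF t])
  then show ?thesis by (simp add: cplx_defs)
qed

lemma quotient_Cplx:
  assumes "0 < t"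
  shows "(1 / t) *\<^sub>R (C.evolution (of_real t) (Cplx x 0) - Cplx x 0) = Cplx ((1 / t) *\<^sub>R (real_evolution t x - x)) 0"
  using assms by (simp add: evolution_real cplx_defs)

theorem real_generates: "real_generates_analytic_semigroup D A"
  unfolding real_generates_analytic_semigroup_def
proof (intro exI conjI allI impI)
  show "analytic_semigroup (pi / 3) C.evolution" by (rule C.evolution_analytic)
  show "C.evolution (of_real t) (Cplx x y) = Cplx (real_evolution t x) (real_evolution t y)" if "0 \<le> t" for t x y
    by (rule evolution_Cplx[OF that])
  have ev: "\<forall>\<^sub>F t in at_right 0. (1 / t) *\<^sub>R (C.evolution (of_real t) (Cplx x 0) - Cplx x 0)
      = Cplx ((1 / t) *\<^sub>R (real_evolution t x - x)) 0" for x
    using eventually_at_right_less[of 0] by eventually_elim (rule quotient_Cplx)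
  have lim: "((\<lambda>t. (1 / t) *\<^sub>R (real_evolution t x - x)) \<longlongrightarrow> - A x) (at_right 0)" if "x \<in> D" for x
  proof -
    have "Cplx x 0 \<in> complexify_dom D" using that zero by (simp add: complexify_dom_def)
    from Lim_transform_eventually[OF C.evolution_quotient[OF this] ev]
    show ?thesis
      using bounded_linear.tendsto[OF bounded_linear_re_part]
      by (fastforce simp: complexify_op_def uminus_complexification_def)
  qed
  show "is_generator real_evolution D (\<lambda>u. - A u)"
    unfolding is_generator_def
  proof (intro conjI ballI set_eqI iffI CollectI)
    fix x assume "x \<in> {x. \<exists>y. ((\<lambda>t. (1 / t) *\<^sub>R (real_evolution t x - x)) \<longlongrightarrow> y) (at_right 0)}"
    then obtain y where "((\<lambda>t. (1 / t) *\<^sub>R (real_evolution t x - x)) \<longlongrightarrow> y) (at_right 0)" by blast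
    from bounded_linear.tendsto[OF bounded_linear_Cplx_0 this]
    have "((\<lambda>t. (1 / t) *\<^sub>R (C.evolution (of_real t) (Cplx x 0) - Cplx x 0)) \<longlongrightarrow> Cplx y 0) (at_right 0)"
      by (rule Lim_transform_eventually) (use ev[of x] in \<open>simp add: eq_commute\<close>)
    then have "Cplx x 0 \<in> complexify_dom D"
      using C.generator unfolding is_generator_def by blast
    then show "x \<in> D" by (simp add: complexify_dom_def)
  next
    fix x assume "x \<in> D"
    from lim[OF this] show "\<exists>y. ((\<lambda>t. (1 / t) *\<^sub>R (real_evolution t x - x)) \<longlongrightarrow> y) (at_right 0)"
      by (rule exI)
  next
    fix x assume "x \<in> D"
    then show "((\<lambda>t. (1 / t) *\<^sub>R (real_evolution t x - x)) \<longlongrightarrow> - A x) (at_right 0)" by (rule lim)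
  qed
qed

end

section \<open>Test functions\<close>

text \<open>
  The functions \<open>p(x) t\<^sup>m e\<^sup>-\<^sup>t\<close> with \<open>t = 1 / (1 - x\<^sup>2)\<close>, extended by zero. The family is closed under
  differentiation, since \<open>t' = 2 x t\<^sup>2\<close> and \<open>(1 - x\<^sup>2) t = 1\<close>; so all its members are smooth.
\<close>

definition bump :: "real poly \<Rightarrow> nat \<Rightarrow> real \<Rightarrow> real" where
  "bump p m x = (if \<bar>x\<bar> < 1 then poly p x * (1 / (1 - x\<^sup>2)) ^ m * exp (- (1 / (1 - x\<^sup>2))) else 0)"

lemma one_minus_square_pos: "\<bar>x\<bar> < 1 \<Longrightarrow> 0 < 1 - x\<^sup>2" for x :: real
  by (simp add: abs_square_less_1)

lemma power_mult_exp_minus_le: "0 \<le> t \<Longrightarrow> t ^ n * exp (- t) \<le> fact n" for t :: real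
proof -
  assume t: "0 \<le> t"
  have "(\<Sum>i\<in>{n}. t ^ i /\<^sub>R fact i) \<le> (\<Sum>i. t ^ i /\<^sub>R fact i)"
    by (rule sum_le_suminf) (use t summable_exp_generic[of t] in auto)
  then have "t ^ n / fact n \<le> exp t" by (simp add: exp_def divide_inverse mult.commute)
  then show ?thesis by (simp add: exp_minus field_simps)
qed

text \<open>
  This estimate alone gives derivative zero at every point outside the open unit interval, its end
  points included. The square comes from \<open>1 - x\<^sup>2 \<le> 2 |x - y|\<close>, at the price of two more powers of
  \<open>t\<close>, which \<open>e\<^sup>-\<^sup>t\<close> absorbs.
\<close>

lemma bump_le_square:
  "\<exists>C. \<forall>x y. 1 \<le> \<bar>y\<bar> \<longrightarrow> \<bar>bump p m x\<bar> \<le> C * \<bar>x - y\<bar>\<^sup>2"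
proof -
  have "compact (poly p ` {-1..1})" by (intro compact_continuous_image continuous_intros) auto
  then have "bounded (poly p ` {-1..1})" by (rule compact_imp_bounded)
  then obtain K where "\<forall>v\<in>poly p ` {-1..1}. norm v \<le> K" unfolding bounded_iff by blast
  then have K: "\<bar>poly p x\<bar> \<le> K" if "x \<in> {-1..1}" for x using that by auto
  have K0: "0 \<le> K" using K[of 0] abs_ge_zero[of "poly p 0"] by simp
  show ?thesis
  proof (intro exI allI impI)
    fix x y :: real assume y: "1 \<le> \<bar>y\<bar>"
    show "\<bar>bump p m x\<bar> \<le> (K * fact (m + 2) * 4) * \<bar>x - y\<bar>\<^sup>2"
    proof (cases "\<bar>x\<bar> < 1")
      case True
      define t where "t = 1 / (1 - x\<^sup>2)"
      have t: "t > 0" using one_minus_square_pos[OF True] by (simp add: t_def)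
      have "1 / t = (1 - \<bar>x\<bar>) * (1 + \<bar>x\<bar>)"
        by (simp add: t_def power2_eq_square algebra_simps)
      also have "\<dots> \<le> \<bar>x - y\<bar> * 2"
        using True y by (intro mult_mono) auto
      finally have "(1 / t)\<^sup>2 \<le> (2 * \<bar>x - y\<bar>)\<^sup>2" using t by (intro power_mono) auto
      then have sq: "(1 / t)\<^sup>2 \<le> 4 * \<bar>x - y\<bar>\<^sup>2" by (simp add: power_mult_distrib)
      have b: "bump p m x = poly p x * t ^ m * exp (- t)" using True by (simp add: bump_def t_def)
      have "\<bar>bump p m x\<bar> = \<bar>poly p x\<bar> * (t ^ (m + 2) * exp (- t)) * (1 / t)\<^sup>2"
        using t by (simp add: b abs_mult power2_eq_square)
      also have "\<dots> \<le> K * fact (m + 2) * (4 * \<bar>x - y\<bar>\<^sup>2)"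
        using True t K0 by (intro mult_mono K power_mult_exp_minus_le sq) auto
      finally show ?thesis by simp
    qed (use K0 in \<open>simp add: bump_def\<close>)
  qed
qed

lemma bump_has_derivative:
  "(bump p m has_real_derivative
    bump (pderiv p * [:1, 0, -1:] ^ 2 + smult (2 * of_nat m) ([:0, 1:] * p * [:1, 0, -1:]) - smult 2 ([:0, 1:] * p)) (m + 2) x) (at x)"
proof (cases "\<bar>x\<bar> < 1")
  case True
  define t where "t = 1 / (1 - x\<^sup>2)"
  have q: "1 - x\<^sup>2 > 0" by (rule one_minus_square_pos[OF True])
  have dt: "((\<lambda>x. 1 / (1 - x\<^sup>2)) has_real_derivative 2 * x * t\<^sup>2) (at x)"
    using q by (auto intro!: derivative_eq_intros simp: t_def power2_eq_square)
  have qt: "(1 - x\<^sup>2) * t = 1" using q by (simp add: t_def)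
  have "((\<lambda>x. poly p x * (1 / (1 - x\<^sup>2)) ^ m * exp (- (1 / (1 - x\<^sup>2)))) has_real_derivative
      (poly (pderiv p) x * t ^ m + of_nat m * (2 * x * t\<^sup>2 * t ^ (m - Suc 0)) * poly p x) * exp (- t)
      + exp (- t) * - (2 * x * t\<^sup>2) * (poly p x * t ^ m)) (at x)"
    using DERIV_mult[OF DERIV_mult[OF poly_DERIV[of p x] DERIV_power[OF dt, of m]]
        DERIV_fun_exp[OF DERIV_minus[OF dt]]]
    unfolding t_def[symmetric] by simp
  also have "(poly (pderiv p) x * t ^ m + of_nat m * (2 * x * t\<^sup>2 * t ^ (m - Suc 0)) * poly p x) * exp (- t)
      + exp (- t) * - (2 * x * t\<^sup>2) * (poly p x * t ^ m)
    = bump (pderiv p * [:1, 0, -1:] ^ 2 + smult (2 * of_nat m) ([:0, 1:] * p * [:1, 0, -1:]) - smult 2 ([:0, 1:] * p)) (m + 2) x"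
  proof -
    have t2: "t ^ (m + 2) = t\<^sup>2 * t ^ m" by (simp add: power2_eq_square)
    have q2: "poly ([:1, 0, -1:] ^ 2) x * t\<^sup>2 = 1"
    proof -
      have "poly ([:1, 0, -1:] ^ 2) x * t\<^sup>2 = ((1 - x\<^sup>2) * t)\<^sup>2"
        by (simp add: power2_eq_square algebra_simps)
      then show ?thesis by (simp add: qt)
    qed
    have m: "of_nat m * (2 * x * t\<^sup>2 * t ^ (m - Suc 0)) = 2 * of_nat m * x * ((1 - x\<^sup>2) * t\<^sup>2 * t ^ m)"
    proof (cases m)
      case (Suc k)
      have "(1 - x\<^sup>2) * t\<^sup>2 * t ^ m = ((1 - x\<^sup>2) * t) * t\<^sup>2 * t ^ k"
        by (simp add: Suc power2_eq_square)
      then have e: "(1 - x\<^sup>2) * t\<^sup>2 * t ^ m = t\<^sup>2 * t ^ k" by (simp only: qt mult_1_left)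
      show ?thesis unfolding e by (simp add: Suc mult_ac)
    qed simp
    have "bump (pderiv p * [:1, 0, -1:] ^ 2 + smult (2 * of_nat m) ([:0, 1:] * p * [:1, 0, -1:]) - smult 2 ([:0, 1:] * p)) (m + 2) x
      = (poly (pderiv p) x * (poly ([:1, 0, -1:] ^ 2) x * t\<^sup>2) * t ^ m
        + 2 * of_nat m * x * ((1 - x\<^sup>2) * t\<^sup>2 * t ^ m) * poly p x - 2 * x * t\<^sup>2 * t ^ m * poly p x) * exp (- t)"
      using True unfolding bump_def t_def[symmetric] t2
      by (simp add: power2_eq_square[of x] del: poly_power) (simp add: algebra_simps del: poly_power)
    then show ?thesis unfolding q2 m by (simp add: algebra_simps)
  qed
  finally show ?thesis
  proof (rule has_field_derivative_transform_within)
    show "0 < 1 - \<bar>x\<bar>" using True by simp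
    fix y assume "dist y x < 1 - \<bar>x\<bar>"
    then have "\<bar>y\<bar> < 1" by (simp add: dist_real_def)
    then show "poly p y * (1 / (1 - y\<^sup>2)) ^ m * exp (- (1 / (1 - y\<^sup>2))) = bump p m y"
      by (simp add: bump_def)
  qed simp
next
  case False
  obtain C where C: "\<And>z y. 1 \<le> \<bar>y\<bar> \<Longrightarrow> \<bar>bump p m z\<bar> \<le> C * \<bar>z - y\<bar>\<^sup>2"
    using bump_le_square by blast
  have "(bump p m has_derivative (\<lambda>h. 0)) (at x)"
    by (rule has_derivative_quadratic[where e = 1 and C = C])
      (use C[of x "x + h" for h] False in \<open>auto simp: bump_def[of p m x]\<close>)
  then have "(bump p m has_real_derivative 0) (at x)"
    by (simp add: has_field_derivative_def lambda_zero)
  moreover have "bump q (m + 2) x = 0" for q using False by (simp add: bump_def)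
  ultimately show ?thesis by metis
qed

lemma bump_test_function: "bump p m \<in> test_functions"
proof -
  have "\<exists>p' m'. (deriv ^^ k) (bump p m) = bump p' m'" for k
  proof (induction k)
    case (Suc k)
    then obtain p' m' where "(deriv ^^ k) (bump p m) = bump p' m'" by blast
    moreover have "\<exists>p'' m''. deriv (bump p' m') = bump p'' m''"
      using DERIV_imp_deriv[OF bump_has_derivative] by blast
    ultimately show ?case by simp
  qed auto
  then have "(deriv ^^ k) (bump p m) differentiable (at x)" for k x
    using bump_has_derivative by (metis real_differentiable_def)
  moreover have "bounded {x. bump p m x \<noteq> 0}"
    by (rule bounded_subset[of "{-1..1}"]) (auto simp: bump_def split: if_splits)
  ultimately show ?thesis by (simp add: test_functions_def compact_closure)
qed

lemma test_function_deriv: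
  assumes "\<phi> \<in> test_functions"
  shows "(\<phi> has_real_derivative deriv \<phi> x) (at x)"
proof -
  have "(deriv ^^ 0) \<phi> differentiable (at x)" using assms unfolding test_functions_def by blast
  then show ?thesis by (simp add: DERIV_deriv_iff_real_differentiable)
qed

lemma deriv_test_function:
  assumes \<phi>: "\<phi> \<in> test_functions"
  shows "deriv \<phi> \<in> test_functions"
proof -
  have "(deriv ^^ k) (deriv \<phi>) differentiable (at x)" for k x
    using \<phi> unfolding test_functions_def by (metis (mono_tags, lifting) funpow_swap1 funpow.simps(2) mem_Collect_eq comp_apply)
  moreover have "{x. deriv \<phi> x \<noteq> 0} \<subseteq> closure {x. \<phi> x \<noteq> 0}"
  proof (clarify, rule ccontr)
    fix x assume x: "x \<notin> closure {x. \<phi> x \<noteq> 0}" "deriv \<phi> x \<noteq> 0"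
    have "((\<lambda>x. 0) has_real_derivative 0) (at x)" by simp
    then have "(\<phi> has_real_derivative 0) (at x)"
      by (rule has_field_derivative_transform_within_open[of _ _ _ "- closure {x. \<phi> x \<noteq> 0}"])
        (use x subsetD[OF closure_subset[of "{x. \<phi> x \<noteq> 0}"]] in auto)
    then show False using DERIV_imp_deriv x(2) by blast
  qed
  moreover have "compact (closure {x. \<phi> x \<noteq> 0})" using \<phi> by (simp add: test_functions_def)
  ultimately show ?thesis
    by (auto simp: test_functions_def compact_closure intro: bounded_subset compact_imp_bounded)
qed

lemma affine_test_function:
  assumes \<phi>: "\<phi> \<in> test_functions" and a: "a \<noteq> 0"
  shows "(\<lambda>x. \<phi> (a * x + b)) \<in> test_functions"
proof -
  have d: "((deriv ^^ k) \<phi> has_real_derivative (deriv ^^ Suc k) \<phi> x) (at x)" for k x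
    using \<phi> by (auto simp: test_functions_def DERIV_deriv_iff_real_differentiable)
  have eq: "(deriv ^^ k) (\<lambda>x. \<phi> (a * x + b)) = (\<lambda>x. a ^ k * (deriv ^^ k) \<phi> (a * x + b))" for k
  proof (induction k)
    case (Suc k)
    have "deriv (\<lambda>x. a ^ k * (deriv ^^ k) \<phi> (a * x + b)) x = a ^ Suc k * (deriv ^^ Suc k) \<phi> (a * x + b)" for x
    proof (rule DERIV_imp_deriv)
      have l: "((\<lambda>x. a * x + b) has_real_derivative a) (at x)" by (auto intro!: derivative_eq_intros)
      show "((\<lambda>x. a ^ k * (deriv ^^ k) \<phi> (a * x + b)) has_real_derivative a ^ Suc k * (deriv ^^ Suc k) \<phi> (a * x + b)) (at x)"
        using DERIV_cmult[OF DERIV_chain2[OF d l], of "a ^ k" k] by (simp add: mult_ac)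
    qed
    then show ?case by (simp add: Suc.IH)
  qed simp
  have "(deriv ^^ k) (\<lambda>x. \<phi> (a * x + b)) differentiable (at x)" for k x
  proof -
    have l: "((\<lambda>x. a * x + b) has_real_derivative a) (at x)" by (auto intro!: derivative_eq_intros)
    show ?thesis
      unfolding eq using DERIV_cmult[OF DERIV_chain2[OF d l], of "a ^ k" k] real_differentiable_def by blast
  qed
  moreover have "bounded {x. \<phi> (a * x + b) \<noteq> 0}"
  proof -
    have "bounded {x. \<phi> x \<noteq> 0}"
      using \<phi> by (auto simp: test_functions_def intro: bounded_subset[OF compact_imp_bounded closure_subset])
    then have "bounded ((\<lambda>x. (x - b) / a) ` {x. \<phi> x \<noteq> 0})"
      using bounded_scaling[of "{x. \<phi> x \<noteq> 0}" "1 / a"] bounded_translation[of "(\<lambda>x. (1 / a) *\<^sub>R x) ` {x. \<phi> x \<noteq> 0}" "- b / a"]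
      by (simp add: image_image diff_divide_distrib add.commute)
    then show ?thesis
      by (rule bounded_subset) (use a in \<open>auto simp: image_iff intro!: exI[of _ "a * _ + b"]\<close>)
  qed
  ultimately show ?thesis by (simp add: test_functions_def compact_closure)
qed

lemma test_function_bounds:
  assumes \<phi>: "\<phi> \<in> test_functions"
  obtains M N where "\<And>x. \<bar>\<phi> x\<bar> \<le> M" "\<And>x. real N < \<bar>x\<bar> \<Longrightarrow> \<phi> x = 0"
proof -
  have cont: "continuous_on UNIV \<phi>"
    by (intro continuous_at_imp_continuous_on ballI DERIV_isCont[OF test_function_deriv[OF \<phi>]])
  define S where "S = closure {x. \<phi> x \<noteq> 0}"
  have S: "compact S" using \<phi> by (simp add: test_functions_def S_def)
  have out: "\<phi> x = 0" if "x \<notin> S" for x using that closure_subset[of "{x. \<phi> x \<noteq> 0}"] by (auto simp: S_def)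
  obtain M where M: "\<And>x. x \<in> S \<Longrightarrow> \<bar>\<phi> x\<bar> \<le> M"
    using compact_imp_bounded[OF compact_continuous_image[OF continuous_on_subset[OF cont] S]]
    unfolding bounded_iff by (metis imageI real_norm_def subset_UNIV)
  obtain R where R: "\<And>x. x \<in> S \<Longrightarrow> \<bar>x\<bar> \<le> R"
    using compact_imp_bounded[OF S] unfolding bounded_iff by auto
  obtain N where N: "R \<le> real N" using real_arch_simple by blast
  show ?thesis
  proof (rule that[of "max M 0" N])
    show "\<bar>\<phi> x\<bar> \<le> max M 0" for x using M[of x] out[of x] by (cases "x \<in> S") auto
    show "\<phi> x = 0" if "real N < \<bar>x\<bar>" for x using R[of x] out[of x] N that by fastforce
  qed
qed

lemma test_function_measurable: "\<phi> \<in> test_functions \<Longrightarrow> \<phi> \<in> borel_measurable borel"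
  by (intro borel_measurable_continuous_onI continuous_at_imp_continuous_on ballI DERIV_isCont[OF test_function_deriv])

text \<open>
  Uniform in \<open>x\<close>, so that it survives integration against a function.
\<close>

lemma test_function_Taylor:
  assumes \<phi>: "\<phi> \<in> test_functions" and M: "\<And>x. \<bar>deriv (deriv \<phi>) x\<bar> \<le> M"
  shows "\<bar>\<phi> (x + h) - \<phi> x - h * deriv \<phi> x\<bar> \<le> M * h\<^sup>2"
proof -
  have 1: "\<bar>deriv \<phi> y - deriv \<phi> x\<bar> \<le> M * \<bar>y - x\<bar>" for y
    using field_differentiable_bound[of UNIV "deriv \<phi>" "deriv (deriv \<phi>)" M y x]
      test_function_deriv[OF deriv_test_function[OF \<phi>]] M by simp
  have M0: "0 \<le> M" using M[of 0] by linarith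
  have "\<bar>(\<phi> (x + h) - deriv \<phi> x * (x + h)) - (\<phi> x - deriv \<phi> x * x)\<bar> \<le> (M * \<bar>h\<bar>) * \<bar>(x + h) - x\<bar>"
    unfolding real_norm_def[symmetric]
  proof (rule field_differentiable_bound[of "closed_segment x (x + h)"])
    have "((\<lambda>y. \<phi> y - deriv \<phi> x * y) has_real_derivative deriv \<phi> y - deriv \<phi> x) (at y)" for y
      by (auto intro!: derivative_eq_intros test_function_deriv[OF \<phi>])
    then show "((\<lambda>y. \<phi> y - deriv \<phi> x * y) has_real_derivative deriv \<phi> y - deriv \<phi> x) (at y within closed_segment x (x + h))" for y
      by (rule has_field_derivative_at_within)
    fix y assume "y \<in> closed_segment x (x + h)"
    then have "\<bar>y - x\<bar> \<le> \<bar>h\<bar>" using segment_bound1[of y x "x + h"] by simp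
    then show "norm (deriv \<phi> y - deriv \<phi> x) \<le> M * norm h"
      using 1[of y] mult_left_mono[OF _ M0, of "\<bar>y - x\<bar>" "\<bar>h\<bar>"] by simp
  qed auto
  then show ?thesis by (simp add: algebra_simps power2_eq_square)
qed

section \<open>The uniformly local norm\<close>

lemma L2ul_w_measurable: "v \<in> L2ul_w \<Longrightarrow> v \<in> borel_measurable lborel"
  by (simp add: L2ul_w_def)

abbreviation unit_nn_integral :: "real \<Rightarrow> (real \<Rightarrow> real) \<Rightarrow> ennreal" where
  "unit_nn_integral a g \<equiv> (\<integral>\<^sup>+x. ennreal (indicat_real {a..a+1} x * g x) \<partial>lborel)"

lemma L2ul_w_nn_integral:
  fixes v :: "real \<Rightarrow> 'a::{banach, second_countable_topology}"
  assumes "v \<in> L2ul_w"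
  shows "unit_nn_integral a (\<lambda>x. (norm (v x))\<^sup>2) = ennreal ((l2_norm_on a v)\<^sup>2)"
proof -
  have "integrable lborel (\<lambda>x. indicat_real {a..a+1} x * (norm (v x))\<^sup>2)"
    using assms by (auto simp: L2ul_w_def set_integrable_def)
  from nn_integral_eq_integral[OF this] show ?thesis
    by (simp add: l2_norm_on_square set_lebesgue_integral_def)
qed

text \<open>
  Together with the preceding lemma this moves the norm into \<open>[0, \<infinity>]\<close>, where Fatou and Tonelli
  apply without integrability conditions.
\<close>

lemma L2ul_w_nn_integralI:
  fixes v :: "real \<Rightarrow> 'a::{banach, second_countable_topology}"
  assumes v [measurable]: "v \<in> borel_measurable lborel" and K: "0 \<le> K"
    and le: "\<And>a. unit_nn_integral a (\<lambda>x. (norm (v x))\<^sup>2) \<le> ennreal (K\<^sup>2)"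
  shows "v \<in> L2ul_w" "l2ul_norm v \<le> K"
proof -
  have int: "integrable lborel (\<lambda>x. indicat_real {a..a+1} x * (norm (v x))\<^sup>2)" for a
    using le[of a] by (intro integrableI_nonneg) (auto intro: le_less_trans)
  have le': "l2_norm_on a v \<le> K" for a
  proof (rule power2_le_imp_le[OF _ K])
    have "ennreal ((l2_norm_on a v)\<^sup>2) \<le> ennreal (K\<^sup>2)"
      using le[of a] nn_integral_eq_integral[OF int[of a]]
      by (simp add: l2_norm_on_square set_lebesgue_integral_def)
    then show "(l2_norm_on a v)\<^sup>2 \<le> K\<^sup>2" by simp
  qed
  show "v \<in> L2ul_w" by (rule L2ul_wI[OF v _ le']) (use int in \<open>simp add: set_integrable_def\<close>)
  show "l2ul_norm v \<le> K" by (rule l2ul_norm_le) (rule le')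
qed

lemma L2ul_w_nn_integral_norm:
  fixes v :: "real \<Rightarrow> 'a::{banach, second_countable_topology}"
  assumes v: "v \<in> L2ul_w"
  shows "unit_nn_integral a (\<lambda>x. norm (v x)) \<le> ennreal (l2ul_norm v)"
proof -
  have [measurable]: "v \<in> borel_measurable lborel" by (rule L2ul_w_measurable[OF v])
  define I where "I = unit_nn_integral a (\<lambda>x. norm (v x))"
  have "I = (\<integral>\<^sup>+x. ennreal (indicat_real {a..a+1} x * norm (v x)) * indicator {a..a+1} x \<partial>lborel)"
    unfolding I_def by (intro nn_integral_cong) (auto simp: indicator_def)
  then have "I\<^sup>2 \<le> (\<integral>\<^sup>+x. (ennreal (indicat_real {a..a+1} x * norm (v x)))\<^sup>2 \<partial>lborel) * (\<integral>\<^sup>+x. (indicator {a..a+1} x)\<^sup>2 \<partial>lborel)"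
    using Cauchy_Schwarz_nn_integral[of "\<lambda>x. ennreal (indicat_real {a..a+1} x * norm (v x))" lborel "indicator {a..a+1}"]
    by simp
  also have "(\<integral>\<^sup>+x. (ennreal (indicat_real {a..a+1} x * norm (v x)))\<^sup>2 \<partial>lborel)
      = unit_nn_integral a (\<lambda>x. (norm (v x))\<^sup>2)"
    by (intro nn_integral_cong) (auto simp: indicator_def ennreal_power)
  also have "(\<integral>\<^sup>+x. (indicator {a..a+1} x :: ennreal)\<^sup>2 \<partial>lborel) = (\<integral>\<^sup>+x. indicator {a..a+1} x \<partial>lborel)"
    by (intro nn_integral_cong) (auto simp: indicator_def)
  also have "\<dots> = 1" by simp
  finally have sq: "I\<^sup>2 \<le> ennreal ((l2_norm_on a v)\<^sup>2)" by (simp add: L2ul_w_nn_integral[OF v])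
  have "I \<le> ennreal (l2_norm_on a v)"
  proof (cases I)
    case (real r)
    then have "r\<^sup>2 \<le> (l2_norm_on a v)\<^sup>2" using sq by (simp add: ennreal_power)
    then have "r \<le> l2_norm_on a v" by (rule power2_le_imp_le) simp
    then show ?thesis using real by (simp add: ennreal_leI)
  next
    case top
    then show ?thesis using sq by (simp add: power2_eq_square top_unique)
  qed
  also have "\<dots> \<le> ennreal (l2ul_norm v)" by (intro ennreal_leI l2_norm_on_le v)
  finally show ?thesis by (simp add: I_def)
qed

text \<open>
  The support is covered by \<open>2 N + 1\<close> unit intervals starting at \<open>- N\<close>.
\<close>

lemma integral_compact_support_bound:
  fixes u :: "real \<Rightarrow> 'a::{banach, second_countable_topology}"
  assumes u: "u \<in> L2ul_w" and \<theta> [measurable]: "\<theta> \<in> borel_measurable borel"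
    and M: "\<And>x. \<bar>\<theta> x\<bar> \<le> M" and N: "\<And>x. real N < \<bar>x\<bar> \<Longrightarrow> \<theta> x = 0"
  shows "integrable lborel (\<lambda>x. \<theta> x *\<^sub>R u x)"
    and "norm (LBINT x. \<theta> x *\<^sub>R u x) \<le> M * (2 * real N + 1) * l2ul_norm u"
proof -
  have [measurable]: "u \<in> borel_measurable lborel" by (rule L2ul_w_measurable[OF u])
  have M0: "0 \<le> M" using M[of 0] by linarith
  define b where "b = (\<lambda>i. real i - real N)"
  have pt: "ennreal (norm (\<theta> x *\<^sub>R u x)) \<le> (\<Sum>i<2*N+1. ennreal M * ennreal (indicat_real {b i..b i + 1} x * norm (u x)))" for x
  proof (cases "real N < \<bar>x\<bar>")
    case False
    define i where "i = nat \<lfloor>x + real N\<rfloor>"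
    have "0 \<le> \<lfloor>x + real N\<rfloor>" using False by (simp only: zero_le_floor)
    then have fl: "real i = of_int \<lfloor>x + real N\<rfloor>" unfolding i_def by (rule of_nat_nat)
    have i: "i < 2 * N + 1" "x \<in> {b i..b i + 1}"
    proof -
      have "real i \<le> x + real N" "x + real N < real i + 1" unfolding fl by linarith+
      then show "x \<in> {b i..b i + 1}" by (auto simp: b_def)
      have "real i \<le> 2 * real N" using \<open>real i \<le> x + real N\<close> False by linarith
      then show "i < 2 * N + 1" by linarith
    qed
    have "ennreal (norm (\<theta> x *\<^sub>R u x)) \<le> ennreal M * ennreal (indicat_real {b i..b i + 1} x * norm (u x))"
      using i(2) M[of x] M0 by (simp add: ennreal_mult[symmetric] mult_right_mono ennreal_leI)
    also have "\<dots> \<le> (\<Sum>i<2*N+1. ennreal M * ennreal (indicat_real {b i..b i + 1} x * norm (u x)))"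
      using i(1) by (intro member_le_sum) auto
    finally show ?thesis .
  qed (simp add: N)
  have "(\<integral>\<^sup>+x. ennreal (norm (\<theta> x *\<^sub>R u x)) \<partial>lborel)
      \<le> (\<integral>\<^sup>+x. (\<Sum>i<2*N+1. ennreal M * ennreal (indicat_real {b i..b i + 1} x * norm (u x))) \<partial>lborel)"
    by (intro nn_integral_mono pt)
  also have "\<dots> = (\<Sum>i<2*N+1. ennreal M * (\<integral>\<^sup>+x. ennreal (indicat_real {b i..b i + 1} x * norm (u x)) \<partial>lborel))"
    by (subst nn_integral_sum) (auto simp: nn_integral_cmult)
  also have "\<dots> \<le> (\<Sum>i<2*N+1. ennreal M * ennreal (l2ul_norm u))"
    by (intro sum_mono mult_left_mono L2ul_w_nn_integral_norm u) auto
  also have "\<dots> = ennreal (M * (2 * real N + 1) * l2ul_norm u)"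
    using M0 l2ul_norm_nonneg[OF u]
    by (simp add: ennreal_mult[symmetric] ennreal_of_nat_eq_real_of_nat algebra_simps ennreal_plus[symmetric] del: ennreal_plus)
  finally have le: "(\<integral>\<^sup>+x. ennreal (norm (\<theta> x *\<^sub>R u x)) \<partial>lborel) \<le> ennreal (M * (2 * real N + 1) * l2ul_norm u)" .
  show int: "integrable lborel (\<lambda>x. \<theta> x *\<^sub>R u x)"
    using le by (intro integrableI_bounded) (auto intro: le_less_trans)
  have "ennreal (norm (LBINT x. \<theta> x *\<^sub>R u x)) \<le> ennreal (M * (2 * real N + 1) * l2ul_norm u)"
    using integral_norm_bound_ennreal[OF int] le by (rule order_trans)
  then show "norm (LBINT x. \<theta> x *\<^sub>R u x) \<le> M * (2 * real N + 1) * l2ul_norm u"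
    using M0 l2ul_norm_nonneg[OF u] by (simp add: ennreal_le_iff)
qed

lemma AE_translate:
  fixes P :: "real \<Rightarrow> bool"
  assumes "AE x in lborel. P x"
  shows "AE x in lborel. P (x - s)"
proof -
  obtain S where S: "S \<in> null_sets lborel" "{x. \<not> P x} \<subseteq> S"
    using assms unfolding eventually_ae_filter by auto
  have [measurable]: "S \<in> sets borel" using S(1) by (auto simp: null_sets_def)
  have "AE x in lborel. x \<notin> S" by (rule AE_not_in[OF S(1)])
  then have "AE x in lborel. - s + 1 * x \<notin> S" by (rule AE_borel_affine[rotated 2]) auto
  then show ?thesis by eventually_elim (use S(2) in auto)
qed

lemma l2_norm_on_translate: "l2_norm_on a (\<lambda>x. u (x - s)) = l2_norm_on (a - s) u"
proof -
  have "(LBINT x. indicat_real {a..a+1} x *\<^sub>R (norm (u (x - s)))\<^sup>2)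
      = (LBINT x. indicat_real {a-s..a-s+1} (- s + 1 * x) *\<^sub>R (norm (u (- s + 1 * x)))\<^sup>2)"
    by (intro Bochner_Integration.integral_cong) (auto simp: indicator_def algebra_simps)
  also have "\<dots> = (LBINT x. indicat_real {a-s..a-s+1} x *\<^sub>R (norm (u x))\<^sup>2)"
    by (subst lborel_integral_real_affine[where c=1 and t="-s"]) auto
  finally show ?thesis by (simp add: l2_norm_on_def set_lebesgue_integral_def)
qed

lemma l2ul_norm_translate: "l2ul_norm (\<lambda>x. u (x - s)) = l2ul_norm u"
proof -
  have "range (\<lambda>a. l2_norm_on (a - s) u) = range (\<lambda>a. l2_norm_on a u)"
    by (metis (no_types, lifting) add_diff_cancel_right' image_cong rangeI range_eqI subset_antisym image_subsetI)
  then show ?thesis by (simp add: l2ul_norm_def l2_norm_on_translate)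
qed

lemma L2ul_s_translate:
  assumes u: "u \<in> L2ul_s"
  shows "(\<lambda>x. u (x - s)) \<in> L2ul_s"
proof -
  have "l2ul_norm (\<lambda>x. u (x - s) - u (x - \<xi> - s)) = l2ul_norm (\<lambda>x. u x - u (x - \<xi>))" for \<xi>
    using l2ul_norm_translate[of "\<lambda>x. u x - u (x - \<xi>)" s] by (simp add: algebra_simps)
  then show ?thesis
    using u L2ul_w_translate[OF L2ul_sD[OF u], of s] by (simp add: L2ul_s_def)
qed

text \<open>
  Strong continuity of translations is preserved by uniformly local limits, as translations are
  isometries.
\<close>

lemma L2ul_s_limit:
  assumes w: "u \<in> L2ul_w" and v: "\<And>e. e > 0 \<Longrightarrow> \<exists>v\<in>L2ul_s. l2ul_norm (\<lambda>x. u x - v x) \<le> e"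
  shows "u \<in> L2ul_s"
proof -
  have "((\<lambda>\<xi>. l2ul_norm (\<lambda>x. u x - u (x - \<xi>))) \<longlongrightarrow> 0) (at 0)"
  proof (rule tendstoI)
    fix e :: real assume e: "e > 0"
    then obtain v where v: "v \<in> L2ul_s" "l2ul_norm (\<lambda>x. u x - v x) \<le> e / 4" using v[of "e / 4"] by auto
    have neg: "(\<lambda>x. - f x) \<in> L2ul_w" "l2ul_norm (\<lambda>x. - f x) \<le> l2ul_norm f" if "f \<in> L2ul_w" for f :: "real \<Rightarrow> 'a"
      using L2ul_w_dominated[OF that, of "\<lambda>x. - f x" 1] L2ul_w_measurable[OF that] by auto
    define d where "d = (\<lambda>x. u x - v x)"
    have d: "d \<in> L2ul_w" using L2ul_w_add(1)[OF w neg(1)[OF L2ul_sD[OF v(1)]]] by (simp add: d_def)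
    have "((\<lambda>\<xi>. l2ul_norm (\<lambda>x. v x - v (x - \<xi>))) \<longlongrightarrow> 0) (at 0)" using v(1) by (simp add: L2ul_s_def)
    moreover have "e / 4 > 0" using e by simp
    ultimately have "\<forall>\<^sub>F \<xi> in at 0. dist (l2ul_norm (\<lambda>x. v x - v (x - \<xi>))) 0 < e / 4"
      unfolding tendsto_iff by blast
    then show "\<forall>\<^sub>F \<xi> in at 0. dist (l2ul_norm (\<lambda>x. u x - u (x - \<xi>))) 0 < e"
    proof eventually_elim
      case (elim \<xi>)
      note dw = L2ul_w_diff_translate[OF L2ul_sD[OF v(1)], of \<xi>] L2ul_w_translate[OF d, of \<xi>]
      have eq: "(\<lambda>x. u x - u (x - \<xi>)) = (\<lambda>x. (v x - v (x - \<xi>)) + (d x + - d (x - \<xi>)))"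
        by (auto simp: d_def)
      have "l2ul_norm (\<lambda>x. u x - u (x - \<xi>)) \<le> l2ul_norm (\<lambda>x. v x - v (x - \<xi>)) + (l2ul_norm d + l2ul_norm (\<lambda>x. - d (x - \<xi>)))"
        unfolding eq
        using L2ul_w_add(2)[OF dw(1) L2ul_w_add(1)[OF d neg(1)[OF dw(2)]]] L2ul_w_add(2)[OF d neg(1)[OF dw(2)]]
        by linarith
      moreover have "l2ul_norm (\<lambda>x. - d (x - \<xi>)) \<le> l2ul_norm d"
        using neg(2)[OF dw(2)] by (simp add: l2ul_norm_translate)
      moreover have "l2ul_norm d \<le> e / 4" using v(2) by (simp add: d_def)
      ultimately have "l2ul_norm (\<lambda>x. u x - u (x - \<xi>)) < e" using elim e by (simp add: dist_real_def)
      moreover have "0 \<le> l2ul_norm (\<lambda>x. u x - u (x - \<xi>))"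
        by (rule l2ul_norm_nonneg[OF L2ul_w_diff_translate[OF w]])
      ultimately show ?case by (simp add: dist_real_def)
    qed
  qed
  then show ?thesis using w by (simp add: L2ul_s_def)
qed

section \<open>The space of equivalence classes\<close>

lemma rep_l2uls_in: "rep_l2uls u \<in> L2ul_s"
  using Quotient3_rep_reflp[OF Quotient3_l2uls, of u] by (simp add: l2uls_rel_def)

lemma rep_abs_l2uls: "f \<in> L2ul_s \<Longrightarrow> AE x in lborel. rep_l2uls (abs_l2uls f) x = f x"
  using Quotient3_rep_abs[OF Quotient3_l2uls, of f] by (simp add: l2uls_rel_def)

lemma abs_rep_l2uls: "abs_l2uls (rep_l2uls u) = u"
  by (rule Quotient3_abs_rep[OF Quotient3_l2uls])

lemma rel_rep: "l2uls_rel (rep_l2uls u) (rep_l2uls u)"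
  by (simp add: l2uls_rel_def rep_l2uls_in)

lemma rep_l2uls_add: "AE x in lborel. rep_l2uls (u + v) x = rep_l2uls u x + rep_l2uls v x"
  using rep_abs_l2uls[OF L2ul_s_add[OF rep_l2uls_in[of u] rep_l2uls_in[of v]]] plus_l2uls.abs_eq[OF rel_rep[of u] rel_rep[of v]]
  by (simp add: abs_rep_l2uls)

lemma rep_l2uls_scaleR: "AE x in lborel. rep_l2uls (r *\<^sub>R u) x = r *\<^sub>R rep_l2uls u x"
  using rep_abs_l2uls[OF L2ul_s_map[OF bounded_linear_scaleR_right rep_l2uls_in[of u]], of r] scaleR_l2uls.abs_eq[OF rel_rep[of u], of r]
  by (simp add: abs_rep_l2uls)

lemma rep_l2uls_diff: "AE x in lborel. rep_l2uls (u - v) x = rep_l2uls u x - rep_l2uls v x"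
  using rep_l2uls_add[of u "-1 *\<^sub>R v"] rep_l2uls_scaleR[of "-1" v]
  by eventually_elim simp

lemma norm_l2uls_rep: "norm u = l2ul_norm (rep_l2uls u)"
  using norm_l2uls.abs_eq[OF rel_rep[of u]] by (simp add: abs_rep_l2uls)

lemma L2ul_w_diff: "f \<in> L2ul_w \<Longrightarrow> g \<in> L2ul_w \<Longrightarrow> (\<lambda>x. f x - g x) \<in> L2ul_w"
proof -
  assume f: "f \<in> L2ul_w" and g: "g \<in> L2ul_w"
  have "(\<lambda>x. - g x) \<in> L2ul_w"
    using L2ul_w_dominated[OF g, of "\<lambda>x. - g x" 1] L2ul_w_measurable[OF g] by auto
  from L2ul_w_add(1)[OF f this] show ?thesis by simp
qed

lemma norm_l2uls_diff: "norm (u - v) = l2ul_norm (\<lambda>x. rep_l2uls u x - rep_l2uls v x)"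
  unfolding norm_l2uls_rep
  by (rule l2ul_norm_cong_AE[OF L2ul_sD[OF rep_l2uls_in] L2ul_w_diff[OF L2ul_sD[OF rep_l2uls_in] L2ul_sD[OF rep_l2uls_in]] rep_l2uls_diff])

lemma Cauchy_subseq_geometric:
  fixes X :: "nat \<Rightarrow> 'a::real_normed_vector"
  assumes X: "Cauchy X"
  obtains r where "strict_mono r" "\<And>n. norm (X (r (Suc n)) - X (r n)) < (1 / 2) ^ n"
proof -
  have "\<exists>N. \<forall>i\<ge>N. \<forall>j\<ge>N. norm (X i - X j) < (1 / 2) ^ n" for n
    by (rule CauchyD[OF X]) simp
  then obtain N where N: "\<And>n i j. i \<ge> N n \<Longrightarrow> j \<ge> N n \<Longrightarrow> norm (X i - X j) < (1 / 2) ^ n" by metis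
  define r where "r = rec_nat (N 0) (\<lambda>n m. max (N (Suc n)) (Suc m))"
  have r: "r 0 = N 0" "r (Suc n) = max (N (Suc n)) (Suc (r n))" for n by (simp_all add: r_def)
  have mono: "strict_mono r" by (simp add: strict_mono_Suc_iff r less_max_iff_disj)
  have ge: "N n \<le> r n" for n by (cases n) (simp_all add: r)
  have ge': "N n \<le> r (Suc n)" for n using ge[of n] strict_monoD[OF mono, of n "Suc n"] by simp
  show ?thesis
    by (rule that[OF mono N]) (use ge ge' in auto)
qed

text \<open>
  The Riesz--Fischer argument: on each unit interval the increments have a finite sum of \<open>L\<^sup>1\<close> norms.
\<close>

lemma Cauchy_subseq_AE_convergent:
  fixes X :: "nat \<Rightarrow> 'a::{banach, second_countable_topology} l2uls"
  assumes X: "\<And>k. norm (X (Suc k) - X k) \<le> (1 / 2) ^ k"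
  shows "AE x in lborel. convergent (\<lambda>k. rep_l2uls (X k) x)"
proof -
  define g where "g = (\<lambda>k x. rep_l2uls (X (Suc k)) x - rep_l2uls (X k) x)"
  have gw: "g k \<in> L2ul_w" for k
    unfolding g_def by (intro L2ul_w_diff L2ul_sD rep_l2uls_in)
  have [measurable]: "g k \<in> borel_measurable lborel" for k by (rule L2ul_w_measurable[OF gw])
  have "AE x in lborel. \<forall>n::int. x \<in> {real_of_int n..real_of_int n + 1} \<longrightarrow> summable (\<lambda>k. norm (g k x))"
    unfolding AE_all_countable
  proof
    fix n :: int
    define a where "a = real_of_int n"
    have "(\<integral>\<^sup>+x. (\<Sum>k. ennreal (indicat_real {a..a+1} x * norm (g k x))) \<partial>lborel)
        = (\<Sum>k. \<integral>\<^sup>+x. ennreal (indicat_real {a..a+1} x * norm (g k x)) \<partial>lborel)"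
      by (rule nn_integral_suminf) auto
    also have "\<dots> \<le> (\<Sum>k. ennreal ((1 / 2) ^ k))"
    proof (intro suminf_le)
      fix k
      have "l2ul_norm (g k) \<le> (1 / 2) ^ k" using X[of k] by (simp add: norm_l2uls_diff g_def)
      then show "unit_nn_integral a (\<lambda>x. norm (g k x)) \<le> ennreal ((1 / 2) ^ k)"
        using L2ul_w_nn_integral_norm[OF gw[of k], of a] by (meson ennreal_leI order_trans)
    qed auto
    also have "\<dots> < \<infinity>"
      by (subst suminf_ennreal2) (auto intro: summable_geometric)
    finally have "AE x in lborel. (\<Sum>k. ennreal (indicat_real {a..a+1} x * norm (g k x))) \<noteq> \<infinity>"
      by (intro nn_integral_PInf_AE) auto
    then show "AE x in lborel. x \<in> {real_of_int n..real_of_int n + 1} \<longrightarrow> summable (\<lambda>k. norm (g k x))"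
      unfolding a_def[symmetric]
    proof eventually_elim
      case (elim x)
      show ?case
      proof
        assume "x \<in> {a..a+1}"
        then have "(\<Sum>k. ennreal (norm (g k x))) \<noteq> top" using elim by simp
        then show "summable (\<lambda>k. norm (g k x))" by (intro summable_suminf_not_top) auto
      qed
    qed
  qed
  then show ?thesis
  proof eventually_elim
    case (elim x)
    have "summable (\<lambda>k. norm (g k x))" using elim[rule_format, of "\<lfloor>x\<rfloor>"] by auto
    then have "convergent (\<lambda>n. \<Sum>k<n. g k x)" by (simp add: summable_norm_cancel summable_iff_convergent[symmetric])
    moreover have "(\<Sum>k<n. g k x) = rep_l2uls (X n) x - rep_l2uls (X 0) x" for n
      unfolding g_def by (rule sum_lessThan_telescope)
    ultimately have "convergent (\<lambda>n. rep_l2uls (X n) x - rep_l2uls (X 0) x)" by simp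
    then show ?case using convergent_diff_const_right_iff by blast
  qed
qed

text \<open>
  The almost everywhere limit \<open>u\<close> of a rapidly converging subsequence is the limit of the whole
  sequence by Fatou's lemma, applied on each unit interval with the same bound.
\<close>

instance l2uls :: ("{banach, second_countable_topology}") banach
proof
  fix X :: "nat \<Rightarrow> 'a l2uls"
  assume X: "Cauchy X"
  obtain r where r: "strict_mono r" "\<And>n. norm (X (r (Suc n)) - X (r n)) < (1 / 2) ^ n"
    by (rule Cauchy_subseq_geometric[OF X], rule that)
  define f where "f = (\<lambda>n. rep_l2uls (X n))"
  have fs: "f n \<in> L2ul_s" for n by (simp add: f_def rep_l2uls_in)
  have [measurable]: "f n \<in> borel_measurable lborel" for n by (rule L2ul_w_measurable[OF L2ul_sD[OF fs]])
  define u where "u = (\<lambda>x. lim (\<lambda>k. f (r k) x))"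
  have [measurable]: "u \<in> borel_measurable lborel" unfolding u_def by measurable
  have conv: "AE x in lborel. (\<lambda>k. f (r k) x) \<longlonglongrightarrow> u x"
    using Cauchy_subseq_AE_convergent[of "\<lambda>k. X (r k)"] less_imp_le[OF r(2)]
    by (simp add: f_def u_def convergent_LIMSEQ_iff)
  have close: "(\<lambda>x. u x - f m x) \<in> L2ul_w" "l2ul_norm (\<lambda>x. u x - f m x) \<le> e"
    if e: "e > 0" and m: "\<And>k. k \<ge> m \<Longrightarrow> norm (X k - X m) \<le> e" for e m
  proof -
    have "unit_nn_integral a (\<lambda>x. (norm (u x - f m x))\<^sup>2) \<le> ennreal (e\<^sup>2)" for a
    proof -
      have "unit_nn_integral a (\<lambda>x. (norm (u x - f m x))\<^sup>2)
          = (\<integral>\<^sup>+x. liminf (\<lambda>k. ennreal (indicat_real {a..a+1} x * (norm (f (r k) x - f m x))\<^sup>2)) \<partial>lborel)"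
      proof (rule nn_integral_cong_AE)
        show "AE x in lborel. ennreal (indicat_real {a..a+1} x * (norm (u x - f m x))\<^sup>2)
            = liminf (\<lambda>k. ennreal (indicat_real {a..a+1} x * (norm (f (r k) x - f m x))\<^sup>2))"
          using conv
        proof eventually_elim
          case (elim x)
          have "(\<lambda>k. ennreal (indicat_real {a..a+1} x * (norm (f (r k) x - f m x))\<^sup>2))
              \<longlonglongrightarrow> ennreal (indicat_real {a..a+1} x * (norm (u x - f m x))\<^sup>2)"
            by (intro tendsto_ennrealI tendsto_intros elim)
          then show ?case using lim_imp_Liminf[OF trivial_limit_sequentially] by metis
        qed
      qed
      also have "\<dots> \<le> liminf (\<lambda>k. \<integral>\<^sup>+x. ennreal (indicat_real {a..a+1} x * (norm (f (r k) x - f m x))\<^sup>2) \<partial>lborel)"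
        by (rule nn_integral_liminf) measurable
      also have "\<dots> \<le> ennreal (e\<^sup>2)"
      proof (rule order_trans[OF Liminf_mono])
        have "\<forall>\<^sub>F k in sequentially. r k \<ge> m"
          using seq_suble[OF r(1)] by (intro eventually_sequentiallyI[of m]) (meson order_trans)
        then show "\<forall>\<^sub>F k in sequentially. unit_nn_integral a (\<lambda>x. (norm (f (r k) x - f m x))\<^sup>2) \<le> ennreal (e\<^sup>2)"
        proof eventually_elim
          case (elim k)
          have w: "(\<lambda>x. f (r k) x - f m x) \<in> L2ul_w" by (intro L2ul_w_diff L2ul_sD fs)
          have "l2_norm_on a (\<lambda>x. f (r k) x - f m x) \<le> norm (X (r k) - X m)"
            using l2_norm_on_le[OF w, of a] by (simp add: norm_l2uls_diff f_def)
          also have "\<dots> \<le> e" by (rule m[OF elim])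
          finally show ?case
            unfolding L2ul_w_nn_integral[OF w] by (intro ennreal_leI power_mono) auto
        qed
      qed (simp add: Liminf_const)
      finally show ?thesis .
    qed
    then show "(\<lambda>x. u x - f m x) \<in> L2ul_w" "l2ul_norm (\<lambda>x. u x - f m x) \<le> e"
      using e by (intro L2ul_w_nn_integralI[of "\<lambda>x. u x - f m x" e]; simp)+
  qed
  have ex: "\<exists>M. \<forall>m\<ge>M. \<forall>k\<ge>m. norm (X k - X m) \<le> e" if "e > 0" for e
    using CauchyD[OF X that] by (meson less_imp_le order_trans)
  obtain M where "\<forall>k\<ge>M. norm (X k - X M) \<le> 1" using ex[of 1] by auto
  then have "(\<lambda>x. (u x - f M x) + f M x) \<in> L2ul_w"
    by (intro L2ul_w_add(1) close(1)[of 1] L2ul_sD fs) auto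
  then have uw: "u \<in> L2ul_w" by simp
  have us: "u \<in> L2ul_s"
  proof (rule L2ul_s_limit[OF uw])
    fix e :: real assume e: "e > 0"
    obtain M where "\<forall>k\<ge>M. norm (X k - X M) \<le> e" using ex[OF e] by auto
    then show "\<exists>v\<in>L2ul_s. l2ul_norm (\<lambda>x. u x - v x) \<le> e" using close(2)[OF e, of M] fs by auto
  qed
  have "X \<longlonglongrightarrow> abs_l2uls u"
  proof (rule LIMSEQ_I)
    fix e :: real assume e: "e > 0"
    then have e2: "e / 2 > 0" by simp
    obtain M where M: "\<forall>m\<ge>M. \<forall>k\<ge>m. norm (X k - X m) \<le> e / 2" using ex[OF e2] by auto
    have "norm (X m - abs_l2uls u) < e" if "m \<ge> M" for m
    proof -
      have "norm (abs_l2uls u - X m) = l2ul_norm (\<lambda>x. rep_l2uls (abs_l2uls u) x - f m x)"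
        by (simp add: norm_l2uls_diff f_def)
      also have "\<dots> = l2ul_norm (\<lambda>x. u x - f m x)"
        by (rule l2ul_norm_cong_AE[OF L2ul_w_diff[OF L2ul_sD[OF rep_l2uls_in] L2ul_sD[OF fs]] L2ul_w_diff[OF uw L2ul_sD[OF fs]]])
          (use rep_abs_l2uls[OF us] in \<open>auto elim!: eventually_mono\<close>)
      also have "\<dots> \<le> e / 2" using M that by (intro close(2)[OF e2]) auto
      finally show ?thesis using e by (simp add: norm_minus_commute)
    qed
    then show "\<exists>no. \<forall>n\<ge>no. norm (X n - abs_l2uls u) < e" by blast
  qed
  then show "convergent X" by (auto simp: convergent_def)
qed

section \<open>Translations and multiplication operators\<close>

lift_definition translate :: "real \<Rightarrow> 'a::{banach, second_countable_topology} l2uls \<Rightarrow> 'a l2uls" is "\<lambda>s u x. u (x - s)"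
proof -
  fix s :: real and f g :: "real \<Rightarrow> 'a"
  assume "l2uls_rel f g"
  then show "l2uls_rel (\<lambda>x. f (x - s)) (\<lambda>x. g (x - s))"
    by (simp add: l2uls_rel_def L2ul_s_translate AE_translate[of "\<lambda>x. f x = g x"])
qed

lemma bounded_linear_translate: "bounded_linear (translate s)"
proof (rule bounded_linear_intro[where K = 1])
  fix u v :: "'a l2uls" and r :: real
  show "translate s (u + v) = translate s u + translate s v"
    by transfer (simp add: l2uls_rel_def L2ul_s_translate L2ul_s_add)
  show "translate s (r *\<^sub>R u) = r *\<^sub>R translate s u"
    by transfer (simp add: l2uls_rel_def L2ul_s_translate L2ul_s_map[OF bounded_linear_scaleR_right])
  show "norm (translate s u) \<le> norm u * 1"
    by transfer (simp add: l2ul_norm_translate)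
qed

definition translation :: "real \<Rightarrow> 'a::{banach, second_countable_topology} l2uls \<Rightarrow>\<^sub>L 'a l2uls" where
  "translation s = Blinfun (translate s)"

lemma translation_apply [simp]: "blinfun_apply (translation s) = translate s"
  by (simp add: translation_def bounded_linear_Blinfun_apply bounded_linear_translate)

interpretation translation: isometry_group "translation :: real \<Rightarrow> 'a::{banach, second_countable_topology} l2uls \<Rightarrow>\<^sub>L 'a l2uls"
proof
  fix s t and u :: "'a l2uls"
  show "translation 0 u = u" unfolding translation_apply by transfer (simp add: l2uls_rel_def)
  show "translation (s + t) u = translation s (translation t u)"
    unfolding translation_apply by transfer (simp add: l2uls_rel_def L2ul_s_translate algebra_simps)
  show "norm (translation s u) = norm u"
    unfolding translation_apply by transfer (simp add: l2ul_norm_translate)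
  have "((\<lambda>s. norm (u - translate s u)) \<longlongrightarrow> 0) (at 0)"
    unfolding minus_l2uls_def by transfer (simp add: l2uls_rel_def L2ul_s_def)
  then have "((\<lambda>s. translate s u - u) \<longlongrightarrow> 0) (at 0)"
    unfolding norm_minus_commute[of u] by (rule tendsto_norm_zero_cancel)
  then show "((\<lambda>s. translation s u) \<longlongrightarrow> u) (at 0)" by (simp add: LIM_zero_iff)
qed

lemma complex_translation:
  "complex_isometry_group (translation :: real \<Rightarrow> 'a::{complex_normed_vector, banach, second_countable_topology} l2uls \<Rightarrow>\<^sub>L 'a l2uls)"
proof
  fix s c and u :: "'a l2uls"
  show "translation s (c *\<^sub>C u) = c *\<^sub>C translation s u"
    unfolding translation_apply
    by transfer (simp add: l2uls_rel_def L2ul_s_translate L2ul_s_map[OF bounded_linear_scaleC])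
qed

lemma bounded_linear_l2uls_map:
  fixes B :: "'a::{banach, second_countable_topology} \<Rightarrow>\<^sub>L 'b::{banach, second_countable_topology}"
  shows "bounded_linear (l2uls_map B)"
proof (rule bounded_linear_intro[where K = "norm B"])
  fix u v :: "'a l2uls" and r :: real
  note [simp] = L2ul_s_map[OF blinfun.bounded_linear_right]
  show "l2uls_map B (u + v) = l2uls_map B u + l2uls_map B v"
    by transfer (simp add: l2uls_rel_def blinfun.add_right L2ul_s_add)
  show "l2uls_map B (r *\<^sub>R u) = r *\<^sub>R l2uls_map B u"
    by transfer (simp add: l2uls_rel_def blinfun.scaleR_right L2ul_s_map[OF bounded_linear_scaleR_right])
  define f where "f = rep_l2uls u"
  have f: "f \<in> L2ul_s" "l2uls_rel f f" "u = abs_l2uls f"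
    by (simp_all add: f_def rep_l2uls_in rel_rep abs_rep_l2uls)
  have Bf: "(\<lambda>x. B (f x)) \<in> L2ul_s" by (simp add: f)
  have "l2ul_norm (\<lambda>x. B (f x)) \<le> norm B * l2ul_norm f"
    by (rule L2ul_w_dominated(2)[OF L2ul_sD[OF f(1)] L2ul_w_measurable[OF L2ul_sD[OF Bf]]]) (auto intro: norm_blinfun)
  then show "norm (l2uls_map B u) \<le> norm u * norm B"
    using Bf by (simp add: f(3) l2uls_map.abs_eq[OF f(2)] norm_l2uls.abs_eq[OF f(2)] norm_l2uls.abs_eq l2uls_rel_def mult.commute)
qed

definition mult_op :: "('a::{banach, second_countable_topology} \<Rightarrow>\<^sub>L 'a) \<Rightarrow> 'a l2uls \<Rightarrow>\<^sub>L 'a l2uls" where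
  "mult_op B = Blinfun (l2uls_map B)"

lemma mult_op_apply [simp]: "blinfun_apply (mult_op B) = l2uls_map B"
  by (simp add: mult_op_def bounded_linear_Blinfun_apply bounded_linear_l2uls_map)

lemma mult_op_translation: "mult_op B (translation s u) = translation s (mult_op B u)"
  unfolding mult_op_apply translation_apply
  by transfer (simp add: l2uls_rel_def L2ul_s_translate L2ul_s_map[OF blinfun.bounded_linear_right])

lemma mult_op_scaleC:
  fixes B :: "'a::{complex_normed_vector, banach, second_countable_topology} \<Rightarrow>\<^sub>L 'a"
  assumes B: "\<And>c x. B (c *\<^sub>C x) = c *\<^sub>C B x"
  shows "mult_op B (c *\<^sub>C u) = c *\<^sub>C mult_op B u"
proof -
  define f where "f = rep_l2uls u"
  have u: "u = abs_l2uls f" and f: "l2uls_rel f f" by (simp_all add: f_def abs_rep_l2uls rel_rep)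
  have cf: "l2uls_rel (\<lambda>x. c *\<^sub>C f x) (\<lambda>x. c *\<^sub>C f x)" and Bf: "l2uls_rel (\<lambda>x. B (f x)) (\<lambda>x. B (f x))"
    using f by (auto simp: l2uls_rel_def L2ul_s_map[OF bounded_linear_scaleC] L2ul_s_map[OF blinfun.bounded_linear_right])
  show ?thesis
    unfolding mult_op_apply u
    by (simp add: scaleC_l2uls.abs_eq[OF f] l2uls_map.abs_eq[OF f] l2uls_map.abs_eq[OF cf] scaleC_l2uls.abs_eq[OF Bf] B)
qed

section \<open>Weak derivatives and the generator of translations\<close>

text \<open>
  The pairing with test functions, with values in the target space; on test functions it carries
  translations and weak derivatives over to \<open>\<phi>\<close>.
\<close>

definition pairing :: "(real \<Rightarrow> real) \<Rightarrow> 'a::{banach, second_countable_topology} l2uls \<Rightarrow> 'a" where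
  "pairing \<phi> u = (LBINT x. \<phi> x *\<^sub>R rep_l2uls u x)"

lemma rep_measurable [measurable]: "rep_l2uls u \<in> borel_measurable borel"
  using L2ul_w_measurable[OF L2ul_sD[OF rep_l2uls_in[of u]]] by simp

lemma pairing_cong_AE:
  assumes "\<phi> \<in> borel_measurable borel" "f \<in> borel_measurable borel" "AE x in lborel. rep_l2uls u x = f x"
  shows "pairing \<phi> u = (LBINT x. \<phi> x *\<^sub>R f x)"
proof -
  note [measurable] = assms(1,2)
  show ?thesis unfolding pairing_def
    by (rule integral_cong_AE) (use assms(3) in \<open>auto elim: eventually_mono\<close>)
qed

lemma pairing_integrable:
  assumes "\<phi> \<in> test_functions"
  shows "integrable lborel (\<lambda>x. \<phi> x *\<^sub>R rep_l2uls u x)"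
proof -
  obtain M N where "\<And>x. \<bar>\<phi> x\<bar> \<le> M" "\<And>x. real N < \<bar>x\<bar> \<Longrightarrow> \<phi> x = 0"
    using test_function_bounds[OF assms] by metis
  then show ?thesis
    by (rule integral_compact_support_bound(1)[OF L2ul_sD[OF rep_l2uls_in] test_function_measurable[OF assms]])
qed

lemma bounded_linear_pairing:
  assumes \<phi>: "\<phi> \<in> test_functions"
  shows "bounded_linear (pairing \<phi>)"
proof -
  note [measurable] = test_function_measurable[OF \<phi>]
  obtain M N where MN: "\<And>x. \<bar>\<phi> x\<bar> \<le> M" "\<And>x. real N < \<bar>x\<bar> \<Longrightarrow> \<phi> x = 0"
    using test_function_bounds[OF \<phi>] by metis
  show ?thesis
  proof (rule bounded_linear_intro[where K = "M * (2 * real N + 1)"])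
    fix u v :: "'a l2uls" and r :: real
    have "pairing \<phi> (u + v) = (LBINT x. \<phi> x *\<^sub>R (rep_l2uls u x + rep_l2uls v x))"
      by (rule pairing_cong_AE[OF test_function_measurable[OF \<phi>] _ rep_l2uls_add]) measurable
    then show "pairing \<phi> (u + v) = pairing \<phi> u + pairing \<phi> v"
      by (simp add: pairing_def scaleR_add_right pairing_integrable \<phi>)
    have "pairing \<phi> (r *\<^sub>R u) = (LBINT x. \<phi> x *\<^sub>R (r *\<^sub>R rep_l2uls u x))"
      by (rule pairing_cong_AE[OF test_function_measurable[OF \<phi>] _ rep_l2uls_scaleR]) measurable
    also have "\<dots> = (LBINT x. r *\<^sub>R (\<phi> x *\<^sub>R rep_l2uls u x))" by (simp add: mult.commute)
    finally show "pairing \<phi> (r *\<^sub>R u) = r *\<^sub>R pairing \<phi> u"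
      by (simp only: pairing_def integral_scaleR_right)
    show "norm (pairing \<phi> u) \<le> norm u * (M * (2 * real N + 1))"
      using integral_compact_support_bound(2)[OF L2ul_sD[OF rep_l2uls_in[of u]] test_function_measurable[OF \<phi>] MN]
      by (simp add: pairing_def norm_l2uls_rep mult.commute)
  qed
qed

lemma rep_translate: "AE x in lborel. rep_l2uls (translate s u) x = rep_l2uls u (x - s)"
  using rep_abs_l2uls[OF L2ul_s_translate[OF rep_l2uls_in[of u]], of s] translate.abs_eq[OF rel_rep[of u], of s]
  by (simp add: abs_rep_l2uls)

lemma pairing_translate:
  assumes \<phi>: "\<phi> \<in> borel_measurable borel"
  shows "pairing \<phi> (translate s u) = pairing (\<lambda>x. \<phi> (x + s)) u"
proof -
  note [measurable] = \<phi>
  have "pairing \<phi> (translate s u) = (LBINT x. \<phi> x *\<^sub>R rep_l2uls u (x - s))"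
    by (rule pairing_cong_AE[OF \<phi> _ rep_translate]) measurable
  also have "\<dots> = (LBINT x. \<phi> (s + 1 * x) *\<^sub>R rep_l2uls u (s + 1 * x - s))"
    by (subst lborel_integral_real_affine[where c=1 and t=s]) auto
  finally show ?thesis by (simp add: pairing_def add.commute)
qed

text \<open>
  After moving the translation to \<open>\<phi>\<close>, the second order Taylor bound for \<open>\<phi>\<close> applies on a fixed
  bounded interval.
\<close>

lemma pairing_orbit_derivative:
  fixes u :: "'a::{banach, second_countable_topology} l2uls"
  assumes \<phi>: "\<phi> \<in> test_functions"
  shows "((\<lambda>s. pairing \<phi> (translate s u)) has_vector_derivative pairing (deriv \<phi>) (translate s u)) (at s)"
proof -
  have [measurable]: "\<phi> \<in> borel_measurable borel" "deriv \<phi> \<in> borel_measurable borel"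
    by (intro test_function_measurable deriv_test_function \<phi>)+
  obtain M where M: "\<And>x. \<bar>deriv (deriv \<phi>) x\<bar> \<le> M"
    using test_function_bounds[OF deriv_test_function[OF deriv_test_function[OF \<phi>]]] by metis
  obtain N where N: "\<And>x. real N < \<bar>x\<bar> \<Longrightarrow> \<phi> x = 0" using test_function_bounds[OF \<phi>] by metis
  obtain N' where N': "\<And>x. real N' < \<bar>x\<bar> \<Longrightarrow> deriv \<phi> x = 0"
    using test_function_bounds[OF deriv_test_function[OF \<phi>]] by metis
  have 0: "((\<lambda>s. pairing \<phi> (translate s w)) has_vector_derivative pairing (deriv \<phi>) w) (at 0)" for w :: "'a l2uls"
    unfolding has_vector_derivative_def
  proof (rule has_derivative_quadratic)
    define K where "K = N + N' + 1"
    fix h :: real assume h: "norm h < 1"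
    define \<theta> where "\<theta> = (\<lambda>x. \<phi> (x + h) - \<phi> x - h * deriv \<phi> x)"
    have sh: "(\<lambda>x. \<phi> (x + h)) \<in> test_functions" using affine_test_function[OF \<phi>, of 1 h] by simp
    have "pairing \<phi> (translate (0 + h) w) - pairing \<phi> (translate 0 w) - h *\<^sub>R pairing (deriv \<phi>) w
        = pairing (\<lambda>x. \<phi> (x + h)) w - pairing \<phi> w - h *\<^sub>R pairing (deriv \<phi>) w"
      by (simp add: pairing_translate)
    also have "\<dots> = (LBINT x. \<theta> x *\<^sub>R rep_l2uls w x)"
      unfolding pairing_def \<theta>_def
      by (simp add: scaleR_diff_left pairing_integrable \<phi> sh deriv_test_function scaleR_scaleR[symmetric] del: scaleR_scaleR)
    also have "norm \<dots> \<le> (M * h\<^sup>2) * (2 * real K + 1) * l2ul_norm (rep_l2uls w)"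
    proof (rule integral_compact_support_bound(2)[OF L2ul_sD[OF rep_l2uls_in]])
      show "\<theta> \<in> borel_measurable borel" unfolding \<theta>_def by measurable
      show "\<bar>\<theta> x\<bar> \<le> M * h\<^sup>2" for x unfolding \<theta>_def by (rule test_function_Taylor[OF \<phi> M])
      show "\<theta> x = 0" if "real K < \<bar>x\<bar>" for x
        using that h N[of "x + h"] N[of x] N'[of x] by (simp add: \<theta>_def K_def)
    qed
    finally show "norm (pairing \<phi> (translate (0 + h) w) - pairing \<phi> (translate 0 w) - h *\<^sub>R pairing (deriv \<phi>) w)
        \<le> (M * (2 * real K + 1) * l2ul_norm (rep_l2uls w)) * (norm h)\<^sup>2"
      by (simp add: mult_ac)
  qed (auto intro: bounded_linear_scaleR_left)
  have "((\<lambda>r. pairing \<phi> (translate (r + - s) (translate s u))) has_vector_derivative pairing (deriv \<phi>) (translate s u)) (at s)"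
    by (rule has_vector_derivative_shift[of "\<lambda>r. pairing \<phi> (translate r (translate s u))"]) (simp add: 0)
  moreover have "translate (r + - s) (translate s u) = translate r u" for r
    using translation.U_add[of "r - s" s u] by simp
  ultimately show ?thesis by simp
qed

text \<open>
  If all pairings vanish, then for a bump \<open>\<rho> \<ge> 0\<close> supported in \<open>[-h, h]\<close> the convolution \<open>\<rho> * f\<close>
  is zero, so \<open>(\<integral>\<rho>) f(x) = \<integral> \<rho>(s) (f(x) - f(x - s)) ds\<close>. By Tonelli the \<open>L\<^sup>1\<close> norm of \<open>f\<close> on a unit
  interval is at most the largest distance of \<open>f\<close> to its translates by \<open>|s| < h\<close>, which tends to
  zero with \<open>h\<close> by the definition of \<open>L\<^sup>2\<^sub>u\<^sub>l\<^sub>-\<^sub>s\<close>.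
\<close>

lemma pairing_separates:
  fixes w :: "'a::{banach, second_countable_topology} l2uls"
  assumes 0: "\<And>\<phi>. \<phi> \<in> test_functions \<Longrightarrow> pairing \<phi> w = 0"
  shows "w = 0"
proof -
  define f where "f = rep_l2uls w"
  have fs: "f \<in> L2ul_s" by (simp add: f_def rep_l2uls_in)
  note fw = L2ul_sD[OF fs]
  have [measurable]: "f \<in> borel_measurable borel" by (simp add: f_def)
  have small: "unit_nn_integral a (\<lambda>x. norm (f x)) \<le> ennreal e" if e: "e > 0" for a e
  proof -
    have "((\<lambda>\<xi>. l2ul_norm (\<lambda>x. f x - f (x - \<xi>))) \<longlongrightarrow> 0) (at 0)" using fs by (simp add: L2ul_s_def)
    then have "\<forall>\<^sub>F \<xi> in at 0. dist (l2ul_norm (\<lambda>x. f x - f (x - \<xi>))) 0 < e"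
      using e unfolding tendsto_iff by blast
    then obtain h where h: "h > 0" "\<And>\<xi>. \<xi> \<noteq> 0 \<Longrightarrow> \<bar>\<xi>\<bar> < h \<Longrightarrow> l2ul_norm (\<lambda>x. f x - f (x - \<xi>)) < e"
      unfolding eventually_at by (auto simp: dist_real_def abs_less_iff)
    define \<rho> where "\<rho> = (\<lambda>x. bump 1 0 (x / h))"
    have \<rho>t: "\<rho> \<in> test_functions"
      using affine_test_function[OF bump_test_function[of 1 0], of "1 / h" 0] h(1) by (simp add: \<rho>_def)
    have [measurable]: "\<rho> \<in> borel_measurable borel" by (rule test_function_measurable[OF \<rho>t])
    have \<rho>0: "\<rho> x \<ge> 0" and \<rho>h: "\<rho> x \<noteq> 0 \<longleftrightarrow> \<bar>x\<bar> < h" for x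
      using h(1) by (auto simp: \<rho>_def bump_def)
    obtain M N where MN: "\<And>x. \<bar>\<rho> x\<bar> \<le> M" "\<And>x. real N < \<bar>x\<bar> \<Longrightarrow> \<rho> x = 0"
      using test_function_bounds[OF \<rho>t] by metis
    define c where "c = (\<integral>\<^sup>+s. ennreal (\<rho> s) \<partial>lborel)"
    have \<rho>int: "integrable lborel \<rho>"
    proof (rule Bochner_Integration.integrable_bound[of _ "\<lambda>x. M * indicat_real {- real N..real N} x"])
      show "AE x in lborel. norm (\<rho> x) \<le> norm (M * indicat_real {- real N..real N} x)"
      proof (rule AE_I2)
        fix x show "norm (\<rho> x) \<le> norm (M * indicat_real {- real N..real N} x)"
          using MN(1)[of x] MN(2)[of x] by (auto simp: indicator_def abs_le_iff not_le split: if_splits)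
      qed
    qed auto
    have c1: "c = ennreal (LBINT s. \<rho> s)"
      unfolding c_def by (rule nn_integral_eq_integral[OF \<rho>int]) (simp add: \<rho>0)
    have c0: "c \<noteq> 0"
    proof
      assume "c = 0"
      then have "AE x in lborel. \<rho> x = 0"
        unfolding c_def by (subst (asm) nn_integral_0_iff_AE) (auto simp: \<rho>0 antisym)
      then have "AE x in lborel. x \<notin> {-h<..<h}"
      proof eventually_elim
        case (elim x)
        then have "\<not> \<bar>x\<bar> < h" using \<rho>h[of x] by blast
        then show ?case by auto
      qed
      then have "{-h<..<h} \<in> null_sets lborel" by (subst AE_iff_null_sets) auto
      then have "emeasure lborel {-h<..<h} = 0" by (rule null_setsD1)
      then show False using h(1) by simp
    qed
    have pt: "c * ennreal (norm (f x)) \<le> (\<integral>\<^sup>+s. ennreal (\<rho> s) * ennreal (norm (f x - f (x - s))) \<partial>lborel)" for x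
    proof -
      have i1: "integrable lborel (\<lambda>s. \<rho> s *\<^sub>R f x)" using \<rho>int by simp
      have \<psi>: "(\<lambda>y. \<rho> (-1 * y + x)) \<in> test_functions" using affine_test_function[OF \<rho>t, of "-1" x] by simp
      have i2: "integrable lborel (\<lambda>y. \<rho> (-1 * y + x) *\<^sub>R f y)"
        unfolding f_def by (rule pairing_integrable[OF \<psi>])
      have "integrable lborel (\<lambda>s. \<rho> (-1 * (x + -1 * s) + x) *\<^sub>R f (x + -1 * s))"
        by (rule lborel_integrable_real_affine[OF i2]) simp
      then have i3: "integrable lborel (\<lambda>s. \<rho> s *\<^sub>R f (x - s))" by simp
      have "(LBINT s. \<rho> s *\<^sub>R f (x - s)) = (LBINT y. \<rho> (-1 * y + x) *\<^sub>R f y)"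
        by (subst lborel_integral_real_affine[where c="-1" and t=x]) auto
      also have "\<dots> = 0" using 0[OF \<psi>] by (simp add: pairing_def f_def)
      finally have "(LBINT s. \<rho> s) *\<^sub>R f x = (LBINT s. \<rho> s *\<^sub>R (f x - f (x - s)))"
        using i1 i3 Bochner_Integration.integral_scaleR_left[of "f x" lborel \<rho>] \<rho>int by (simp add: scaleR_diff_right)
      moreover have "(LBINT s. \<rho> s) \<ge> 0" by (intro Bochner_Integration.integral_nonneg \<rho>0)
      ultimately have "c * ennreal (norm (f x)) = ennreal (norm (LBINT s. \<rho> s *\<^sub>R (f x - f (x - s))))"
        unfolding c1 by (metis abs_of_nonneg ennreal_mult norm_ge_zero norm_scaleR)
      also have "\<dots> \<le> (\<integral>\<^sup>+s. ennreal (norm (\<rho> s *\<^sub>R (f x - f (x - s)))) \<partial>lborel)"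
        by (rule integral_norm_bound_ennreal) (use Bochner_Integration.integrable_diff[OF i1 i3] in \<open>simp add: scaleR_diff_right\<close>)
      finally show ?thesis by (simp add: \<rho>0 ennreal_mult)
    qed
    have "c * unit_nn_integral a (\<lambda>x. norm (f x))
        = (\<integral>\<^sup>+x. indicator {a..a+1} x * (c * ennreal (norm (f x))) \<partial>lborel)"
      by (subst nn_integral_cmult[symmetric]) (auto intro!: nn_integral_cong simp: indicator_def)
    also have "\<dots> \<le> (\<integral>\<^sup>+x. indicator {a..a+1} x * (\<integral>\<^sup>+s. ennreal (\<rho> s) * ennreal (norm (f x - f (x - s))) \<partial>lborel) \<partial>lborel)"
      by (intro nn_integral_mono mult_left_mono pt) auto
    also have "\<dots> = (\<integral>\<^sup>+x. (\<integral>\<^sup>+s. indicator {a..a+1} x * (ennreal (\<rho> s) * ennreal (norm (f x - f (x - s)))) \<partial>lborel) \<partial>lborel)"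
      by (intro nn_integral_cong nn_integral_cmult[symmetric]) measurable
    also have "\<dots> = (\<integral>\<^sup>+s. (\<integral>\<^sup>+x. indicator {a..a+1} x * (ennreal (\<rho> s) * ennreal (norm (f x - f (x - s)))) \<partial>lborel) \<partial>lborel)"
      by (rule lborel_pair.Fubini') measurable
    also have "\<dots> \<le> (\<integral>\<^sup>+s. ennreal (\<rho> s) * ennreal e \<partial>lborel)"
    proof (rule nn_integral_mono)
      fix s
      have "(\<integral>\<^sup>+x. indicator {a..a+1} x * (ennreal (\<rho> s) * ennreal (norm (f x - f (x - s)))) \<partial>lborel)
          = ennreal (\<rho> s) * unit_nn_integral a (\<lambda>x. norm (f x - f (x - s)))"
        by (subst nn_integral_cmult[symmetric]) (auto intro!: nn_integral_cong simp: indicator_def)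
      also have "\<dots> \<le> ennreal (\<rho> s) * ennreal e"
      proof (cases "\<bar>s\<bar> < h \<and> s \<noteq> 0")
        case True
        have "unit_nn_integral a (\<lambda>x. norm (f x - f (x - s))) \<le> ennreal e"
          using L2ul_w_nn_integral_norm[OF L2ul_w_diff_translate[OF fw], of a s] h(2)[of s] True
          by (meson ennreal_leI less_imp_le order_trans)
        then show ?thesis by (intro mult_left_mono) auto
      next
        case False
        then consider "s = 0" | "\<rho> s = 0" using \<rho>h[of s] by blast
        then show ?thesis by cases auto
      qed
      finally show "(\<integral>\<^sup>+x. indicator {a..a+1} x * (ennreal (\<rho> s) * ennreal (norm (f x - f (x - s)))) \<partial>lborel)
          \<le> ennreal (\<rho> s) * ennreal e" .
    qed
    also have "\<dots> = c * ennreal e" unfolding c_def by (rule nn_integral_multc) measurable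
    finally show ?thesis
      by (subst (asm) ennreal_mult_le_mult_iff) (use c0 c1 in auto)
  qed
  have "AE x in lborel. \<forall>n::int. x \<in> {real_of_int n..real_of_int n + 1} \<longrightarrow> f x = 0"
    unfolding AE_all_countable
  proof
    fix n :: int
    define a where "a = real_of_int n"
    have "unit_nn_integral a (\<lambda>x. norm (f x)) \<le> 0"
    proof (rule ennreal_le_epsilon)
      fix e :: real assume "0 < e"
      then show "unit_nn_integral a (\<lambda>x. norm (f x)) \<le> 0 + ennreal e"
        using small by simp
    qed
    then have "unit_nn_integral a (\<lambda>x. norm (f x)) = 0" by simp
    then have "AE x in lborel. ennreal (indicat_real {a..a+1} x * norm (f x)) = 0"
      by (subst (asm) nn_integral_0_iff_AE) auto
    then show "AE x in lborel. x \<in> {real_of_int n..real_of_int n + 1} \<longrightarrow> f x = 0"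
      unfolding a_def[symmetric] by eventually_elim (auto simp: indicator_def ennreal_eq_0_iff)
  qed
  then have ae: "AE x in lborel. f x = 0"
  proof eventually_elim
    case (elim x)
    from elim[rule_format, of "\<lfloor>x\<rfloor>"] show ?case by auto
  qed
  have "norm w = 0" using ae l2ul_norm_eq_0[OF fw] by (simp add: norm_l2uls_rep f_def)
  then show ?thesis by simp
qed

lemma has_weak_deriv_rep:
  "has_weak_deriv k (rep_l2uls u) (rep_l2uls v) \<longleftrightarrow>
    (\<forall>\<phi>\<in>test_functions. pairing ((deriv ^^ k) \<phi>) u = (-1) ^ k *\<^sub>R pairing \<phi> v)"
  by (simp add: has_weak_deriv_def pairing_def)

text \<open>
  The sign comes from \<open>U(s) u = u(\<cdot> - s)\<close>. From right to left, differentiate the pairing of an orbit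
  in two ways. From left to right, the pairings of \<open>U(s) u + \<integral> U(r) v dr\<close> have derivative zero in
  \<open>s\<close>; as they separate points this function is constant, and the integral is differentiable.
\<close>

lemma weak_deriv_iff_gen:
  "has_weak_deriv 1 (rep_l2uls u) (rep_l2uls v) \<longleftrightarrow> translation.gen u (- v)"
proof
  assume g: "translation.gen u (- v)"
  show "has_weak_deriv 1 (rep_l2uls u) (rep_l2uls v)"
    unfolding has_weak_deriv_rep
  proof
    fix \<phi> :: "real \<Rightarrow> real" assume \<phi>: "\<phi> \<in> test_functions"
    interpret P: bounded_linear "pairing \<phi> :: 'a l2uls \<Rightarrow> 'a" by (rule bounded_linear_pairing[OF \<phi>])
    have "((\<lambda>s. pairing \<phi> (translate s u)) has_vector_derivative pairing \<phi> (- v)) (at 0)"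
      using P.has_vector_derivative[OF g[unfolded translation.gen_def]] by simp
    moreover have "((\<lambda>s. pairing \<phi> (translate s u)) has_vector_derivative pairing (deriv \<phi>) u) (at 0)"
      using pairing_orbit_derivative[OF \<phi>, of u 0] translation.U_0[of u] by simp
    ultimately have "pairing (deriv \<phi>) u = pairing \<phi> (- v)" by (rule vector_derivative_unique_at[rotated])
    then show "pairing ((deriv ^^ 1) \<phi>) u = (- 1) ^ 1 *\<^sub>R pairing \<phi> v" by (simp add: P.neg)
  qed
next
  assume w: "has_weak_deriv 1 (rep_l2uls u) (rep_l2uls v)"
  define F where "F = (\<lambda>s. integral {-1..s} (\<lambda>r. translation r v))"
  have F: "(F has_vector_derivative translation s v) (at s)" if "-1 < s" "s < 1" for s
    unfolding F_def using that by (rule translation.orbit_primitive)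
  have const: "translation s u + F s = u + F 0" if s: "s \<in> {-1<..<1}" for s
  proof -
    have "translation s u + F s - (u + F 0) = 0"
    proof (rule pairing_separates)
      fix \<phi> :: "real \<Rightarrow> real" assume \<phi>: "\<phi> \<in> test_functions"
      interpret P: bounded_linear "pairing \<phi> :: 'a l2uls \<Rightarrow> 'a" by (rule bounded_linear_pairing[OF \<phi>])
      have "(\<lambda>s. pairing \<phi> (translate s u) + pairing \<phi> (F s)) s = (\<lambda>s. pairing \<phi> (translate s u) + pairing \<phi> (F s)) 0"
      proof (rule has_derivative_zero_unique[of "{-1<..<1}"])
        fix r :: real assume r: "r \<in> {-1<..<1}"
        have meas: "\<phi> \<in> borel_measurable borel" "deriv \<phi> \<in> borel_measurable borel"
          by (intro test_function_measurable deriv_test_function \<phi>)+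
        have sh: "(\<lambda>x. \<phi> (x + r)) \<in> test_functions" using affine_test_function[OF \<phi>, of 1 r] by simp
        have dsh: "deriv (\<lambda>x. \<phi> (x + r)) = (\<lambda>x. deriv \<phi> (x + r))"
        proof
          fix x show "deriv (\<lambda>x. \<phi> (x + r)) x = deriv \<phi> (x + r)"
            using DERIV_shift[of \<phi> "deriv \<phi> (x + r)" x r] test_function_deriv[OF \<phi>] by (intro DERIV_imp_deriv) simp
        qed
        have "pairing (deriv (\<lambda>x. \<phi> (x + r))) u = - pairing (\<lambda>x. \<phi> (x + r)) v"
          using w sh unfolding has_weak_deriv_rep by fastforce
        then have "pairing (deriv \<phi>) (translate r u) = - pairing \<phi> (translate r v)"
          by (simp add: pairing_translate meas dsh)
        moreover have "((\<lambda>s. pairing \<phi> (translate s u) + pairing \<phi> (F s)) has_vector_derivative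
            pairing (deriv \<phi>) (translate r u) + pairing \<phi> (translate r v)) (at r)"
          using r F[of r] P.has_vector_derivative
          by (intro has_vector_derivative_add pairing_orbit_derivative \<phi>) auto
        ultimately show "((\<lambda>s. pairing \<phi> (translate s u) + pairing \<phi> (F s)) has_derivative (\<lambda>h. 0)) (at r within {-1<..<1})"
          by (auto simp: has_vector_derivative_def intro: has_derivative_at_withinI)
      qed (use s in auto)
      then show "pairing \<phi> (translation s u + F s - (u + F 0)) = 0"
        using translation.U_0[of u] by (simp add: P.add P.diff)
    qed
    then show ?thesis by simp
  qed
  have "((\<lambda>s. (u + F 0) - F s) has_vector_derivative 0 - translation 0 v) (at 0)"
    by (intro has_vector_derivative_diff has_vector_derivative_const F) auto
  then have "((\<lambda>s. translation s u) has_vector_derivative 0 - translation 0 v) (at 0)"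
  proof (rule has_vector_derivative_transform_within_open[of _ _ _ "{-1<..<1}"])
    show "u + F 0 - F s = translation s u" if "s \<in> {-1<..<1}" for s
      using const[OF that] by (simp add: algebra_simps)
  qed auto
  then show "translation.gen u (- v)" unfolding translation.gen_def by (simp only: translation.U_0 diff_0)
qed

lemma second_weak_deriv:
  assumes "has_weak_deriv 1 (rep_l2uls u) (rep_l2uls v)"
  shows "has_weak_deriv 2 (rep_l2uls u) (rep_l2uls w) \<longleftrightarrow> has_weak_deriv 1 (rep_l2uls v) (rep_l2uls w)"
proof -
  have 1: "pairing (deriv (deriv \<phi>)) u = - pairing (deriv \<phi>) v" if "\<phi> \<in> test_functions" for \<phi>
    using assms deriv_test_function[OF that] unfolding has_weak_deriv_rep by fastforce
  have 2: "(deriv ^^ 2) \<phi> = deriv (deriv \<phi>)" "(deriv ^^ 1) \<phi> = deriv \<phi>" for \<phi> :: "real \<Rightarrow> real"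
    by (simp_all add: numeral_2_eq_2)
  show ?thesis
    unfolding has_weak_deriv_rep 2
    by (intro ball_cong refl) (auto simp: 1 minus_equation_iff)
qed

lemma weak_deriv_unique:
  assumes "has_weak_deriv k (rep_l2uls u) (rep_l2uls v)" "has_weak_deriv k (rep_l2uls u) (rep_l2uls w)"
  shows "v = w"
proof -
  have "v - w = 0"
  proof (rule pairing_separates)
    fix \<phi> :: "real \<Rightarrow> real" assume \<phi>: "\<phi> \<in> test_functions"
    interpret P: bounded_linear "pairing \<phi> :: 'a l2uls \<Rightarrow> 'a" by (rule bounded_linear_pairing[OF \<phi>])
    have "(-1) ^ k *\<^sub>R pairing \<phi> v = (-1) ^ k *\<^sub>R pairing \<phi> w"
      using assms \<phi> unfolding has_weak_deriv_rep by metis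
    then show "pairing \<phi> (v - w) = 0" by (simp add: P.diff)
  qed
  then show ?thesis by simp
qed

lemma weak_deriv_eq:
  assumes "has_weak_deriv k (rep_l2uls u) (rep_l2uls v)"
  shows "weak_deriv k u = v"
  unfolding weak_deriv_def using assms by (rule the_equality) (rule weak_deriv_unique[OF _ assms])

lemma H2ul_s_iff: "u \<in> H2ul_s \<longleftrightarrow> (\<exists>v w. translation.gen u v \<and> translation.gen v w)"
proof
  assume "u \<in> H2ul_s"
  then have H: "\<exists>v. has_weak_deriv k (rep_l2uls u) (rep_l2uls v)" if "k \<le> 2" for k
    using that by (simp add: H2ul_s_def)
  obtain v where v: "has_weak_deriv 1 (rep_l2uls u) (rep_l2uls v)" using H[of 1] by auto
  obtain w where "has_weak_deriv 2 (rep_l2uls u) (rep_l2uls w)" using H[of 2] by auto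
  then have "has_weak_deriv 1 (rep_l2uls v) (rep_l2uls w)" using second_weak_deriv[OF v] by simp
  then have "translation.gen v (- w)" by (simp add: weak_deriv_iff_gen[unfolded One_nat_def])
  then have "translation.gen (- v) w" using translation.gen_scaleR[of v "- w" "-1"] by simp
  then show "\<exists>v w. translation.gen u v \<and> translation.gen v w" using v weak_deriv_iff_gen by blast
next
  assume "\<exists>v w. translation.gen u v \<and> translation.gen v w"
  then obtain v w where g: "translation.gen u v" "translation.gen v w" by blast
  have 1: "has_weak_deriv 1 (rep_l2uls u) (rep_l2uls (- v))" using g(1) by (simp add: weak_deriv_iff_gen[unfolded One_nat_def])
  have "translation.gen (- v) (- w)" using translation.gen_scaleR[OF g(2), of "-1"] by simp
  then have 2: "has_weak_deriv 2 (rep_l2uls u) (rep_l2uls w)"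
    using second_weak_deriv[OF 1] weak_deriv_iff_gen by blast
  have 0: "has_weak_deriv 0 (rep_l2uls u) (rep_l2uls u)" by (simp add: has_weak_deriv_rep)
  show "u \<in> H2ul_s"
    unfolding H2ul_s_def
  proof (clarify)
    fix k :: nat assume "k \<le> 2"
    then consider "k = 0" | "k = 1" | "k = 2" by linarith
    then show "\<exists>v. has_weak_deriv k (rep_l2uls u) (rep_l2uls v)" using 0 1 2 by cases auto
  qed
qed

lemma weak_deriv_2_gen:
  assumes "translation.gen u v" "translation.gen v w"
  shows "weak_deriv 2 u = w"
proof (rule weak_deriv_eq)
  have 1: "has_weak_deriv 1 (rep_l2uls u) (rep_l2uls (- v))" using assms(1) by (simp add: weak_deriv_iff_gen[unfolded One_nat_def])
  have "translation.gen (- v) (- w)" using translation.gen_scaleR[OF assms(2), of "-1"] by simp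
  then show "has_weak_deriv 2 (rep_l2uls u) (rep_l2uls w)"
    using second_weak_deriv[OF 1] weak_deriv_iff_gen by blast
qed

text \<open>
  The graph norm condition holds for all \<open>u\<close>, because \<open>y \<mapsto> (y, B y)\<close> is bounded.
\<close>

lemma A_dom_iff: "u \<in> A_dom B \<longleftrightarrow> (\<exists>v w. translation.gen u v \<and> translation.gen v w)"
proof -
  have "bounded_linear (\<lambda>y. (y, B y))"
    by (intro bounded_linear_Pair bounded_linear_ident blinfun.bounded_linear_right)
  then have "(\<lambda>x. (rep_l2uls u x, B (rep_l2uls u x))) \<in> L2ul_s"
    by (rule L2ul_s_map[OF _ rep_l2uls_in])
  then show ?thesis by (simp add: A_dom_def L2ul_s_dom_def H2ul_s_iff)
qed

lemma A_op_gen: "translation.gen u v \<Longrightarrow> translation.gen v w \<Longrightarrow> A_op B u = mult_op B u - w"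
  by (simp add: A_op_def weak_deriv_2_gen)

theorem proposition1p3:
  fixes B :: "'a::{real_inner, banach, second_countable_topology} \<Rightarrow>\<^sub>L 'a"
    and C :: "'b::{complex_inner, banach, second_countable_topology} \<Rightarrow>\<^sub>L 'b"
  shows "(positive_selfadjoint B \<longrightarrow>
            real_sectorial (A_dom B) (A_op B) \<and> real_generates_analytic_semigroup (A_dom B) (A_op B)) \<and>
         (complex_positive_selfadjoint C \<longrightarrow>
            sectorial (A_dom C) (A_op C) \<and> generates_analytic_semigroup (A_dom C) (A_op C))"
proof (intro conjI impI)
  interpret R: real_perturbed_square translation "mult_op B" "A_dom B" "A_op B"
    by unfold_locales (rule mult_op_translation A_dom_iff A_op_gen; assumption?)+
  show "real_sectorial (A_dom B) (A_op B)" by (rule R.real_sectorial)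
  show "real_generates_analytic_semigroup (A_dom B) (A_op B)" by (rule R.real_generates)
next
  assume "complex_positive_selfadjoint C"
  then have C: "C (c *\<^sub>C x) = c *\<^sub>C C x" for c x by (simp add: complex_positive_selfadjoint_def)
  have "perturbed_square translation (mult_op C) (A_dom C) (A_op C)"
    by (intro perturbed_square.intro complex_translation perturbed_square_axioms.intro mult_op_translation
        mult_op_scaleC A_dom_iff A_op_gen C)
  then show "sectorial (A_dom C) (A_op C)" "generates_analytic_semigroup (A_dom C) (A_op C)"
    by (rule perturbed_square.sectorial perturbed_square.generates)+
qed

end
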